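(* Let $f,g:\mathbb{R}\to\mathbb{R}$ be smooth. Consider a smooth non-characteristic traveling wave $(t,x)\mapsto \underline{u}(x-\sigma t)$ of $$\partial_t u+\partial_x(f(u))=g(u)\qquad (t\ge 0,\ x\in\mathbb{R}),$$ of profile $\underline u$ and speed $\sigma$, with endstates $u_-$ at $-\infty$ and $u_+$ at $+\infty$ such that $g'(u_-)<0<g'(u_+)$. Set $\kappa^+:=g'(u_+)/|f'(u_+)-\sigma|$ and let $\kappa\ge\kappa^+$. There exist positive $C$ and $\delta_0$ such that if $u_0\in BUC^1(\mathbb{R})$ with $(u_0-\underline u)/\Omega_\kappa^+\in BUC^0(\mathbb{R})$, $\partial_x(u_0-\underline u)/\Omega_\kappa^+\in BUC^0(\mathbb{R})$ and $$E_{0,\kappa}:=\|u_0-\underline u\|_{W^{1,\infty}_{\kappa,+}}\le\delta_0,$$ then the solution $u$ to $\partial_t u+\partial_x(f(u))=g(u)$ starting from $u(0,\cdot)=u_0$ satisfies, for any $t\ge 0$, $$\|u(t,\cdot+\sigma t)-\underline u\|_{W^{1,\infty}_{\kappa,+}}\le C\,E_{0,\kappa}\,\exp(-t\,\omega_\kappa),$$ where $$\omega_\kappa:=\min\big(\{|g'(u_-)|,\ (\kappa-\kappa^+)\,|f'(u_+)-\sigma|\}\big).$$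
   Context: Solutions are Kružkov entropy solutions. A traveling wave is a solution of the form $u(t,x)=\underline u(x-\sigma t)$; its endstates are the limits of $\underline u$ at $\pm\infty$. The wave is non-characteristic if $f'(v)\neq\sigma$ for every value $v$ of $\underline u$ and for both endstates. $BUC^0(\mathbb{R})$ denotes the bounded uniformly continuous functions, $BUC^1(\mathbb{R})$ the $\mathcal{C}^1$ functions that are in $BUC^0(\mathbb{R})$ together with their first derivative. For $\kappa>0$, $\Omega_\kappa(x):=\exp(-\kappa x)$ and $\Omega^+_\kappa(x):=\Omega_\kappa(x_+)=\exp(-\kappa x_+)$ where $x_+=\max(\{x,0\})$; and $$\|v\|_{W^{1,\infty}_{\kappa,+}}:=\|(\Omega_\kappa^+)^{-1}(v,\partial_x v)\|_{L^\infty(\mathbb{R})}.$$ *)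

theory Defs
  imports "HOL-Analysis.Analysis" "HOL-Probability.Essential_Supremum"
begin

definition smooth :: "(real \<Rightarrow> real) \<Rightarrow> bool" where
  "smooth f \<longleftrightarrow> (\<forall>n x. ((deriv ^^ n) f) differentiable (at x))"

definition BUC0 :: "(real \<Rightarrow> real) \<Rightarrow> bool" where
  "BUC0 v \<longleftrightarrow> bounded (range v) \<and> uniformly_continuous_on UNIV v"

definition BUC1 :: "(real \<Rightarrow> real) \<Rightarrow> bool" where
  "BUC1 v \<longleftrightarrow> (\<forall>x. v differentiable (at x)) \<and> BUC0 v \<and> BUC0 (deriv v)"

(* phi is a C^1 function of (t,x), with compact support in {t > 0} and with partial
   derivatives phit, phix. *)
definition test_function ::
  "(real \<times> real \<Rightarrow> real) \<Rightarrow> (real \<times> real \<Rightarrow> real) \<Rightarrow> (real \<times> real \<Rightarrow> real) \<Rightarrow> bool" where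
  "test_function \<phi> \<phi>t \<phi>x \<longleftrightarrow>
     (\<forall>z. (\<phi> has_derivative (\<lambda>(s, y). \<phi>t z * s + \<phi>x z * y)) (at z)) \<and>
     continuous_on UNIV \<phi>t \<and> continuous_on UNIV \<phi>x \<and>
     (\<exists>K. compact K \<and> K \<subseteq> {0<..} \<times> UNIV \<and> (\<forall>z. z \<notin> K \<longrightarrow> \<phi> z = 0))"

(* Global Kruzkov entropy solutions of u_t + f(u)_x = g(u) with initial datum u0, in the class
   L^infinity_loc([0,infinity); L^infinity(R)) and C([0,infinity); L^1_loc(R)). The time continuity
   gives a meaning, up to null sets of x, to u t for every t >= 0, and to the initial condition.
   Values of u at negative times are irrelevant. *)
definition entropy_solution ::
  "(real \<Rightarrow> real) \<Rightarrow> (real \<Rightarrow> real) \<Rightarrow> (real \<Rightarrow> real) \<Rightarrow> (real \<Rightarrow> real \<Rightarrow> real) \<Rightarrow> bool" where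
  "entropy_solution f g u0 u \<longleftrightarrow>
     set_borel_measurable borel ({0..} \<times> UNIV) (\<lambda>(t, x). u t x) \<and>
     (\<forall>T. \<exists>M. \<forall>t\<in>{0..T}. AE x in lborel. \<bar>u t x\<bar> \<le> M) \<and>
     (\<forall>s\<ge>0. \<forall>R. ((\<lambda>t. LINT x:{-R..R}|lborel. \<bar>u t x - u s x\<bar>) \<longlongrightarrow> 0) (at s within {0..})) \<and>
     (AE x in lborel. u 0 x = u0 x) \<and>
     (\<forall>k \<phi> \<phi>t \<phi>x. test_function \<phi> \<phi>t \<phi>x \<and> (\<forall>z. \<phi> z \<ge> 0) \<longrightarrow>
        0 \<le> (LINT (t, x)|lborel.
               \<bar>u t x - k\<bar> * \<phi>t (t, x)
               + sgn (u t x - k) * (f (u t x) - f k) * \<phi>x (t, x)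
               + sgn (u t x - k) * g (u t x) * \<phi> (t, x)))"

definition traveling_wave ::
  "(real \<Rightarrow> real) \<Rightarrow> (real \<Rightarrow> real) \<Rightarrow> (real \<Rightarrow> real) \<Rightarrow> real \<Rightarrow> real \<Rightarrow> real \<Rightarrow> bool" where
  "traveling_wave f g U \<sigma> um up \<longleftrightarrow>
     entropy_solution f g U (\<lambda>t x. U (x - \<sigma> * t)) \<and>
     (U \<longlongrightarrow> um) at_bot \<and> (U \<longlongrightarrow> up) at_top"

definition non_characteristic ::
  "(real \<Rightarrow> real) \<Rightarrow> (real \<Rightarrow> real) \<Rightarrow> real \<Rightarrow> real \<Rightarrow> real \<Rightarrow> bool" where
  "non_characteristic f U \<sigma> um up \<longleftrightarrow>
     (\<forall>x. deriv f (U x) \<noteq> \<sigma>) \<and> deriv f um \<noteq> \<sigma> \<and> deriv f up \<noteq> \<sigma>"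

definition Omega :: "real \<Rightarrow> real \<Rightarrow> real" where
  "Omega \<kappa> x = exp (- \<kappa> * x)"

definition Omega_plus :: "real \<Rightarrow> real \<Rightarrow> real" where
  "Omega_plus \<kappa> x = Omega \<kappa> (max x 0)"

definition weak_derivative :: "(real \<Rightarrow> real) \<Rightarrow> (real \<Rightarrow> real) \<Rightarrow> bool" where
  "weak_derivative v w \<longleftrightarrow>
     (\<forall>a b. set_integrable lborel {a..b} v \<and> set_integrable lborel {a..b} w) \<and>
     (\<forall>\<phi> \<phi>'. (\<forall>x. (\<phi> has_real_derivative \<phi>' x) (at x)) \<and> continuous_on UNIV \<phi>' \<and>
        (\<exists>R. \<forall>x. \<bar>x\<bar> > R \<longrightarrow> \<phi> x = 0) \<longrightarrow>
        (LINT x|lborel. v x * \<phi>' x) = - (LINT x|lborel. w x * \<phi> x))"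

(* The weighted norm, for the weak derivative of v and the Euclidean norm of pairs. Weak derivatives
   agree almost everywhere, so the infimum is over a single value, or over the empty set (hence
   infinite) if v has no weak derivative. *)
definition W1inf_norm :: "real \<Rightarrow> (real \<Rightarrow> real) \<Rightarrow> ennreal" where
  "W1inf_norm \<kappa> v =
     (INF w \<in> {w. weak_derivative v w}.
        esssup lborel (\<lambda>x. ennreal (norm (v x, w x) / Omega_plus \<kappa> x)))"

definition kappa_plus :: "(real \<Rightarrow> real) \<Rightarrow> (real \<Rightarrow> real) \<Rightarrow> real \<Rightarrow> real \<Rightarrow> real" where
  "kappa_plus f g \<sigma> up = deriv g up / \<bar>deriv f up - \<sigma>\<bar>"

definition decay_rate ::
  "(real \<Rightarrow> real) \<Rightarrow> (real \<Rightarrow> real) \<Rightarrow> real \<Rightarrow> real \<Rightarrow> real \<Rightarrow> real \<Rightarrow> real" where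
  "decay_rate f g \<sigma> um up \<kappa> =
     min \<bar>deriv g um\<bar> ((\<kappa> - kappa_plus f g \<sigma> up) * \<bar>deriv f up - \<sigma>\<bar>)"

end

theory Submission
  imports Defs "HOL-Real_Asymp.Real_Asymp"
begin

text \<open>
  In the frame of the wave the equation reads \<open>w\<^sub>t + a(w) w\<^sub>y = g(w)\<close> with \<open>a = f' - \<sigma>\<close>, and the
  profile solves \<open>U' = h(U)\<close>, \<open>h = g / a\<close>. The signs of \<open>g'\<close> at the endstates force \<open>a < 0\<close> on the closed
  range of the wave, so that characteristics travel to the left. Since \<open>dw/dy = h(w)\<close> along them, the orbits in
  the \<open>(y, w)\<close> plane are explicit in a coordinate \<open>H\<close> that linearizes \<open>h\<close> at the left endstate
  (\<open>h H' = \<mu> H\<close>, so \<open>H (U y) = exp (\<mu> y)\<close>, \<open>\<mu> = h'(u\<^sub>-)\<close>): the quantity \<open>H(w) exp (- \<mu> y)\<close> is constant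
  along a characteristic. With \<open>b = - 1 / a\<close> and \<open>\<beta>' h = b - b(u\<^sub>-)\<close>, so is \<open>t + b(u\<^sub>-) y + \<beta>(w)\<close>, which
  gives the travel time. Hence the solution is obtained by inverting one scalar monotone function, and its
  perturbation of \<open>U\<close> is the initial one times an explicit weight. No rate is lost: up to a bounded error, the
  travel time is the distance travelled in \<open>y < 0\<close> over \<open>\<bar>a(u\<^sub>-)\<bar>\<close> plus that travelled in \<open>y > 0\<close> over
  \<open>\<bar>a(u\<^sub>+)\<bar>\<close>. The resulting \<open>C\<^sup>1\<close> solution is an entropy
  solution, and it is the only one by the relative entropy inequality in a cone.
\<close>

subsection \<open>Test functions and classical solutions\<close>

text \<open>The reaction is unstable at \<open>up\<close>: a perturbation that travels left through
  a distance d there grows like exp (\<nu> d), where \<open>\<nu>\<close> is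
  \<open>kappa_plus\<close>. A datum of size exp (- \<kappa> s) at the foot s pays for this growth
  exactly when \<open>\<nu> \<le> \<kappa>\<close>; the surplus \<open>\<kappa> - \<nu>\<close> per
  unit length, times the speed, is one entry of \<open>decay_rate\<close>, and the damping near
  \<open>um\<close> is the other. The obstacle is that \<open>H\<close> is regular through
  \<open>um\<close> but blows up at \<open>up\<close>. Values may overshoot \<open>um\<close> but
  must stay below \<open>up\<close>, although the gap between the profile and \<open>up\<close>
  closes like exp (- \<nu> y); again \<open>\<nu> \<le> \<kappa>\<close> keeps the datum inside the
  gap. No shock forms because the travel time has a derivative in the foot that stays bounded below
  when the datum is close to the profile together with its first derivative. Decreasing waves are
  reduced to increasing ones by the reflection u to -u. Uniqueness has to be shown against arbitrary
  entropy solutions, known only almost everywhere at each time.\<close>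

lemma smooth_has_deriv: "smooth f \<Longrightarrow> (f has_real_derivative deriv f x) (at x)"
  unfolding smooth_def
  by (drule spec[of _ 0]) (auto simp: DERIV_deriv_iff_real_differentiable)

lemma smooth_deriv: "smooth f \<Longrightarrow> smooth (deriv f)"
  unfolding smooth_def by (metis comp_apply funpow_Suc_right)

lemma smooth_continuous_on: "smooth f \<Longrightarrow> continuous_on A f"
  by (meson DERIV_isCont continuous_at_imp_continuous_on smooth_has_deriv)

abbreviation has_gradient :: "(real \<times> real \<Rightarrow> real) \<Rightarrow> real \<Rightarrow> real \<Rightarrow> real \<times> real \<Rightarrow> bool" where
  "has_gradient \<phi> p q z \<equiv> (\<phi> has_derivative (\<lambda>(s, y). p * s + q * y)) (at z)"

text \<open>The half plane is open because test functions have compact support in t > 0, so that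
  integrations by parts see no boundary. Continuity up to t = 0 is handled separately, through the
  initial condition.\<close>

definition C1_half_plane :: "(real \<times> real \<Rightarrow> real) \<Rightarrow> (real \<times> real \<Rightarrow> real) \<Rightarrow> (real \<times> real \<Rightarrow> real) \<Rightarrow> bool" where
  "C1_half_plane c ct cx \<longleftrightarrow>
     (\<forall>z. 0 < fst z \<longrightarrow> has_gradient c (ct z) (cx z) z) \<and>
     continuous_on ({0<..} \<times> UNIV) ct \<and> continuous_on ({0<..} \<times> UNIV) cx"

lemma open_half_plane: "open ({0<..} \<times> UNIV :: (real \<times> real) set)"
  by (intro open_Times) auto

lemma has_gradient_unique:
  assumes "has_gradient \<phi> p q z" "has_gradient \<phi> p' q' z"
  shows "p = p'" "q = q'"
proof -
  have "(\<lambda>(s, y). p * s + q * y) = (\<lambda>(s, y). p' * s + q' * y)"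
    using has_derivative_unique assms by blast
  from fun_cong[OF this, of "(1,0)"] fun_cong[OF this, of "(0,1)"]
  show "p = p'" "q = q'" by auto
qed

lemma has_gradient_mult:
  assumes "has_gradient a p q z" "has_gradient b p' q' z"
  shows "has_gradient (\<lambda>z. a z * b z) (p * b z + a z * p') (q * b z + a z * q') z"
  using has_derivative_mult[OF assms]
  by (rule has_derivative_eq_rhs) (auto simp: fun_eq_iff algebra_simps)

lemma has_gradient_compose:
  assumes "has_gradient a p q z" "(j has_real_derivative d) (at (a z))"
  shows "has_gradient (\<lambda>z. j (a z)) (d * p) (d * q) z"
  using DERIV_compose_FDERIV[OF assms(2,1)]
  by (rule has_derivative_eq_rhs) (auto simp: fun_eq_iff algebra_simps)

lemma has_gradient_partials:
  assumes "has_gradient \<phi> p q (t, x)"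
  shows "((\<lambda>s. \<phi> (s, x)) has_real_derivative p) (at t)"
    and "((\<lambda>y. \<phi> (t, y)) has_real_derivative q) (at x)"
proof -
  have "((\<lambda>s. (s, x)) has_derivative (\<lambda>s. (s, 0))) (at t)"
    by (auto intro!: derivative_eq_intros)
  from has_derivative_compose[OF this assms]
  show "((\<lambda>s. \<phi> (s, x)) has_real_derivative p) (at t)"
    by (simp add: has_field_derivative_def)
  have "((\<lambda>y. (t, y)) has_derivative (\<lambda>s. (0, s))) (at x)"
    by (auto intro!: derivative_eq_intros)
  from has_derivative_compose[OF this assms]
  show "((\<lambda>y. \<phi> (t, y)) has_real_derivative q) (at x)"
    by (simp add: has_field_derivative_def)
qed

lemma test_functionD:
  assumes "test_function \<phi> \<phi>t \<phi>x"
  shows "has_gradient \<phi> (\<phi>t z) (\<phi>x z) z" "continuous_on UNIV \<phi>"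
    "continuous_on UNIV \<phi>t" "continuous_on UNIV \<phi>x"
proof -
  have *: "has_gradient \<phi> (\<phi>t z) (\<phi>x z) z" for z
    using assms unfolding test_function_def by blast
  show "has_gradient \<phi> (\<phi>t z) (\<phi>x z) z" by (rule *)
  show "continuous_on UNIV \<phi>"
    using has_derivative_continuous[OF *] by (rule continuous_at_imp_continuous_on[OF ballI])
qed (use assms in \<open>auto simp: test_function_def\<close>)

lemma gradient_zero_outside:
  assumes "\<And>z. has_gradient \<phi> (\<phi>t z) (\<phi>x z) z" "open S" "\<And>z. z \<in> S \<Longrightarrow> \<phi> z = 0" "z \<in> S"
  shows "\<phi>t z = 0" "\<phi>x z = 0"
proof -
  have "has_gradient \<phi> 0 0 z"
    apply (rule has_derivative_transform_within_open[where f="\<lambda>_. 0", OF _ assms(2,4)])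
    using assms(3) by (auto intro: derivative_eq_intros simp: case_prod_unfold)
  then show "\<phi>t z = 0" "\<phi>x z = 0"
    using has_gradient_unique[OF assms(1)] by blast+
qed

text \<open>A compact set is closed, so \<open>\<phi>\<close> vanishes on the open complement of
  \<open>K\<close>, and its partial derivatives vanish there as well.\<close>

lemma test_function_support:
  assumes "test_function \<phi> \<phi>t \<phi>x"
  obtains K where "compact K" "K \<subseteq> {0<..} \<times> UNIV"
    "\<And>z. z \<notin> K \<Longrightarrow> \<phi> z = 0" "\<And>z. z \<notin> K \<Longrightarrow> \<phi>t z = 0" "\<And>z. z \<notin> K \<Longrightarrow> \<phi>x z = 0"
proof -
  from assms obtain K where K: "compact K" "K \<subseteq> {0<..} \<times> UNIV" "\<And>z. z \<notin> K \<Longrightarrow> \<phi> z = 0"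
    unfolding test_function_def by blast
  have "open (- K)" using K(1) by (simp add: compact_imp_closed open_Compl)
  then have "\<phi>t z = 0 \<and> \<phi>x z = 0" if "z \<notin> K" for z
    using gradient_zero_outside[OF test_functionD(1)[OF assms], of "- K" z] K(3) that by auto
  with K that show ?thesis by metis
qed

text \<open>The open half plane and the complement of \<open>K\<close> are open and cover the plane;
  on the second set the product is 0, whatever values \<open>c\<close> takes for t \<le> 0.\<close>

lemma continuous_on_mult_supported:
  fixes c \<phi> :: "real \<times> real \<Rightarrow> real"
  assumes "continuous_on ({0<..} \<times> UNIV) c" "continuous_on UNIV \<phi>"
    and "compact K" "K \<subseteq> {0<..} \<times> UNIV" "\<And>z. z \<notin> K \<Longrightarrow> \<phi> z = 0"
  shows "continuous_on UNIV (\<lambda>z. c z * \<phi> z)"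
proof -
  have "continuous_on ({0<..} \<times> UNIV \<union> - K) (\<lambda>z. c z * \<phi> z)"
  proof (rule continuous_on_open_Un)
    show "open (- K)" using assms(3) by (simp add: compact_imp_closed open_Compl)
    show "continuous_on ({0<..} \<times> UNIV) (\<lambda>z. c z * \<phi> z)"
      by (intro continuous_intros assms continuous_on_subset[OF assms(2)]) auto
    have "continuous_on (- K) (\<lambda>z. 0::real)" by simp
    then show "continuous_on (- K) (\<lambda>z. c z * \<phi> z)"
      by (rule continuous_on_eq) (simp add: assms(5))
  qed (rule open_half_plane)
  moreover have "{0<..} \<times> UNIV \<union> - K = UNIV" using assms(4) by auto
  ultimately show ?thesis by simp
qed

lemma integrable_compact_support:
  fixes F :: "'a::euclidean_space \<Rightarrow> real"
  assumes "continuous_on UNIV F" "compact K" "\<And>z. z \<notin> K \<Longrightarrow> F z = 0"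
  shows "integrable lborel F"
proof -
  have "integrable lborel (\<lambda>x. indicator K x *\<^sub>R F x)"
    by (rule borel_integrable_compact) (auto intro: assms continuous_on_subset)
  moreover have "(\<lambda>x. indicator K x *\<^sub>R F x) = F"
    using assms(3) by (auto simp: fun_eq_iff indicator_def)
  ultimately show ?thesis by simp
qed

lemma integrable_test_function_mult:
  assumes "test_function \<phi> \<phi>t \<phi>x" "continuous_on ({0<..} \<times> UNIV) c"
  shows "integrable lborel (\<lambda>z. c z * \<phi> z)" "integrable lborel (\<lambda>z. c z * \<phi>t z)"
    "integrable lborel (\<lambda>z. c z * \<phi>x z)"
    "integrable lborel (\<lambda>z. c z * \<bar>\<phi> z\<bar>)" "integrable lborel (\<lambda>z. c z * \<bar>\<phi>t z\<bar>)"
    "integrable lborel (\<lambda>z. c z * \<bar>\<phi>x z\<bar>)"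
proof -
  obtain K where K: "compact K" "K \<subseteq> {0<..} \<times> UNIV" and
    z: "\<And>z. z \<notin> K \<Longrightarrow> \<phi> z = 0" "\<And>z. z \<notin> K \<Longrightarrow> \<phi>t z = 0" "\<And>z. z \<notin> K \<Longrightarrow> \<phi>x z = 0"
    using test_function_support[OF assms(1)] by metis
  have *: "integrable lborel (\<lambda>z. c z * h z)"
    if "continuous_on UNIV h" "\<And>z. z \<notin> K \<Longrightarrow> h z = 0" for h
    by (rule integrable_compact_support[OF _ K(1)])
      (use that in \<open>auto intro!: continuous_on_mult_supported[OF assms(2) _ K]\<close>)
  show "integrable lborel (\<lambda>z. c z * \<phi> z)" "integrable lborel (\<lambda>z. c z * \<phi>t z)"
    "integrable lborel (\<lambda>z. c z * \<phi>x z)"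
    "integrable lborel (\<lambda>z. c z * \<bar>\<phi> z\<bar>)" "integrable lborel (\<lambda>z. c z * \<bar>\<phi>t z\<bar>)"
    "integrable lborel (\<lambda>z. c z * \<bar>\<phi>x z\<bar>)"
    by (intro *; auto intro!: continuous_intros test_functionD[OF assms(1)] simp: z)+
qed

lemma test_function_integrable:
  assumes "test_function \<phi> \<phi>t \<phi>x"
  shows "integrable lborel \<phi>" "integrable lborel \<phi>t" "integrable lborel \<phi>x"
  using integrable_test_function_mult[OF assms, of "\<lambda>_. 1"] by auto

lemma C1_half_plane_continuous:
  assumes "C1_half_plane c ct cx"
  shows "continuous_on ({0<..} \<times> UNIV) c" "continuous_on ({0<..} \<times> UNIV) ct"
    "continuous_on ({0<..} \<times> UNIV) cx"
  using assms unfolding C1_half_plane_def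
  by (auto intro!: continuous_at_imp_continuous_on dest: has_derivative_continuous)

lemma C1_half_plane_compose:
  assumes "C1_half_plane c ct cx" "\<And>r. (j has_real_derivative j' r) (at r)" "continuous_on UNIV j'"
  shows "C1_half_plane (\<lambda>z. j (c z)) (\<lambda>z. j' (c z) * ct z) (\<lambda>z. j' (c z) * cx z)"
proof -
  have "continuous_on ({0<..} \<times> UNIV) (\<lambda>z. j' (c z))"
    by (rule continuous_on_compose2[OF assms(3)]) (auto intro: C1_half_plane_continuous[OF assms(1)])
  then show ?thesis
    using assms(1) unfolding C1_half_plane_def
    by (intro conjI allI impI continuous_on_mult has_gradient_compose[OF _ assms(2)]) blast+
qed

text \<open>This is how a solution that is \<open>C1_half_plane\<close> enters a test function. It
  also reduces integration by parts to the fact that the partial derivatives of a test function have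
  integral 0.\<close>

lemma test_function_mult:
  assumes "test_function \<phi> \<phi>t \<phi>x" "C1_half_plane c ct cx"
  shows "test_function (\<lambda>z. c z * \<phi> z) (\<lambda>z. ct z * \<phi> z + c z * \<phi>t z) (\<lambda>z. cx z * \<phi> z + c z * \<phi>x z)"
proof -
  obtain K where K: "compact K" "K \<subseteq> {0<..} \<times> UNIV" and
    z: "\<And>z. z \<notin> K \<Longrightarrow> \<phi> z = 0" "\<And>z. z \<notin> K \<Longrightarrow> \<phi>t z = 0" "\<And>z. z \<notin> K \<Longrightarrow> \<phi>x z = 0"
    using test_function_support[OF assms(1)] by metis
  note cont = C1_half_plane_continuous[OF assms(2)] test_functionD(2-4)[OF assms(1)]
  have "has_gradient (\<lambda>z. c z * \<phi> z) (ct z * \<phi> z + c z * \<phi>t z) (cx z * \<phi> z + c z * \<phi>x z) z" for z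
  proof (cases "z \<in> K")
    case True
    then have "0 < fst z" using K(2) by auto
    then show ?thesis
      using assms(2) test_functionD(1)[OF assms(1)] unfolding C1_half_plane_def
      by (intro has_gradient_mult) blast+
  next
    case False
    have "has_gradient (\<lambda>z. c z * \<phi> z) 0 0 z"
    proof (rule has_derivative_transform_within_open[where f="\<lambda>_. 0" and s = "- K"])
      show "open (- K)" using K(1) by (simp add: compact_imp_closed open_Compl)
    qed (use False z in \<open>auto intro: derivative_eq_intros simp: case_prod_unfold\<close>)
    then show ?thesis using z False by simp
  qed
  moreover have "continuous_on UNIV (\<lambda>z. ct z * \<phi> z + c z * \<phi>t z)"
    "continuous_on UNIV (\<lambda>z. cx z * \<phi> z + c z * \<phi>x z)"
    using z by (auto intro!: continuous_on_add continuous_on_mult_supported[OF _ _ K] cont)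
  ultimately show ?thesis
    unfolding test_function_def using K z(1) by (intro conjI allI exI[of _ K]) auto
qed

lemma integral_FTC_support:
  fixes F F' :: "real \<Rightarrow> real"
  assumes "\<And>x. (F has_real_derivative F' x) (at x)" "continuous_on UNIV F'"
    and "\<And>x. R < \<bar>x\<bar> \<Longrightarrow> F x = 0"
  shows "(LINT x|lborel. F' x) = 0"
proof -
  \<comment> \<open>The radius is enlarged so that it is positive even for negative
    \<open>R\<close>, and so that \<open>F\<close> vanishes at the two endpoints themselves.\<close>
  define r where "r = \<bar>R\<bar> + 1"
  have F0: "F x = 0" if "r \<le> \<bar>x\<bar>" for x using assms(3)[of x] that by (auto simp: r_def)
  have "F' x = 0" if "r < \<bar>x\<bar>" for x
  proof -
    have "(F has_real_derivative 0) (at x)"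
    proof (rule DERIV_cong[OF has_field_derivative_transform_within_open[where f="\<lambda>_. 0" and S="{y. r < \<bar>y\<bar>}"]])
      show "open {y. r < \<bar>y\<bar>}" by (intro open_Collect_less continuous_intros)
    qed (use that F0 in auto)
    then show ?thesis using assms(1) DERIV_unique by blast
  qed
  then have "F' x = F' x * indicator {-r..r} x" for x
    by (cases "r < \<bar>x\<bar>") (auto simp: indicator_def)
  then have "(LINT x|lborel. F' x) = (LINT x|lborel. F' x * indicator {-r..r} x)"
    by (intro Bochner_Integration.integral_cong refl) auto
  also have "\<dots> = F r - F (-r)"
    using assms(2) by (intro integral_FTC_Icc_real assms(1)) (auto simp: r_def continuous_on_eq_continuous_at)
  also have "\<dots> = 0" using F0[of r] F0[of "-r"] by (auto simp: r_def)
  finally show ?thesis .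
qed

lemma integral_test_function_partial:
  assumes "test_function \<phi> \<phi>t \<phi>x"
  shows "(LINT z|lborel. \<phi>t z) = 0" "(LINT z|lborel. \<phi>x z) = 0"
proof -
  obtain K where K: "compact K" "\<And>z. z \<notin> K \<Longrightarrow> \<phi> z = 0"
    using test_function_support[OF assms] by metis
  then obtain B where B: "\<And>z. z \<in> K \<Longrightarrow> norm z \<le> B"
    using compact_imp_bounded bounded_iff by metis
  have 0: "\<phi> (t, x) = 0" if "B < \<bar>t\<bar> \<or> B < \<bar>x\<bar>" for t x
    using K(2) B norm_fst_le[of t x] norm_snd_le[of x t] that by fastforce
  note [simp] = test_functionD(3,4)[OF assms]
  have int: "integrable (lborel \<Otimes>\<^sub>M lborel) \<phi>t" "integrable (lborel \<Otimes>\<^sub>M lborel) \<phi>x"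
    using test_function_integrable[OF assms] by (simp_all add: lborel_prod)
  have "(LINT t|lborel. \<phi>t (t, x)) = 0" for x
    by (rule integral_FTC_support[where F="\<lambda>t. \<phi> (t, x)" and R=B])
      (use 0 in \<open>auto intro!: has_gradient_partials[OF test_functionD(1)[OF assms]]
          continuous_on_compose2[OF test_functionD(3)[OF assms]] continuous_intros\<close>)
  then show "(LINT z|lborel. \<phi>t z) = 0"
    using lborel_pair.integral_snd[of "\<lambda>t x. \<phi>t (t, x)"] int by (simp add: lborel_prod)
  have "(LINT x|lborel. \<phi>x (t, x)) = 0" for t
    by (rule integral_FTC_support[where F="\<lambda>x. \<phi> (t, x)" and R=B])
      (use 0 in \<open>auto intro!: has_gradient_partials[OF test_functionD(1)[OF assms]]
          continuous_on_compose2[OF test_functionD(4)[OF assms]] continuous_intros\<close>)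
  then show "(LINT z|lborel. \<phi>x z) = 0"
    using lborel_pair.integral_fst[of "\<lambda>t x. \<phi>x (t, x)"] int by (simp add: lborel_prod)
qed

lemma integral_by_parts_test_function:
  assumes "test_function \<phi> \<phi>t \<phi>x" "C1_half_plane c ct cx" "C1_half_plane d dt dx"
  shows "(LINT z|lborel. c z * \<phi>t z + d z * \<phi>x z + (ct z + dx z) * \<phi> z) = 0"
proof -
  note int = integrable_test_function_mult[OF assms(1) C1_half_plane_continuous(1)[OF assms(2)]]
    integrable_test_function_mult[OF assms(1) C1_half_plane_continuous(2)[OF assms(2)]]
    integrable_test_function_mult[OF assms(1) C1_half_plane_continuous(1)[OF assms(3)]]
    integrable_test_function_mult[OF assms(1) C1_half_plane_continuous(3)[OF assms(3)]]
  have "(LINT z|lborel. c z * \<phi>t z + d z * \<phi>x z + (ct z + dx z) * \<phi> z) =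
    (LINT z|lborel. (ct z * \<phi> z + c z * \<phi>t z) + (dx z * \<phi> z + d z * \<phi>x z))"
    by (intro Bochner_Integration.integral_cong) (auto simp: algebra_simps)
  also have "\<dots> = (LINT z|lborel. ct z * \<phi> z + c z * \<phi>t z) + (LINT z|lborel. dx z * \<phi> z + d z * \<phi>x z)"
    by (intro Bochner_Integration.integral_add Bochner_Integration.integrable_add int)
  also have "\<dots> = 0"
    using integral_test_function_partial(1)[OF test_function_mult[OF assms(1,2)]]
      integral_test_function_partial(2)[OF test_function_mult[OF assms(1,3)]] by simp
  finally show ?thesis .
qed

section \<open>Smoothed signs and the entropy equality of a classical solution\<close>

definition smooth_sgn :: "nat \<Rightarrow> real \<Rightarrow> real" where
  "smooth_sgn n r = real n * r / sqrt (1 + (real n * r)\<^sup>2)"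

definition smooth_sgn' :: "nat \<Rightarrow> real \<Rightarrow> real" where
  "smooth_sgn' n r = real n / ((1 + (real n * r)\<^sup>2) * sqrt (1 + (real n * r)\<^sup>2))"

lemma smooth_sgn_deriv: "(smooth_sgn n has_real_derivative smooth_sgn' n r) (at r)"
proof -
  have pos: "1 + (real n * r)\<^sup>2 > 0" by (smt (verit) zero_le_power2)
  have "((\<lambda>r. real n * r / sqrt (1 + (real n * r)\<^sup>2)) has_real_derivative smooth_sgn' n r) (at r)"
    using pos
    apply (auto intro!: derivative_eq_intros simp: smooth_sgn'_def)
    apply (simp add: field_simps power2_eq_square)
    done
  then show ?thesis by (simp add: smooth_sgn_def[abs_def])
qed

lemma smooth_sgn'_continuous: "continuous_on UNIV (smooth_sgn' n)"
proof -
  have "1 + (real n * r)\<^sup>2 > 0" for r by (smt (verit) zero_le_power2)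
  then show ?thesis unfolding smooth_sgn'_def by (intro continuous_intros) (auto simp: less_le)
qed

text \<open>The second bound controls the term in which the derivative falls on the sign: this term
  is dominated uniformly in n, and it disappears in the limit although
  \<open>smooth_sgn' n 0\<close> tends to infinity.\<close>

lemma smooth_sgn_bound: "\<bar>smooth_sgn n r\<bar> \<le> 1" "\<bar>r * smooth_sgn' n r\<bar> \<le> 1"
proof -
  define x where "x = real n * r"
  have pos: "1 + x\<^sup>2 > 0" by (smt (verit) zero_le_power2)
  have 1: "\<bar>x\<bar> \<le> sqrt (1 + x\<^sup>2)" by (rule real_le_rsqrt) simp
  then show "\<bar>smooth_sgn n r\<bar> \<le> 1"
    using pos by (simp add: smooth_sgn_def x_def[symmetric] abs_mult)
  have "\<bar>r * smooth_sgn' n r\<bar> = \<bar>x\<bar> / ((1 + x\<^sup>2) * sqrt (1 + x\<^sup>2))"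
    using pos by (simp add: smooth_sgn'_def x_def[symmetric] abs_mult) (simp add: x_def abs_mult)
  also have "\<dots> \<le> 1"
    using mult_mono[of 1 "1 + x\<^sup>2" "\<bar>x\<bar>" "sqrt (1 + x\<^sup>2)"] 1 pos by (simp add: divide_le_eq_1)
  finally show "\<bar>r * smooth_sgn' n r\<bar> \<le> 1" .
qed

lemma smooth_sgn_tendsto: "(\<lambda>n. smooth_sgn n r) \<longlonglongrightarrow> sgn r"
proof -
  consider "r = 0" | "r > 0" | "r < 0" by linarith
  then show ?thesis
    unfolding smooth_sgn_def by cases (simp, real_asymp, real_asymp)
qed

lemma smooth_sgn'_tendsto: "(\<lambda>n. r * smooth_sgn' n r) \<longlonglongrightarrow> 0"
proof -
  consider "r = 0" | "r > 0" | "r < 0" by linarith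
  then show ?thesis
    unfolding smooth_sgn'_def by cases (simp, real_asymp, real_asymp)
qed

lemma Lipschitz_on_interval:
  fixes h :: "real \<Rightarrow> real"
  assumes "\<And>x. \<alpha> \<le> x \<Longrightarrow> x \<le> \<beta> \<Longrightarrow> (h has_real_derivative h' x) (at x)" "continuous_on {\<alpha>..\<beta>} h'"
  obtains L where "0 \<le> L" "\<And>x y. x \<in> {\<alpha>..\<beta>} \<Longrightarrow> y \<in> {\<alpha>..\<beta>} \<Longrightarrow> \<bar>h x - h y\<bar> \<le> L * \<bar>x - y\<bar>"
    "\<And>x. x \<in> {\<alpha>..\<beta>} \<Longrightarrow> \<bar>h' x\<bar> \<le> L"
proof -
  obtain B where B: "\<And>x. x \<in> {\<alpha>..\<beta>} \<Longrightarrow> norm (h' x) \<le> B"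
    using compact_imp_bounded[OF compact_continuous_image[OF assms(2) compact_Icc]]
    unfolding bounded_iff by blast
  then have B': "\<bar>h' x\<bar> \<le> \<bar>B\<bar>" if "x \<in> {\<alpha>..\<beta>}" for x using B[OF that] by simp
  have "norm (h x - h y) \<le> \<bar>B\<bar> * norm (x - y)" if "x \<in> {\<alpha>..\<beta>}" "y \<in> {\<alpha>..\<beta>}" for x y
    by (rule field_differentiable_bound[where S="{\<alpha>..\<beta>}" and f'=h'])
      (use that B' assms(1) in \<open>auto intro: has_field_derivative_at_within\<close>)
  with B' show ?thesis using that[of "\<bar>B\<bar>"] by simp
qed

text \<open>The chain rule is exact for the smoothed entropy pair \<open>j1\<close>,
  \<open>j2\<close>, so integration by parts gives 0 for each n; dominated convergence then replaces
  the smoothed sign by \<open>sgn\<close>. There is equality because a classical solution dissipates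
  no entropy.\<close>

lemma Kruzkov_equality_classical:
  assumes f': "\<And>x. (f has_real_derivative f' x) (at x)" "continuous_on UNIV f'"
    and c: "C1_half_plane c ct cx"
    and pde: "\<And>z. 0 < fst z \<Longrightarrow> ct z + f' (c z) * cx z = g (c z)"
    and bound: "\<And>z. 0 < fst z \<Longrightarrow> \<bar>c z\<bar> \<le> M"
    and test: "test_function \<phi> \<phi>t \<phi>x"
  shows "(LINT z|lborel. \<bar>c z - k\<bar> * \<phi>t z + sgn (c z - k) * (f (c z) - f k) * \<phi>x z
      + sgn (c z - k) * g (c z) * \<phi> z) = 0"
proof -
  note cont_c = C1_half_plane_continuous[OF c]
  have cont_f: "continuous_on UNIV f"
    using f'(1) by (meson DERIV_isCont continuous_at_imp_continuous_on)
  obtain K where K: "compact K" "K \<subseteq> {0<..} \<times> UNIV" and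
    K0: "\<And>z. z \<notin> K \<Longrightarrow> \<phi> z = 0" "\<And>z. z \<notin> K \<Longrightarrow> \<phi>t z = 0" "\<And>z. z \<notin> K \<Longrightarrow> \<phi>x z = 0"
    using test_function_support[OF test] by metis
  define \<rho> where "\<rho> = \<bar>M\<bar> + \<bar>k\<bar>"
  obtain L where L: "0 \<le> L"
    "\<And>x y. x \<in> {-\<rho>..\<rho>} \<Longrightarrow> y \<in> {-\<rho>..\<rho>} \<Longrightarrow> \<bar>f x - f y\<bar> \<le> L * \<bar>x - y\<bar>"
    "\<And>x. x \<in> {-\<rho>..\<rho>} \<Longrightarrow> \<bar>f' x\<bar> \<le> L"
    using Lipschitz_on_interval[of "-\<rho>" \<rho> f f', OF f'(1) continuous_on_subset[OF f'(2) subset_UNIV]] by blast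
  define S where "S n z = smooth_sgn n (c z - k)" for n z
  define S' where "S' n z = smooth_sgn' n (c z - k)" for n z
  define j1 where "j1 n z = (c z - k) * S n z" for n z
  define j2 where "j2 n z = (f (c z) - f k) * S n z" for n z
  define j1' where "j1' n z = S n z + (c z - k) * S' n z" for n z
  define j2' where "j2' n z = f' (c z) * S n z + (f (c z) - f k) * S' n z" for n z
  have cont_sgn: "continuous_on UNIV (smooth_sgn n)" for n
    by (meson smooth_sgn_deriv DERIV_isCont continuous_at_imp_continuous_on)
  have shift: "((\<lambda>r. smooth_sgn n (r - k)) has_real_derivative smooth_sgn' n (r - k)) (at r)" for n r
    using DERIV_shift[of "smooth_sgn n" "smooth_sgn' n (r - k)" r "- k"] smooth_sgn_deriv by simp
  have cont_shift: "continuous_on UNIV (\<lambda>r. smooth_sgn n (r - k))"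
    "continuous_on UNIV (\<lambda>r. smooth_sgn' n (r - k))" for n
    by (rule continuous_on_compose2[OF cont_sgn] continuous_on_compose2[OF smooth_sgn'_continuous];
        auto intro: continuous_intros)+
  have cont_S: "continuous_on ({0<..} \<times> UNIV) (S n)" "continuous_on ({0<..} \<times> UNIV) (S' n)" for n
    unfolding S_def[abs_def] S'_def[abs_def]
    by (rule continuous_on_compose2[OF cont_shift(1) cont_c(1) subset_UNIV]
        continuous_on_compose2[OF cont_shift(2) cont_c(1) subset_UNIV])+
  have C1: "C1_half_plane (j1 n) (\<lambda>z. j1' n z * ct z) (\<lambda>z. j1' n z * cx z)" for n
    unfolding j1_def[abs_def] S_def j1'_def S'_def
  proof (rule C1_half_plane_compose[OF c, of "\<lambda>r. (r - k) * smooth_sgn n (r - k)"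
          "\<lambda>r. smooth_sgn n (r - k) + (r - k) * smooth_sgn' n (r - k)"])
    show "((\<lambda>r. (r - k) * smooth_sgn n (r - k)) has_real_derivative
        smooth_sgn n (r - k) + (r - k) * smooth_sgn' n (r - k)) (at r)" for r
      by (rule DERIV_cong[OF DERIV_mult[OF _ shift]]) (auto intro!: derivative_eq_intros)
  qed (intro continuous_intros cont_shift)
  have C2: "C1_half_plane (j2 n) (\<lambda>z. j2' n z * ct z) (\<lambda>z. j2' n z * cx z)" for n
    unfolding j2_def[abs_def] S_def j2'_def S'_def
  proof (rule C1_half_plane_compose[OF c, of "\<lambda>r. (f r - f k) * smooth_sgn n (r - k)"
          "\<lambda>r. f' r * smooth_sgn n (r - k) + (f r - f k) * smooth_sgn' n (r - k)"])
    show "((\<lambda>r. (f r - f k) * smooth_sgn n (r - k)) has_real_derivative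
        f' r * smooth_sgn n (r - k) + (f r - f k) * smooth_sgn' n (r - k)) (at r)" for r
      by (rule DERIV_cong[OF DERIV_mult[OF _ shift]]) (auto intro!: derivative_eq_intros f')
  qed (intro continuous_intros cont_shift f'(2) cont_f)
  define I where "I n z = j1 n z * \<phi>t z + j2 n z * \<phi>x z + (j1' n z * ct z + j2' n z * cx z) * \<phi> z" for n z
  define J where "J z = \<bar>c z - k\<bar> * \<phi>t z + sgn (c z - k) * (f (c z) - f k) * \<phi>x z
      + sgn (c z - k) * g (c z) * \<phi> z" for z
  define D where "D z = \<bar>c z - k\<bar> * \<bar>\<phi>t z\<bar> + \<bar>f (c z) - f k\<bar> * \<bar>\<phi>x z\<bar>
      + (2 * \<bar>ct z\<bar> + 2 * L * \<bar>cx z\<bar>) * \<bar>\<phi> z\<bar>" for z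
  have zero: "(LINT z|lborel. I n z) = 0" for n
    unfolding I_def by (rule integral_by_parts_test_function[OF test C1 C2])
  have lim: "(\<lambda>n. I n z) \<longlonglongrightarrow> J z" for z
  proof (cases "z \<in> K")
    case True
    then have z: "0 < fst z" using K(2) by auto
    \<comment> \<open>Where \<open>c z\<close> equals \<open>k\<close> the first factor is 0;
      elsewhere the quotient by \<open>c z - k\<close> reduces this to the limit of
      \<open>r * smooth_sgn' n r\<close>.\<close>
    have fS: "(\<lambda>n. (f (c z) - f k) * S' n z) \<longlonglongrightarrow> 0"
    proof (cases "c z = k")
      case False
      have "(\<lambda>n. (f (c z) - f k) / (c z - k) * ((c z - k) * S' n z)) \<longlonglongrightarrow> (f (c z) - f k) / (c z - k) * 0"
        unfolding S'_def by (intro tendsto_intros smooth_sgn'_tendsto)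
      then show ?thesis using False by simp
    qed simp
    have "(\<lambda>n. I n z) \<longlonglongrightarrow> (c z - k) * sgn (c z - k) * \<phi>t z + (f (c z) - f k) * sgn (c z - k) * \<phi>x z
        + ((sgn (c z - k) + 0) * ct z + (f' (c z) * sgn (c z - k) + 0) * cx z) * \<phi> z"
      unfolding I_def j1_def j2_def j1'_def j2'_def
      by (intro tendsto_intros fS) (auto simp: S_def S'_def intro: smooth_sgn_tendsto smooth_sgn'_tendsto)
    moreover have "(c z - k) * sgn (c z - k) * \<phi>t z + (f (c z) - f k) * sgn (c z - k) * \<phi>x z
        + ((sgn (c z - k) + 0) * ct z + (f' (c z) * sgn (c z - k) + 0) * cx z) * \<phi> z = J z"
      using pde[OF z, symmetric] by (simp add: J_def abs_sgn algebra_simps)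
    ultimately show ?thesis by simp
  qed (simp add: I_def J_def K0)
  have dom: "norm (I n z) \<le> D z" for n z
  proof (cases "z \<in> K")
    case True
    then have z: "0 < fst z" using K(2) by auto
    have mem: "c z \<in> {-\<rho>..\<rho>}" "k \<in> {-\<rho>..\<rho>}" using bound[OF z] by (auto simp: \<rho>_def abs_le_iff)
    have S1: "\<bar>S n z\<bar> \<le> 1" and S2: "\<bar>(c z - k) * S' n z\<bar> \<le> 1"
      by (auto simp: S_def S'_def smooth_sgn_bound)
    have "\<bar>(f (c z) - f k) * S' n z\<bar> \<le> L * \<bar>c z - k\<bar> * \<bar>S' n z\<bar>"
      unfolding abs_mult by (intro mult_right_mono L(2) mem) auto
    also have "\<dots> \<le> L" using mult_left_mono[OF S2 L(1)] by (simp add: abs_mult mult.assoc)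
    finally have S3: "\<bar>(f (c z) - f k) * S' n z\<bar> \<le> L" .
    have "\<bar>f' (c z) * S n z\<bar> \<le> L * 1"
      unfolding abs_mult by (intro mult_mono L(3) mem S1 L) auto
    then have "\<bar>j1' n z\<bar> \<le> 2" "\<bar>j2' n z\<bar> \<le> 2 * L"
      using S1 S2 S3 unfolding j1'_def j2'_def by linarith+
    then have "\<bar>j1' n z * ct z\<bar> \<le> 2 * \<bar>ct z\<bar>" "\<bar>j2' n z * cx z\<bar> \<le> 2 * L * \<bar>cx z\<bar>"
      unfolding abs_mult by (auto intro: mult_right_mono)
    then have 3: "\<bar>(j1' n z * ct z + j2' n z * cx z) * \<phi> z\<bar> \<le> (2 * \<bar>ct z\<bar> + 2 * L * \<bar>cx z\<bar>) * \<bar>\<phi> z\<bar>"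
      by (subst abs_mult, intro mult_right_mono) linarith+
    have "\<bar>j1 n z\<bar> \<le> \<bar>c z - k\<bar> * 1" "\<bar>j2 n z\<bar> \<le> \<bar>f (c z) - f k\<bar> * 1"
      unfolding j1_def j2_def abs_mult by (intro mult_left_mono S1; simp)+
    then have "\<bar>j1 n z * \<phi>t z\<bar> \<le> \<bar>c z - k\<bar> * \<bar>\<phi>t z\<bar>" "\<bar>j2 n z * \<phi>x z\<bar> \<le> \<bar>f (c z) - f k\<bar> * \<bar>\<phi>x z\<bar>"
      unfolding abs_mult by (auto intro: mult_right_mono)
    with 3 show ?thesis unfolding I_def D_def real_norm_def
      by (intro order_trans[OF abs_triangle_ineq add_mono[OF order_trans[OF abs_triangle_ineq add_mono]]])
  qed (simp add: I_def D_def K0)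
  have cont_fc: "continuous_on ({0<..} \<times> UNIV) (\<lambda>z. f (c z))"
    "continuous_on ({0<..} \<times> UNIV) (\<lambda>z. f' (c z))"
    using continuous_on_compose2[OF cont_f cont_c(1)] continuous_on_compose2[OF f'(2) cont_c(1)] by auto
  have cont_D: "continuous_on ({0<..} \<times> UNIV) (\<lambda>z. \<bar>c z - k\<bar>)"
    "continuous_on ({0<..} \<times> UNIV) (\<lambda>z. \<bar>f (c z) - f k\<bar>)"
    "continuous_on ({0<..} \<times> UNIV) (\<lambda>z. 2 * \<bar>ct z\<bar> + 2 * L * \<bar>cx z\<bar>)"
    using cont_c cont_fc by (auto intro!: continuous_intros)
  have D: "integrable lborel D"
    unfolding D_def[abs_def]
    by (intro Bochner_Integration.integrable_add integrable_test_function_mult(4-6)[OF test] cont_D)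
  have cont_I: "continuous_on ({0<..} \<times> UNIV) (j1 n)" "continuous_on ({0<..} \<times> UNIV) (j2 n)"
    "continuous_on ({0<..} \<times> UNIV) (\<lambda>z. j1' n z * ct z + j2' n z * cx z)" for n
    using C1_half_plane_continuous[OF C1] C1_half_plane_continuous[OF C2]
    by (auto intro!: continuous_on_add)
  have meas: "I n \<in> borel_measurable lborel" for n
    unfolding I_def[abs_def]
    by (intro borel_measurable_integrable Bochner_Integration.integrable_add integrable_test_function_mult(1-3)[OF test] cont_I)
  have "J \<in> borel_measurable lborel"
    by (rule borel_measurable_LIMSEQ_metric[OF meas lim])
  then have "(\<lambda>n. LINT z|lborel. I n z) \<longlonglongrightarrow> (LINT z|lborel. J z)"
    by (intro integral_dominated_convergence[where w=D] meas D) (use lim dom in auto)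
  then have "(LINT z|lborel. J z) = 0" using zero by (simp add: LIMSEQ_const_iff)
  then show ?thesis by (simp add: J_def)
qed

subsection \<open>Relative entropy and uniqueness\<close>

lemma mean_value_between:
  fixes h :: "real \<Rightarrow> real"
  assumes "\<And>x. (h has_real_derivative h' x) (at x)"
  obtains \<xi> where "h v - h c = h' \<xi> * (v - c)" "\<bar>\<xi> - c\<bar> \<le> \<bar>v - c\<bar>" "\<bar>\<xi> - v\<bar> \<le> \<bar>v - c\<bar>"
    "min v c \<le> \<xi>" "\<xi> \<le> max v c"
proof (cases v c rule: linorder_cases)
  case less
  then obtain \<xi> where "v < \<xi>" "\<xi> < c" "h c - h v = (c - v) * h' \<xi>"
    using MVT2[of v c h h'] assms by blast
  with less show ?thesis by (intro that[of \<xi>]) (auto simp: algebra_simps)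
next
  case greater
  then obtain \<xi> where "c < \<xi>" "\<xi> < v" "h v - h c = (v - c) * h' \<xi>"
    using MVT2[of c v h h'] assms by blast
  with greater show ?thesis by (intro that[of \<xi>]) (auto simp: algebra_simps)
qed (use that[of c] in auto)

lemma continuous_on_antiderivative:
  fixes f :: "real \<Rightarrow> real"
  assumes "continuous_on UNIV f"
  obtains F where "\<And>x. (F has_real_derivative f x) (at x)"
  using einterval_antiderivative[of "-\<infinity>" \<infinity> f] assms
  by (auto simp: continuous_on_eq_continuous_at has_real_derivative_iff_has_vector_derivative)

lemma integrable_bounded_mult:
  fixes h :: "'a \<Rightarrow> real"
  assumes "integrable M h" "b \<in> borel_measurable M" "\<And>z. z \<in> space M \<Longrightarrow> \<bar>b z\<bar> \<le> B"
  shows "integrable M (\<lambda>z. b z * h z)"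
proof (rule Bochner_Integration.integrable_bound)
  show "integrable M (\<lambda>z. B * h z)" using assms(1) by simp
  show "AE z in M. norm (b z * h z) \<le> norm (B * h z)"
  proof (rule AE_I2)
    fix z assume "z \<in> space M"
    then have "\<bar>b z\<bar> \<le> \<bar>B\<bar>" using assms(3)[of z] by linarith
    then show "norm (b z * h z) \<le> norm (B * h z)" by (simp add: abs_mult mult_right_mono)
  qed
qed (use assms in measurable)

text \<open>The sign is 1 below \<open>v\<close> and -1 above it, so the integral is P v - P (- N)
  minus P N - P v; the single point \<open>v\<close> does not count.\<close>

lemma integral_sgn_antiderivative:
  fixes p P :: "real \<Rightarrow> real"
  assumes "\<And>k. (P has_real_derivative p k) (at k)" "continuous_on UNIV p" "v \<in> {-N..N}"
  shows "(LINT k|lborel. indicator {-N..N} k * (sgn (v - k) * p k)) = 2 * P v - P N - P (- N)"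
proof -
  have I: "(p has_integral (P b - P a)) {a..b}" if "a \<le> b" for a b
    using that assms(1)
    by (intro fundamental_theorem_of_calculus)
      (auto simp flip: has_real_derivative_iff_has_vector_derivative intro: has_field_derivative_at_within)
  have "((\<lambda>k. sgn (v - k) * p k) has_integral (P v - P (-N))) {-N..v}"
    by (rule has_integral_spike_finite[OF _ _ I, of "{v}"]) (use assms(3) in auto)
  moreover have "((\<lambda>k. sgn (v - k) * p k) has_integral (- (P N - P v))) {v..N}"
    by (rule has_integral_spike_finite[OF _ _ has_integral_neg[OF I], of "{v}"]) (use assms(3) in auto)
  ultimately have "((\<lambda>k. sgn (v - k) * p k) has_integral (P v - P (-N) + - (P N - P v))) {-N..N}"
    using assms(3) by (intro has_integral_combine[of "-N" v N]) auto
  moreover have "set_integrable lborel {-N..N} (\<lambda>k. sgn (v - k) * p k)"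
    unfolding set_integrable_def
  proof -
    have "integrable lborel (\<lambda>k. sgn (v - k) * (indicator {-N..N} k * p k))"
    proof (rule integrable_bounded_mult[where B=1])
      show "integrable lborel (\<lambda>k. indicator {-N..N} k * p k)"
        using borel_integrable_compact[of "{-N..N}" p] assms(2) continuous_on_subset by fastforce
    qed (auto simp: sgn_if)
    then show "integrable lborel (\<lambda>x. indicat_real {- N..N} x *\<^sub>R (sgn (v - x) * p x))"
      by (simp add: mult.left_commute)
  qed
  ultimately show ?thesis
    using set_borel_integral_eq_integral(2)[of "{-N..N}" "\<lambda>k. sgn (v - k) * p k"]
    by (simp add: set_lebesgue_integral_def integral_unique)
qed

text \<open>Averaging the entropy inequalities over the levels \<open>k \<in> [- N, N]\<close> produces the
  quadratic entropy.\<close>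

lemma quadratic_entropy_inequality:
  fixes V :: "real \<times> real \<Rightarrow> real"
  assumes F: "\<And>x. (F has_real_derivative f x) (at x)"
    and cont: "continuous_on UNIV f" "continuous_on UNIV g"
    and V: "V \<in> borel_measurable borel" "\<And>z. \<bar>V z\<bar> \<le> N"
    and test: "test_function \<phi> \<phi>t \<phi>x"
    and Kruzkov: "\<And>k. 0 \<le> (LINT z|lborel. \<bar>V z - k\<bar> * \<phi>t z + sgn (V z - k) * (f (V z) - f k) * \<phi>x z
      + sgn (V z - k) * g (V z) * \<phi> z)"
  shows "0 \<le> (LINT z|lborel. (V z)\<^sup>2 / 2 * \<phi>t z + (V z * f (V z) - F (V z)) * \<phi>x z + V z * g (V z) * \<phi> z)"
proof -
  have [measurable]: "V \<in> borel_measurable borel" "f \<in> borel_measurable borel" "g \<in> borel_measurable borel"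
    using V(1) cont by (auto intro: borel_measurable_continuous_onI)
  have cont_F: "continuous_on UNIV F"
    using F by (meson DERIV_isCont continuous_at_imp_continuous_on)
  note int = test_function_integrable[OF test]
  have [measurable]: "\<phi> \<in> borel_measurable borel" "\<phi>t \<in> borel_measurable borel" "\<phi>x \<in> borel_measurable borel"
    using test_functionD[OF test] by (auto intro: borel_measurable_continuous_onI)
  have [measurable]: "F \<in> borel_measurable borel" using cont_F by (auto intro: borel_measurable_continuous_onI)
  have N: "0 \<le> N" using V(2)[of 0] by linarith
  have bounded: "\<exists>B. \<forall>x\<in>{-N..N}. \<bar>h x\<bar> \<le> B" if "continuous_on UNIV h" for h :: "real \<Rightarrow> real"
    using compact_imp_bounded[OF compact_continuous_image[OF continuous_on_subset[OF that subset_UNIV] compact_Icc]]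
    unfolding bounded_iff by (metis imageI real_norm_def)
  obtain Bf Bg BF where B: "\<And>x. x\<in>{-N..N} \<Longrightarrow> \<bar>f x\<bar> \<le> Bf" "\<And>x. x\<in>{-N..N} \<Longrightarrow> \<bar>g x\<bar> \<le> Bg" "\<And>x. x\<in>{-N..N} \<Longrightarrow> \<bar>F x\<bar> \<le> BF"
    using bounded[OF cont(1)] bounded[OF cont(2)] bounded[OF cont_F] by metis
  have VN: "V z \<in> {-N..N}" for z using V(2)[of z] by (auto simp: abs_le_iff)
  define p where "p z k = \<phi>t z * (V z - k) + \<phi>x z * (f (V z) - f k) + \<phi> z * g (V z)" for z k
  define P where "P z k = \<phi>t z * (V z * k - k\<^sup>2 / 2) + \<phi>x z * (f (V z) * k - F k) + \<phi> z * g (V z) * k" for z k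
  define \<Phi> where "\<Phi> z k = indicator {-N..N} k * (sgn (V z - k) * p z k)" for z k
  define H where "H z = 2 * N * \<bar>\<phi>t z\<bar> + 2 * Bf * \<bar>\<phi>x z\<bar> + Bg * \<bar>\<phi> z\<bar>" for z
  have \<Phi>_le: "\<bar>\<Phi> z k\<bar> \<le> H z * indicator {-N..N} k" for z k
  proof (cases "k \<in> {-N..N}")
    case True
    have "\<bar>V z - k\<bar> \<le> 2 * N" "\<bar>f (V z) - f k\<bar> \<le> 2 * Bf" "\<bar>g (V z)\<bar> \<le> Bg"
      using True VN[of z] B(1)[OF True] B(1)[OF VN[of z]] B(2)[OF VN[of z]] by (auto simp: abs_le_iff)
    then have "\<bar>\<phi>t z * (V z - k)\<bar> \<le> 2 * N * \<bar>\<phi>t z\<bar>" "\<bar>\<phi>x z * (f (V z) - f k)\<bar> \<le> 2 * Bf * \<bar>\<phi>x z\<bar>"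
      "\<bar>\<phi> z * g (V z)\<bar> \<le> Bg * \<bar>\<phi> z\<bar>"
      by (auto simp: abs_mult mult.commute[of "\<bar>\<phi>t z\<bar>"] mult.commute[of "\<bar>\<phi>x z\<bar>"] mult.commute[of "\<bar>\<phi> z\<bar>"] intro!: mult_right_mono)
    then have p: "\<bar>p z k\<bar> \<le> H z" unfolding p_def H_def
      by (intro order_trans[OF abs_triangle_ineq add_mono[OF order_trans[OF abs_triangle_ineq add_mono]]])
    have "\<bar>sgn (V z - k) * p z k\<bar> \<le> \<bar>p z k\<bar>" by (auto simp: sgn_if abs_mult)
    with p True show ?thesis by (simp add: \<Phi>_def)
  qed (simp add: \<Phi>_def)
  have "(\<lambda>x. case_prod \<Phi> x) \<in> borel_measurable (borel \<Otimes>\<^sub>M borel)"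
    unfolding \<Phi>_def p_def case_prod_unfold by measurable
  then have \<Phi>_meas: "case_prod \<Phi> \<in> borel_measurable (lborel \<Otimes>\<^sub>M lborel)"
    by (simp cong: measurable_cong_sets)
  have H: "integrable lborel H" unfolding H_def[abs_def] using int by auto
  have ind: "integrable lborel (\<lambda>k. indicator {-N..N} k :: real)" "(LINT k|lborel. indicator {-N..N} k :: real) = 2 * N"
    using N by (auto simp: measure_def)
  have "H z \<ge> 0" for z
    using \<Phi>_le[of z 0] N by (auto simp: indicator_def)
  have "integrable (lborel \<Otimes>\<^sub>M lborel) (\<lambda>x. case_prod (\<lambda>z k. H z * indicator {-N..N} k) x)"
  proof (rule lborel_pair.Fubini_integrable)
    have [measurable]: "H \<in> borel_measurable borel" using H by auto
    show "(\<lambda>(z, k). H z * indicator {-N..N} k) \<in> borel_measurable (lborel \<Otimes>\<^sub>M lborel)"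
      by measurable
  qed (use H ind in \<open>simp_all add: abs_mult\<close>)
  then have \<Phi>_int: "integrable (lborel \<Otimes>\<^sub>M lborel) (case_prod \<Phi>)"
    by (rule Bochner_Integration.integrable_bound[OF _ \<Phi>_meas])
      (auto intro!: AE_I2 order_trans[OF \<Phi>_le] mult_right_mono simp: abs_mult)
  have eq: "(LINT k|lborel. \<Phi> z k) = 2 * P z (V z) - P z N - P z (- N)" for z
    unfolding \<Phi>_def
  proof (rule integral_sgn_antiderivative[OF _ _ VN])
    show "(P z has_real_derivative p z k) (at k)" for k
      unfolding P_def[abs_def] p_def by (auto intro!: derivative_eq_intros F simp: algebra_simps)
    show "continuous_on UNIV (p z)"
      unfolding p_def[abs_def] by (intro continuous_intros cont)
  qed
  define E where "E z = (V z)\<^sup>2 / 2 * \<phi>t z + (V z * f (V z) - F (V z)) * \<phi>x z + V z * g (V z) * \<phi> z" for z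
  \<comment> \<open>The terms of \<open>P\<close> that are linear in k cancel between N and - N.
    What remains at the two ends has constant coefficients in front of the partial derivatives of
    \<open>\<phi>\<close>, and therefore integrates to 0: the choice of N leaves no trace.\<close>
  have eq2: "2 * P z (V z) - P z N - P z (- N) = 2 * E z + (N\<^sup>2 * \<phi>t z + (F N + F (- N)) * \<phi>x z)" for z
    unfolding P_def E_def by (simp add: algebra_simps power2_eq_square)
  have E_int: "integrable lborel E"
    unfolding E_def[abs_def]
  proof (intro Bochner_Integration.integrable_add integrable_bounded_mult int)
    show "\<bar>(V z)\<^sup>2 / 2\<bar> \<le> N\<^sup>2 / 2" for z
      using V(2)[of z] by (simp add: abs_le_square_iff[symmetric] power2_le_iff_abs_le N)
    show "\<bar>V z * f (V z) - F (V z)\<bar> \<le> N * Bf + BF" for z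
      using mult_mono[OF V(2)[of z] B(1)[OF VN[of z]] N] B(3)[OF VN[of z]]
      by (intro order_trans[OF abs_triangle_ineq4] add_mono) (auto simp: abs_mult)
    show "\<bar>V z * g (V z)\<bar> \<le> N * Bg" for z
      using mult_mono[OF V(2)[of z] B(2)[OF VN[of z]] N] by (auto simp: abs_mult)
  qed auto
  have "0 \<le> (LINT k|lborel. LINT z|lborel. \<Phi> z k)"
  proof (rule integral_nonneg_AE, rule AE_I2)
    fix k :: real
    have "(LINT z|lborel. \<Phi> z k) = indicator {-N..N} k * (LINT z|lborel. \<bar>V z - k\<bar> * \<phi>t z + sgn (V z - k) * (f (V z) - f k) * \<phi>x z
      + sgn (V z - k) * g (V z) * \<phi> z)"
      unfolding \<Phi>_def p_def integral_mult_right_zero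
      by (intro arg_cong2[where f="(*)"] refl Bochner_Integration.integral_cong) (auto simp: algebra_simps abs_sgn)
    then show "0 \<le> (LINT z|lborel. \<Phi> z k)" using Kruzkov[of k] by simp
  qed
  also have "\<dots> = (LINT z|lborel. LINT k|lborel. \<Phi> z k)"
    by (rule lborel_pair.Fubini_integral[OF \<Phi>_int])
  also have "\<dots> = (LINT z|lborel. 2 * E z + (N\<^sup>2 * \<phi>t z + (F N + F (- N)) * \<phi>x z))"
    by (simp add: eq eq2)
  also have "\<dots> = 2 * (LINT z|lborel. E z)"
    using E_int int integral_test_function_partial[OF test] by simp
  finally show ?thesis by (simp add: E_def)
qed

text \<open>A level above all values of \<open>V\<close> and a level below all of them make the sign
  constant, with opposite signs. The two Kruzkov inequalities are then opposite inequalities for the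
  same integral, since the terms in \<open>k\<close> and \<open>f k\<close> integrate to 0.\<close>

lemma weak_equality:
  fixes V :: "real \<times> real \<Rightarrow> real"
  assumes cont: "continuous_on UNIV f" "continuous_on UNIV g"
    and V: "V \<in> borel_measurable borel" "\<And>z. \<bar>V z\<bar> \<le> N"
    and test: "test_function \<phi> \<phi>t \<phi>x"
    and Kruzkov: "\<And>k. 0 \<le> (LINT z|lborel. \<bar>V z - k\<bar> * \<phi>t z + sgn (V z - k) * (f (V z) - f k) * \<phi>x z
      + sgn (V z - k) * g (V z) * \<phi> z)"
  shows "integrable lborel (\<lambda>z. V z * \<phi>t z + f (V z) * \<phi>x z + g (V z) * \<phi> z)"
    and "(LINT z|lborel. V z * \<phi>t z + f (V z) * \<phi>x z + g (V z) * \<phi> z) = 0"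
proof -
  have [measurable]: "V \<in> borel_measurable borel" "f \<in> borel_measurable borel" "g \<in> borel_measurable borel"
    using V(1) cont by (auto intro: borel_measurable_continuous_onI)
  note int = test_function_integrable[OF test]
  have bounded: "\<exists>B. \<forall>x\<in>{-N..N}. \<bar>h x\<bar> \<le> B" if "continuous_on UNIV h" for h :: "real \<Rightarrow> real"
    using compact_imp_bounded[OF compact_continuous_image[OF continuous_on_subset[OF that subset_UNIV] compact_Icc]]
    unfolding bounded_iff by (metis imageI real_norm_def)
  obtain Bf Bg where B: "\<And>x. x\<in>{-N..N} \<Longrightarrow> \<bar>f x\<bar> \<le> Bf" "\<And>x. x\<in>{-N..N} \<Longrightarrow> \<bar>g x\<bar> \<le> Bg"
    using bounded[OF cont(1)] bounded[OF cont(2)] by metis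
  have VN: "V z \<in> {-N..N}" for z using V(2)[of z] by (auto simp: abs_le_iff)
  define E where "E z = V z * \<phi>t z + f (V z) * \<phi>x z + g (V z) * \<phi> z" for z
  have E: "integrable lborel E"
    unfolding E_def[abs_def]
    by (intro Bochner_Integration.integrable_add integrable_bounded_mult[where B=N, OF int(2)]
        integrable_bounded_mult[where B=Bf, OF int(3)] integrable_bounded_mult[where B=Bg, OF int(1)] V B VN) auto
  then show "integrable lborel (\<lambda>z. V z * \<phi>t z + f (V z) * \<phi>x z + g (V z) * \<phi> z)" unfolding E_def[abs_def] .
  have *: "(LINT z|lborel. \<epsilon> * E z - (\<epsilon> * k) * \<phi>t z - (\<epsilon> * f k) * \<phi>x z) = \<epsilon> * (LINT z|lborel. E z)" for \<epsilon> k
    using E int integral_test_function_partial[OF test] by simp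
  have "0 \<le> (LINT z|lborel. -1 * E z - (-1 * (N + 1)) * \<phi>t z - (-1 * f (N + 1)) * \<phi>x z)"
  proof -
    have "\<bar>V z - (N + 1)\<bar> = - (V z - (N + 1))" "sgn (V z - (N + 1)) = -1" for z using VN[of z] by auto
    note eq = this
    show ?thesis
      by (rule order_trans[OF Kruzkov[of "N + 1"]], rule eq_refl, rule Bochner_Integration.integral_cong[OF refl],
          unfold eq E_def) (simp add: algebra_simps)
  qed
  moreover have "0 \<le> (LINT z|lborel. 1 * E z - (1 * (- N - 1)) * \<phi>t z - (1 * f (- N - 1)) * \<phi>x z)"
  proof -
    have "\<bar>V z - (- N - 1)\<bar> = V z - (- N - 1)" "sgn (V z - (- N - 1)) = 1" for z using VN[of z] by auto
    note eq = this
    show ?thesis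
      by (rule order_trans[OF Kruzkov[of "- N - 1"]], rule eq_refl, rule Bochner_Integration.integral_cong[OF refl],
          unfold eq E_def) (simp add: algebra_simps)
  qed
  ultimately have "(LINT z|lborel. E z) = 0" unfolding * by simp
  then show "(LINT z|lborel. V z * \<phi>t z + f (V z) * \<phi>x z + g (V z) * \<phi> z) = 0" unfolding E_def[abs_def] .
qed

section \<open>Cut-off functions of class C1 and a monotonicity criterion in weak form\<close>

lemma pos_part_square_deriv: "((\<lambda>r. (max r 0)\<^sup>2) has_real_derivative 2 * max r 0) (at (r::real))"
proof -
  consider "r = 0" | "r > 0" | "r < 0" by linarith
  then show ?thesis
  proof cases
    case 1
    have "isCont (\<lambda>r::real. max r 0) 0" by (intro continuous_intros)
    then show ?thesis
      unfolding CARAT_DERIV 1 by (intro exI[of _ "\<lambda>r. max r 0"]) (auto simp: max_def power2_eq_square)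
  next
    case 2
    have "((\<lambda>r. r\<^sup>2) has_real_derivative 2 * max r 0) (at r)"
      using 2 by (auto intro!: derivative_eq_intros)
    then show ?thesis
      by (rule has_field_derivative_transform_within_open[where S="{0<..}"]) (use 2 in auto)
  next
    case 3
    have "((\<lambda>r. 0) has_real_derivative 2 * max r 0) (at r)"
      using 3 by (auto intro!: derivative_eq_intros)
    then show ?thesis
      by (rule has_field_derivative_transform_within_open[where S="{..<0}"]) (use 3 in auto)
  qed
qed

text \<open>The usual quotient \<psi> s / (\<psi> s + \<psi> (1 - s)) that joins 0 to 1. The square
  of the positive part serves as \<psi>, because C1 regularity is enough for
  \<open>test_function\<close>.\<close>

lemma ramp_exists:
  obtains r r' :: "real \<Rightarrow> real" where "\<And>s. (r has_real_derivative r' s) (at s)" "continuous_on UNIV r'"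
    "\<And>s. 0 \<le> r' s" "\<And>s. s \<le> 0 \<Longrightarrow> r s = 0" "\<And>s. 1 \<le> s \<Longrightarrow> r s = 1"
    "\<And>s. s \<notin> {0..1} \<Longrightarrow> r' s = 0" "\<And>s. 0 \<le> r s" "\<And>s. r s \<le> 1"
proof -
  define \<psi> :: "real \<Rightarrow> real" where "\<psi> s = (max s 0)\<^sup>2" for s
  define \<psi>' :: "real \<Rightarrow> real" where "\<psi>' s = 2 * max s 0" for s
  have d: "(\<psi> has_real_derivative \<psi>' s) (at s)" for s
    unfolding \<psi>_def[abs_def] \<psi>'_def by (rule pos_part_square_deriv)
  have d1: "((\<lambda>s. \<psi> (1 - s)) has_real_derivative - \<psi>' (1 - s)) (at s)" for s
    by (rule DERIV_cong[OF DERIV_chain2[OF d]]) (auto intro!: derivative_eq_intros)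
  have pos: "\<psi> s + \<psi> (1 - s) > 0" for s
  proof (cases "s > 0")
    case True
    then have "\<psi> s > 0" by (simp add: \<psi>_def)
    then show ?thesis by (simp add: \<psi>_def add_pos_nonneg)
  next
    case False
    then have "\<psi> (1 - s) > 0" by (simp add: \<psi>_def)
    then show ?thesis by (simp add: \<psi>_def add_nonneg_pos)
  qed
  define D where "D s = \<psi> s + \<psi> (1 - s)" for s
  have D: "D s > 0" for s using pos by (simp add: D_def)
  define r where "r s = \<psi> s / D s" for s
  define r' where "r' s = (\<psi>' s * \<psi> (1 - s) + \<psi> s * \<psi>' (1 - s)) / (D s)\<^sup>2" for s
  have cont: "continuous_on UNIV \<psi>" "continuous_on UNIV \<psi>'" "continuous_on UNIV (\<lambda>s. \<psi> (1 - s))"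
     "continuous_on UNIV (\<lambda>s. \<psi>' (1 - s))" "continuous_on UNIV D"
    unfolding \<psi>_def[abs_def] \<psi>'_def[abs_def] D_def[abs_def] by (intro continuous_intros)+
  show ?thesis
  proof (rule that)
    show "(r has_real_derivative r' s) (at s)" for s
    proof -
      have "(D has_real_derivative \<psi>' s - \<psi>' (1 - s)) (at s)"
        unfolding D_def[abs_def] by (rule DERIV_cong[OF DERIV_add[OF d d1]]) simp
      then show ?thesis
        unfolding r_def[abs_def] r'_def
        by (rule DERIV_cong[OF DERIV_divide[OF d]])
          (use D[of s] in \<open>auto simp: D_def power2_eq_square algebra_simps\<close>)
    qed
    show "continuous_on UNIV r'" unfolding r'_def[abs_def]
      using D by (intro continuous_intros cont) (auto simp: less_le)
    show "0 \<le> r' s" for s by (simp add: r'_def \<psi>_def \<psi>'_def)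
    show "s \<le> 0 \<Longrightarrow> r s = 0" for s by (simp add: r_def \<psi>_def)
    show "1 \<le> s \<Longrightarrow> r s = 1" for s by (simp add: r_def D_def \<psi>_def)
    show "s \<notin> {0..1} \<Longrightarrow> r' s = 0" for s by (auto simp: r'_def \<psi>_def \<psi>'_def)
    show "0 \<le> r s" "r s \<le> 1" for s
      using D[of s] by (auto simp: r_def field_simps) (auto simp: D_def \<psi>_def)
  qed
qed

text \<open>The hypothesis \<open>ineq\<close> says that \<open>m\<close> is nonincreasing on (0, T)
  in the sense of distributions. A plateau that rises just after 0 and falls just after t compares
  the averages of \<open>m\<close> near these two points, and continuity within [0, T] identifies
  them with m 0 = 0 and m t.\<close>

lemma nonneg_function_zero_of_test:
  fixes m :: "real \<Rightarrow> real"
  assumes nonneg: "\<And>s. 0 \<le> m s" and m0: "m 0 = 0"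
    and cont: "\<And>s. 0 \<le> s \<Longrightarrow> s < T \<Longrightarrow> (m \<longlongrightarrow> m s) (at s within {0..T})"
    and int: "\<And>h. continuous_on UNIV h \<Longrightarrow> (\<And>s. s \<notin> {0..T} \<Longrightarrow> h s = 0) \<Longrightarrow> integrable lborel (\<lambda>s. h s * m s)"
    and ineq: "\<And>\<theta> \<theta>' a b. (\<And>s. (\<theta> has_real_derivative \<theta>' s) (at s)) \<Longrightarrow> continuous_on UNIV \<theta>' \<Longrightarrow>
      (\<And>s. 0 \<le> \<theta> s) \<Longrightarrow> 0 < a \<Longrightarrow> b < T \<Longrightarrow> (\<And>s. s \<notin> {a..b} \<Longrightarrow> \<theta> s = 0) \<Longrightarrow> 0 \<le> (LINT s|lborel. \<theta>' s * m s)"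
    and t: "0 < t" "t < T"
  shows "m t = 0"
proof (rule ccontr)
  assume "m t \<noteq> 0"
  define \<eta> where "\<eta> = m t / 3"
  have \<eta>: "\<eta> > 0" using \<open>m t \<noteq> 0\<close> nonneg[of t] by (simp add: \<eta>_def less_le)
  have cont': "\<exists>d>0. \<forall>s\<in>{0..T}. \<bar>s - c\<bar> < d \<longrightarrow> \<bar>m s - m c\<bar> < \<eta>" if c: "0 \<le> c" "c < T" for c
  proof -
    from tendstoD[OF cont[OF c] \<eta>] obtain d where "d > 0"
      and d: "\<forall>s\<in>{0..T}. s \<noteq> c \<and> dist s c < d \<longrightarrow> dist (m s) (m c) < \<eta>"
      unfolding eventually_at by blast
    have "\<bar>m s - m c\<bar> < \<eta>" if "s \<in> {0..T}" "\<bar>s - c\<bar> < d" for s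
      using d that \<eta> by (cases "s = c") (auto simp: dist_real_def)
    with \<open>d > 0\<close> show ?thesis by blast
  qed
  from cont'[of 0] t obtain d0 where d0: "d0 > 0" "\<forall>s\<in>{0..T}. \<bar>s - 0\<bar> < d0 \<longrightarrow> \<bar>m s - m 0\<bar> < \<eta>" by auto
  from cont'[of t] t obtain d1 where d1: "d1 > 0" "\<forall>s\<in>{0..T}. \<bar>s - t\<bar> < d1 \<longrightarrow> \<bar>m s - m t\<bar> < \<eta>" by auto
  \<comment> \<open>The ramps occupy [\<epsilon>, 2 \<epsilon>] and [t, t + \<epsilon>]. With a
    quarter of the minimum, the first one is complete before t, the second one ends before T, and
    both lie where \<open>m\<close> is within \<eta> of m 0 and of m t = 3 \<eta>.\<close>
  define \<epsilon> where "\<epsilon> = Min {d0, d1, t, T - t} / 4"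
  have \<epsilon>: "\<epsilon> > 0" "4 * \<epsilon> \<le> d0" "4 * \<epsilon> \<le> d1" "4 * \<epsilon> \<le> t" "4 * \<epsilon> \<le> T - t"
    using d0 d1 t by (auto simp: \<epsilon>_def)
  obtain r r' where r: "\<And>s. (r has_real_derivative r' s) (at s)" "continuous_on UNIV r'"
    "\<And>s. 0 \<le> r' s" "\<And>s. s \<le> 0 \<Longrightarrow> r s = 0" "\<And>s. 1 \<le> s \<Longrightarrow> r s = 1"
    "\<And>s. s \<notin> {0..1} \<Longrightarrow> r' s = 0" "\<And>s. 0 \<le> r s" "\<And>s. r s \<le> (1::real)"
    by (rule ramp_exists) blast
  define R where "R c s = r ((s - c) / \<epsilon>)" for c s
  define R' where "R' c s = r' ((s - c) / \<epsilon>) / \<epsilon>" for c s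
  have R_deriv: "(R c has_real_derivative R' c s) (at s)" for c s
    unfolding R_def[abs_def] R'_def
    by (rule DERIV_cong[OF DERIV_chain2[OF r(1)]]) (use \<epsilon>(1) in \<open>auto intro!: derivative_eq_intros\<close>)
  have R'_cont: "continuous_on UNIV (R' c)" for c
    unfolding R'_def[abs_def] using \<epsilon>(1)
    by (intro continuous_intros continuous_on_compose2[OF r(2)]) auto
  have R'0: "R' c s = 0" if "s \<notin> {c..c+\<epsilon>}" for c s
    unfolding R'_def using that \<epsilon>(1) by (subst r(6)) (auto simp: field_simps)
  have R'_nonneg: "0 \<le> R' c s" for c s using r(3) \<epsilon>(1) by (simp add: R'_def)
  have mass: "(LINT s|lborel. R' c s) = 1" for c
  proof -
    have "(LINT s|lborel. R' c s) = (LINT s|lborel. R' c s * indicator {c..c+\<epsilon>} s)"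
      using R'0 by (intro Bochner_Integration.integral_cong) (auto simp: indicator_def)
    also have "\<dots> = R c (c + \<epsilon>) - R c c"
      using \<epsilon>(1) R'_cont by (intro integral_FTC_Icc_real R_deriv) (auto simp: continuous_on_eq_continuous_at)
    also have "\<dots> = 1" using \<epsilon>(1) r(4,5) by (simp add: R_def)
    finally show ?thesis .
  qed
  have R'_int: "integrable lborel (R' c)" for c
    by (rule integrable_compact_support[OF R'_cont compact_Icc R'0])
  have m_int: "integrable lborel (\<lambda>s. R' c s * m s)" if "0 \<le> c" "c + \<epsilon> \<le> T" for c
    by (rule int[OF R'_cont]) (use that R'0 in auto)
  have "0 \<le> (LINT s|lborel. (R' \<epsilon> s - R' t s) * m s)"
  proof (rule ineq[of "\<lambda>s. R \<epsilon> s - R t s" _ \<epsilon> "t + \<epsilon>"])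
    show "((\<lambda>s. R \<epsilon> s - R t s) has_real_derivative R' \<epsilon> s - R' t s) (at s)" for s
      by (intro derivative_intros R_deriv)
    show "continuous_on UNIV (\<lambda>s. R' \<epsilon> s - R' t s)" by (intro continuous_intros R'_cont)
    show "0 \<le> R \<epsilon> s - R t s" for s
    proof (cases "s \<le> t")
      case True
      then show ?thesis using r(4)[of "(s - t) / \<epsilon>"] r(7)[of "(s - \<epsilon>) / \<epsilon>"] \<epsilon>(1) by (simp add: R_def divide_le_0_iff)
    next
      case False
      then have "1 \<le> (s - \<epsilon>) / \<epsilon>" using \<epsilon> by (simp add: field_simps)
      then show ?thesis using r(5) r(8) by (simp add: R_def)
    qed
    show "s \<notin> {\<epsilon>..t + \<epsilon>} \<Longrightarrow> R \<epsilon> s - R t s = 0" for s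
    proof -
      assume "s \<notin> {\<epsilon>..t + \<epsilon>}"
      then consider "s < \<epsilon>" | "t + \<epsilon> < s" by fastforce
      then show ?thesis
      proof cases
        case 1
        then have "(s - \<epsilon>) / \<epsilon> \<le> 0" "(s - t) / \<epsilon> \<le> 0" using \<epsilon> by (auto simp: divide_le_0_iff)
        then show ?thesis using r(4) by (simp add: R_def)
      next
        case 2
        then have "1 \<le> (s - \<epsilon>) / \<epsilon>" "1 \<le> (s - t) / \<epsilon>" using \<epsilon> by (auto simp: field_simps)
        then show ?thesis using r(5) by (simp add: R_def)
      qed
    qed
  qed (use \<epsilon> in auto)
  also have "\<dots> = (LINT s|lborel. R' \<epsilon> s * m s) - (LINT s|lborel. R' t s * m s)"
    unfolding left_diff_distrib using \<epsilon> t by (intro Bochner_Integration.integral_diff m_int) auto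
  finally have 0: "0 \<le> (LINT s|lborel. R' \<epsilon> s * m s) - (LINT s|lborel. R' t s * m s)" .
  have 1: "(LINT s|lborel. R' \<epsilon> s * m s) \<le> (LINT s|lborel. R' \<epsilon> s * \<eta>)"
  proof (rule integral_mono)
    show "integrable lborel (\<lambda>s. R' \<epsilon> s * m s)" using \<epsilon> by (intro m_int) auto
    show "R' \<epsilon> s * m s \<le> R' \<epsilon> s * \<eta>" for s
    proof (cases "s \<in> {\<epsilon>..\<epsilon>+\<epsilon>}")
      case True
      then have "\<bar>m s - m 0\<bar> < \<eta>" using \<epsilon> t by (intro d0(2)[rule_format]) auto
      then have "m s < \<eta>" using m0 by simp
      then show ?thesis by (intro mult_left_mono R'_nonneg) simp
    qed (use R'0 in auto)
  qed (use R'_int in auto)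
  have 2: "(LINT s|lborel. R' t s * m s) \<ge> (LINT s|lborel. R' t s * (2 * \<eta>))"
  proof (rule integral_mono)
    show "integrable lborel (\<lambda>s. R' t s * m s)" using \<epsilon> t by (intro m_int) auto
    show "R' t s * (2 * \<eta>) \<le> R' t s * m s" for s
    proof (cases "s \<in> {t..t+\<epsilon>}")
      case True
      then have "\<bar>m s - m t\<bar> < \<eta>" using \<epsilon> t by (intro d1(2)[rule_format]) auto
      then have "2 * \<eta> \<le> m s" by (simp add: \<eta>_def abs_if split: if_splits)
      then show ?thesis by (intro mult_left_mono R'_nonneg) simp
    qed (use R'0 in auto)
  qed (use R'_int in auto)
  from 0 1 2 show False using mass \<eta> by simp
qed

section \<open>Classical solutions compared with arbitrary entropy solutions\<close>

locale classical_solution =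
  fixes f f' f'' g g' F :: "real \<Rightarrow> real" and u :: "real \<Rightarrow> real \<Rightarrow> real"
    and ut ux :: "real \<times> real \<Rightarrow> real" and M M1 :: real
  assumes F: "\<And>r. (F has_real_derivative f r) (at r)"
    and f': "\<And>r. (f has_real_derivative f' r) (at r)"
    and f'': "\<And>r. (f' has_real_derivative f'' r) (at r)" "continuous_on UNIV f''"
    and g': "\<And>r. (g has_real_derivative g' r) (at r)" "continuous_on UNIV g'"
    and u_cont: "continuous_on ({0..} \<times> UNIV) (\<lambda>z. u (fst z) (snd z))"
    and u_C1: "C1_half_plane (\<lambda>z. u (fst z) (snd z)) ut ux"
    and pde: "\<And>z. 0 < fst z \<Longrightarrow> ut z + f' (u (fst z) (snd z)) * ux z = g (u (fst z) (snd z))"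
    and u_bound: "\<And>t x. 0 \<le> t \<Longrightarrow> \<bar>u t x\<bar> \<le> M"
    and ux_bound: "\<And>z. 0 < fst z \<Longrightarrow> \<bar>ux z\<bar> \<le> M1"
begin

lemma cont_coeffs: "continuous_on UNIV f" "continuous_on UNIV f'" "continuous_on UNIV g" "continuous_on UNIV F"
  using F f' f'' g' by (meson DERIV_isCont continuous_at_imp_continuous_on)+

lemma u_section_cont:
  assumes "0 \<le> t"
  shows "continuous_on UNIV (u t)"
proof -
  have "continuous_on UNIV (\<lambda>x. (t, x :: real))" by (rule continuous_on_Pair; rule continuous_intros)
  from continuous_on_compose2[OF u_cont this] show ?thesis using assms by (simp add: image_subset_iff)
qed

lemma u_sequence:
  assumes "X \<longlonglongrightarrow> s" "\<And>n. 0 \<le> X n" "0 \<le> s"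
  shows "(\<lambda>n. u (X n) x) \<longlonglongrightarrow> u s x"
  using continuous_on_tendsto_compose[OF u_cont tendsto_Pair[OF assms(1) tendsto_const, of x]] assms by simp

lemma L1_loc_continuous_sequence:
  assumes X: "X \<longlonglongrightarrow> s" "\<And>n. 0 \<le> X n" "0 \<le> s"
  shows "(\<lambda>n. LINT x:{-R..R}|lborel. \<bar>u (X n) x - u s x\<bar>) \<longlonglongrightarrow> 0"
proof -
  have [measurable]: "u t \<in> borel_measurable borel" if "0 \<le> t" for t
    using u_section_cont[OF that] by (rule borel_measurable_continuous_onI)
  have "(\<lambda>n. LINT x|lborel. indicator {-R..R} x *\<^sub>R \<bar>u (X n) x - u s x\<bar>) \<longlonglongrightarrow> integral\<^sup>L lborel (\<lambda>x::real. 0 :: real)"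
  proof (rule integral_dominated_convergence[where w="\<lambda>x. indicator {-R..R} x * (2 * M)" and f="\<lambda>_. 0"
      and s="\<lambda>n x. indicator {-R..R} x *\<^sub>R \<bar>u (X n) x - u s x\<bar>"])
    have "integrable lborel (indicat_real {- R..R})"
      by (rule integrable_real_indicator) (auto simp: emeasure_lborel_Icc_eq)
    then show "integrable lborel (\<lambda>x. indicat_real {- R..R} x * (2 * M))" by simp
    show "AE x in lborel. (\<lambda>n. indicat_real {- R..R} x *\<^sub>R \<bar>u (X n) x - u s x\<bar>) \<longlonglongrightarrow> 0"
    proof (rule AE_I2)
      fix x
      have "(\<lambda>n. indicat_real {- R..R} x *\<^sub>R \<bar>u (X n) x - u s x\<bar>) \<longlonglongrightarrow> indicat_real {- R..R} x *\<^sub>R \<bar>u s x - u s x\<bar>"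
        by (intro tendsto_intros u_sequence X)
      then show "(\<lambda>n. indicat_real {- R..R} x *\<^sub>R \<bar>u (X n) x - u s x\<bar>) \<longlonglongrightarrow> 0" by simp
    qed
    show "AE x in lborel. norm (indicat_real {- R..R} x *\<^sub>R \<bar>u (X n) x - u s x\<bar>) \<le> indicat_real {- R..R} x * (2 * M)" for n
    proof (rule AE_I2)
      fix x
      show "norm (indicat_real {- R..R} x *\<^sub>R \<bar>u (X n) x - u s x\<bar>) \<le> indicat_real {- R..R} x * (2 * M)"
        using u_bound[OF X(2)[of n], of x] u_bound[OF X(3), of x] by (auto simp: indicator_def)
    qed
  qed (use X in measurable)
  then show ?thesis by (simp add: set_lebesgue_integral_def)
qed

lemma entropy_solution_self: "entropy_solution f g (u 0) u"
  unfolding entropy_solution_def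
proof (intro conjI allI impI)
  have "(\<lambda>(t, x). u t x) = (\<lambda>z. u (fst z) (snd z))" by (simp add: case_prod_unfold)
  then show "set_borel_measurable borel ({0..} \<times> UNIV) (\<lambda>(t, x). u t x)"
    unfolding set_borel_measurable_def
    using borel_measurable_continuous_on_indicator[OF _ u_cont]
    by (simp add: borel_closed closed_Times)
  show "\<exists>M. \<forall>t\<in>{0..T}. AE x in lborel. \<bar>u t x\<bar> \<le> M" for T
    using u_bound by (intro exI[of _ M]) auto
  show "((\<lambda>t. LINT x:{-R..R}|lborel. \<bar>u t x - u s x\<bar>) \<longlongrightarrow> 0) (at s within {0..})" if "0 \<le> s" for s R
    unfolding tendsto_at_iff_sequentially comp_def
    using L1_loc_continuous_sequence that by auto
  fix k \<phi> \<phi>t \<phi>x assume *: "test_function \<phi> \<phi>t \<phi>x \<and> (\<forall>z. 0 \<le> \<phi> z)"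
  have "(LINT z|lborel. \<bar>u (fst z) (snd z) - k\<bar> * \<phi>t z
      + sgn (u (fst z) (snd z) - k) * (f (u (fst z) (snd z)) - f k) * \<phi>x z
      + sgn (u (fst z) (snd z) - k) * g (u (fst z) (snd z)) * \<phi> z) = 0"
    by (rule Kruzkov_equality_classical[OF f' cont_coeffs(2) u_C1 pde u_bound])
      (use * in auto)
  then show "0 \<le> (LINT (t, x)|lborel. \<bar>u t x - k\<bar> * \<phi>t (t, x)
      + sgn (u t x - k) * (f (u t x) - f k) * \<phi>x (t, x) + sgn (u t x - k) * g (u t x) * \<phi> (t, x))"
    by (simp add: case_prod_unfold)
qed simp

text \<open>The integrand is A1 - A2 + A3: the quadratic entropy of \<open>V\<close>, minus the weak
  equation of \<open>V\<close> tested against \<open>c \<phi>\<close>, plus the exact quadratic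
  entropy balance of \<open>c\<close>. The equation for \<open>c\<close> leaves a remainder
  quadratic in V - c, multiplied by the space derivative of \<open>c\<close>.\<close>

lemma relative_entropy_inequality:
  fixes V :: "real \<times> real \<Rightarrow> real"
  assumes V: "V \<in> borel_measurable borel" "\<And>z. \<bar>V z\<bar> \<le> N" and M: "M \<le> N"
    and Kruzkov: "\<And>\<phi> \<phi>t \<phi>x k. test_function \<phi> \<phi>t \<phi>x \<Longrightarrow> (\<And>z. 0 \<le> \<phi> z) \<Longrightarrow> (\<And>z. T \<le> fst z \<Longrightarrow> \<phi> z = 0) \<Longrightarrow>
      0 \<le> (LINT z|lborel. \<bar>V z - k\<bar> * \<phi>t z + sgn (V z - k) * (f (V z) - f k) * \<phi>x z
      + sgn (V z - k) * g (V z) * \<phi> z)"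
    and test: "test_function \<phi> \<phi>t \<phi>x" "\<And>z. 0 \<le> \<phi> z" "\<And>z. T \<le> fst z \<Longrightarrow> \<phi> z = 0"
  defines "c \<equiv> \<lambda>z. u (fst z) (snd z)"
  shows "0 \<le> (LINT z|lborel. (V z - c z)\<^sup>2 / 2 * \<phi>t z
      + ((V z - c z) * f (V z) - (F (V z) - F (c z))) * \<phi>x z
      + ((V z - c z) * (g (V z) - g (c z)) - (f (V z) - f (c z) - f' (c z) * (V z - c z)) * ux z) * \<phi> z)"
    and "integrable lborel (\<lambda>z. (V z - c z)\<^sup>2 / 2 * \<phi>t z
      + ((V z - c z) * f (V z) - (F (V z) - F (c z))) * \<phi>x z
      + ((V z - c z) * (g (V z) - g (c z)) - (f (V z) - f (c z) - f' (c z) * (V z - c z)) * ux z) * \<phi> z)"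
proof -
  have [measurable]: "V \<in> borel_measurable borel" "f \<in> borel_measurable borel" "g \<in> borel_measurable borel"
      "F \<in> borel_measurable borel"
    using V(1) cont_coeffs by (auto intro: borel_measurable_continuous_onI)
  have cC1: "C1_half_plane c ut ux" using u_C1 by (simp add: c_def)
  note cont_c = C1_half_plane_continuous[OF cC1]
  note int = test_function_integrable[OF test(1)]
  have bounded: "\<exists>B. \<forall>z. \<bar>h (V z)\<bar> \<le> B" if h: "continuous_on UNIV h" for h :: "real \<Rightarrow> real"
  proof -
    obtain B where B: "\<And>x. x \<in> {-N..N} \<Longrightarrow> \<bar>h x\<bar> \<le> B"
      using compact_imp_bounded[OF compact_continuous_image[OF continuous_on_subset[OF h subset_UNIV] compact_Icc]]
      unfolding bounded_iff by (metis imageI real_norm_def)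
    have "V z \<in> {-N..N}" for z using V(2)[of z] by (auto simp: abs_le_iff)
    with B show ?thesis by blast
  qed
  define A1 where "A1 z = (V z)\<^sup>2 / 2 * \<phi>t z + (V z * f (V z) - F (V z)) * \<phi>x z + V z * g (V z) * \<phi> z" for z
  define A2 where "A2 z = V z * (ut z * \<phi> z + c z * \<phi>t z) + f (V z) * (ux z * \<phi> z + c z * \<phi>x z) + g (V z) * (c z * \<phi> z)" for z
  define A3 where "A3 z = (c z)\<^sup>2 / 2 * \<phi>t z + F (c z) * \<phi>x z + (c z * ut z + f (c z) * ux z) * \<phi> z" for z
  have K1: "0 \<le> (LINT z|lborel. A1 z)"
    unfolding A1_def
    by (rule quadratic_entropy_inequality[OF F cont_coeffs(1,3) V test(1)]) (rule Kruzkov[OF test])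
  have "\<exists>B. \<forall>z. \<bar>(V z)\<^sup>2 / 2\<bar> \<le> B" "\<exists>B. \<forall>z. \<bar>V z * f (V z) - F (V z)\<bar> \<le> B" "\<exists>B. \<forall>z. \<bar>V z * g (V z)\<bar> \<le> B"
    by (rule bounded[of "\<lambda>r. r\<^sup>2 / 2"] bounded[of "\<lambda>r. r * f r - F r"] bounded[of "\<lambda>r. r * g r"];
        intro continuous_intros cont_coeffs; simp)+
  then obtain B1 B2 B3 where "\<And>z. \<bar>(V z)\<^sup>2 / 2\<bar> \<le> B1" "\<And>z. \<bar>V z * f (V z) - F (V z)\<bar> \<le> B2" "\<And>z. \<bar>V z * g (V z)\<bar> \<le> B3"
    by auto
  then have A1: "integrable lborel A1"
    unfolding A1_def[abs_def]
    by (intro Bochner_Integration.integrable_add integrable_bounded_mult[where B=B1, OF int(2)]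
        integrable_bounded_mult[where B=B2, OF int(3)] integrable_bounded_mult[where B=B3, OF int(1)]) auto
  have C1M: "C1_half_plane (\<lambda>z. c z + N) ut ux"
    using C1_half_plane_compose[OF cC1 DERIV_add[OF DERIV_ident DERIV_const], of N] by simp
  \<comment> \<open>The function \<open>c \<phi>\<close> may be negative, while the Kruzkov
    inequalities need nonnegative test functions. Since c + N is nonnegative for t > 0, the shifted
    product is admissible; the shift is undone in \<open>A2_eq\<close> by subtracting N times the
    weak equality for \<open>\<phi>\<close>.\<close>
  define \<psi> where "\<psi> z = (c z + N) * \<phi> z" for z
  define \<psi>t where "\<psi>t z = ut z * \<phi> z + (c z + N) * \<phi>t z" for z
  define \<psi>x where "\<psi>x z = ux z * \<phi> z + (c z + N) * \<phi>x z" for z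
  have \<psi>: "test_function \<psi> \<psi>t \<psi>x"
    unfolding \<psi>_def[abs_def] \<psi>t_def[abs_def] \<psi>x_def[abs_def] by (rule test_function_mult[OF test(1) C1M])
  have \<psi>_nonneg: "0 \<le> \<psi> z" for z
  proof (cases "fst z > 0")
    case True
    then show ?thesis using u_bound[of "fst z" "snd z"] M test(2)[of z] unfolding \<psi>_def c_def
      by (intro mult_nonneg_nonneg) auto
  next
    case False
    then have "\<phi> z = 0" using test_function_support[OF test(1)] by (metis SigmaD1 greaterThan_iff prod.collapse subsetD)
    then show ?thesis by (simp add: \<psi>_def)
  qed
  have \<psi>T: "T \<le> fst z \<Longrightarrow> \<psi> z = 0" for z using test(3) by (simp add: \<psi>_def)
  note W1 = weak_equality[OF cont_coeffs(1,3) V \<psi> Kruzkov[OF \<psi> \<psi>_nonneg \<psi>T]]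
  note W2 = weak_equality[OF cont_coeffs(1,3) V test(1) Kruzkov[OF test]]
  have A2_eq: "A2 = (\<lambda>z. (V z * \<psi>t z + f (V z) * \<psi>x z + g (V z) * \<psi> z) - N * (V z * \<phi>t z + f (V z) * \<phi>x z + g (V z) * \<phi> z))"
    by (auto simp: fun_eq_iff A2_def \<psi>_def \<psi>t_def \<psi>x_def algebra_simps)
  have K2: "integrable lborel A2" "(LINT z|lborel. A2 z) = 0"
    unfolding A2_eq using W1 W2 by auto
  have cF: "C1_half_plane (\<lambda>z. F (c z)) (\<lambda>z. f (c z) * ut z) (\<lambda>z. f (c z) * ux z)"
    by (rule C1_half_plane_compose[OF cC1 F cont_coeffs(1)])
  have csq: "C1_half_plane (\<lambda>z. (c z)\<^sup>2 / 2) (\<lambda>z. c z * ut z) (\<lambda>z. c z * ux z)"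
    by (rule C1_half_plane_compose[OF cC1, of "\<lambda>r. r\<^sup>2 / 2" "\<lambda>r. r"]) (auto intro!: derivative_eq_intros continuous_intros)
  have K3: "(LINT z|lborel. A3 z) = 0"
    unfolding A3_def by (rule integral_by_parts_test_function[OF test(1) csq cF])
  have A3: "integrable lborel A3"
    unfolding A3_def[abs_def]
    by (intro Bochner_Integration.integrable_add integrable_test_function_mult(1-3)[OF test(1)]
        C1_half_plane_continuous[OF cF] C1_half_plane_continuous[OF csq] continuous_on_add)
  define E where "E z = (V z - c z)\<^sup>2 / 2 * \<phi>t z
      + ((V z - c z) * f (V z) - (F (V z) - F (c z))) * \<phi>x z
      + ((V z - c z) * (g (V z) - g (c z)) - (f (V z) - f (c z) - f' (c z) * (V z - c z)) * ux z) * \<phi> z" for z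
  have "A1 z - A2 z + A3 z = E z" for z
  proof (cases "fst z > 0")
    case True
    then have g: "g (c z) = ut z + f' (c z) * ux z" using pde[of z] by (simp add: c_def)
    show ?thesis unfolding A1_def A2_def A3_def E_def g by (simp add: field_simps power2_eq_square)
  next
    case False
    then have "\<phi> z = 0" "\<phi>t z = 0" "\<phi>x z = 0"
      using test_function_support[OF test(1)] by (metis SigmaD1 greaterThan_iff prod.collapse subsetD)+
    then show ?thesis by (simp add: A1_def A2_def A3_def E_def)
  qed
  then have E: "E = (\<lambda>z. A1 z - A2 z + A3 z)" by auto
  have "0 \<le> (LINT z|lborel. E z)" "integrable lborel E"
    unfolding E using A1 K2 A3 K1 K3 by auto
  then show "0 \<le> (LINT z|lborel. (V z - c z)\<^sup>2 / 2 * \<phi>t z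
      + ((V z - c z) * f (V z) - (F (V z) - F (c z))) * \<phi>x z
      + ((V z - c z) * (g (V z) - g (c z)) - (f (V z) - f (c z) - f' (c z) * (V z - c z)) * ux z) * \<phi> z)"
    and "integrable lborel (\<lambda>z. (V z - c z)\<^sup>2 / 2 * \<phi>t z
      + ((V z - c z) * f (V z) - (F (V z) - F (c z))) * \<phi>x z
      + ((V z - c z) * (g (V z) - g (c z)) - (f (V z) - f (c z) - f' (c z) * (V z - c z)) * ux z) * \<phi> z)"
    unfolding E_def[abs_def] .
qed

end

lemma Lipschitz_bound_exists:
  fixes h :: "real \<Rightarrow> real"
  assumes "\<And>x. (h has_real_derivative h' x) (at x)" "continuous_on UNIV h'"
  shows "\<exists>L\<ge>0. \<forall>x\<in>{\<alpha>..\<beta>}. \<forall>y\<in>{\<alpha>..\<beta>}. \<bar>h x - h y\<bar> \<le> L * \<bar>x - y\<bar>"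
proof (rule Lipschitz_on_interval[of \<alpha> \<beta> h h'])
  fix L assume "0 \<le> L" "\<And>x y. x \<in> {\<alpha>..\<beta>} \<Longrightarrow> y \<in> {\<alpha>..\<beta>} \<Longrightarrow> \<bar>h x - h y\<bar> \<le> L * \<bar>x - y\<bar>"
  then show ?thesis by blast
qed (rule assms(1) continuous_on_subset[OF assms(2) subset_UNIV])+

context classical_solution
begin

text \<open>Weak-strong uniqueness. As \<open>ux\<close> is bounded, both the flux and the remainder
  of the relative entropy are at most constants times \<open>D\<close>, half the squared distance.
  Localized to a backward cone, the weighted integral \<open>m\<close> of \<open>D\<close> is then
  nonincreasing and starts from 0. Larger and larger cones cover the line.\<close>

lemma entropy_solution_unique:
  assumes v: "entropy_solution f g (u 0) v" and t: "0 \<le> t"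
  shows "AE x in lborel. v t x = u t x"
proof (cases "t = 0")
  case True
  then show ?thesis using v by (simp add: entropy_solution_def)
next
  case False
  with t have t: "0 < t" by simp
  define T where "T = t + 1"
  have T: "t < T" by (simp add: T_def)
  obtain N0 where N0: "\<And>s. s \<in> {0..T} \<Longrightarrow> AE x in lborel. \<bar>v s x\<bar> \<le> N0"
    using v unfolding entropy_solution_def by meson
  define N where "N = max (max M N0) 0"
  have N: "M \<le> N" "N0 \<le> N" "0 \<le> N" by (auto simp: N_def)
  define w where "w z = indicator ({0..} \<times> UNIV) z *\<^sub>R v (fst z) (snd z)" for z
  define C where "C z = indicator ({0..} \<times> UNIV) z *\<^sub>R u (fst z) (snd z)" for z
  have wv: "w (s, x) = v s x" "C (s, x) = u s x" if "0 \<le> s" for s x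
    using that by (auto simp: w_def C_def)
  have w_meas [measurable]: "w \<in> borel_measurable borel"
    using v unfolding entropy_solution_def set_borel_measurable_def by (simp add: w_def[abs_def] case_prod_unfold)
  have C_meas [measurable]: "C \<in> borel_measurable borel"
    unfolding C_def[abs_def] by (rule borel_measurable_continuous_on_indicator[OF _ u_cont])
      (simp add: borel_closed closed_Times)
  have C_bound: "\<bar>C z\<bar> \<le> N" for z
    using u_bound[of "fst z" "snd z"] N by (auto simp: C_def indicator_def)
  \<comment> \<open>A bound on \<open>v\<close> holds only almost everywhere at each time, and
    depends on T. The truncation is bounded at every point and measurable, and it agrees with
    \<open>v\<close> almost everywhere at each time of [0, T]; test functions are restricted to
    times before T accordingly.\<close>
  define V where "V z = (if fst z \<in> {0..T} then max (- N) (min N (w z)) else 0)" for z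
  have V_meas [measurable]: "V \<in> borel_measurable borel"
  proof -
    have "V = (\<lambda>z. indicator ({0..T} \<times> UNIV) z * max (- N) (min N (w z)))"
      by (auto simp: fun_eq_iff V_def indicator_def)
    moreover have [measurable]: "{0..T} \<times> UNIV \<in> sets (borel :: (real \<times> real) measure)"
      by (simp add: borel_closed closed_Times)
    ultimately show ?thesis by simp
  qed
  have V_bound: "\<bar>V z\<bar> \<le> N" for z using N by (auto simp: V_def)
  have V_eq_w: "V (s, x) = w (s, x)" if "\<bar>w (s, x)\<bar> \<le> N0" "s \<in> {0..T}" for s x
    using that N by (auto simp: V_def)
  have Vv: "AE x in lborel. V (s, x) = v s x" if "s \<in> {0..T}" for s
    using N0[OF that] by eventually_elim (use V_eq_w that wv(1)[of s] in auto)
  have VvAE: "AE z in lborel. fst z \<in> {0..T} \<longrightarrow> V z = w z"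
  proof -
    have "AE z in lborel \<Otimes>\<^sub>M lborel. fst z \<in> {0..T} \<longrightarrow> V z = w z"
    proof (rule lborel_pair.AE_pair_measure)
      have [measurable]: "{0..T} \<times> UNIV \<in> sets (borel :: (real \<times> real) measure)"
        by (simp add: borel_closed closed_Times)
      have "{z \<in> space borel. indicator ({0..T} \<times> UNIV) z * (V z - w z) = 0} \<in> sets borel"
        by measurable
      moreover have "{z \<in> space borel. indicator ({0..T} \<times> UNIV) z * (V z - w z) = 0} =
          {z \<in> space (lborel \<Otimes>\<^sub>M lborel). fst z \<in> {0..T} \<longrightarrow> V z = w z}"
        by (auto simp: lborel_prod indicator_def)
      ultimately show "{z \<in> space (lborel \<Otimes>\<^sub>M lborel). fst z \<in> {0..T} \<longrightarrow> V z = w z} \<in> sets (lborel \<Otimes>\<^sub>M lborel)"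
        by (simp only: lborel_prod sets_lborel)
      show "AE s in lborel. AE x in lborel. fst (s, x) \<in> {0..T} \<longrightarrow> V (s, x) = w (s, x)"
      proof (rule AE_I2)
        fix s
        show "AE x in lborel. fst (s, x) \<in> {0..T} \<longrightarrow> V (s, x) = w (s, x)"
          using Vv[of s] wv[of s] by (cases "s \<in> {0..T}") auto
      qed
    qed
    then show ?thesis unfolding lborel_prod .
  qed
  have [measurable]: "f \<in> borel_measurable borel" "g \<in> borel_measurable borel"
    using cont_coeffs by (auto intro: borel_measurable_continuous_onI)
  have Kruzkov: "0 \<le> (LINT z|lborel. \<bar>V z - k\<bar> * \<phi>t z + sgn (V z - k) * (f (V z) - f k) * \<phi>x z
      + sgn (V z - k) * g (V z) * \<phi> z)"
    if test: "test_function \<phi> \<phi>t \<phi>x" "\<And>z. 0 \<le> \<phi> z" "\<And>z. T \<le> fst z \<Longrightarrow> \<phi> z = 0" for k \<phi> \<phi>t \<phi>x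
  proof -
    obtain K where K: "K \<subseteq> {0<..} \<times> UNIV" "\<And>z. z \<notin> K \<Longrightarrow> \<phi> z = 0" "\<And>z. z \<notin> K \<Longrightarrow> \<phi>t z = 0" "\<And>z. z \<notin> K \<Longrightarrow> \<phi>x z = 0"
      using test_function_support[OF test(1)] by metis
    have K0: "\<phi> z = 0 \<and> \<phi>t z = 0 \<and> \<phi>x z = 0" if "fst z \<notin> {0..T}" for z
    proof (cases "fst z > T")
      case True
      have op: "open {z :: real \<times> real. T < fst z}" by (intro open_Collect_less continuous_intros)
      have "\<phi>t z = 0" "\<phi>x z = 0"
        by (rule gradient_zero_outside[OF test_functionD(1)[OF test(1)] op]; use True test(3) in auto)+
      then show ?thesis using True test(3) by auto
    next
      case False
      then have "z \<notin> K" using K(1) that by auto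
      then show ?thesis using K by auto
    qed
    have [measurable]: "\<phi> \<in> borel_measurable borel" "\<phi>t \<in> borel_measurable borel" "\<phi>x \<in> borel_measurable borel"
      using test_functionD[OF test(1)] by (auto intro: borel_measurable_continuous_onI)
    have "0 \<le> (LINT z|lborel. \<bar>v (fst z) (snd z) - k\<bar> * \<phi>t z
        + sgn (v (fst z) (snd z) - k) * (f (v (fst z) (snd z)) - f k) * \<phi>x z
        + sgn (v (fst z) (snd z) - k) * g (v (fst z) (snd z)) * \<phi> z)"
      using v test(1,2) unfolding entropy_solution_def by (simp add: case_prod_unfold)
    also have "\<dots> = (LINT z|lborel. \<bar>w z - k\<bar> * \<phi>t z + sgn (w z - k) * (f (w z) - f k) * \<phi>x z
      + sgn (w z - k) * g (w z) * \<phi> z)"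
    proof (rule Bochner_Integration.integral_cong[OF refl])
      fix z :: "real \<times> real"
      show "\<bar>v (fst z) (snd z) - k\<bar> * \<phi>t z
        + sgn (v (fst z) (snd z) - k) * (f (v (fst z) (snd z)) - f k) * \<phi>x z
        + sgn (v (fst z) (snd z) - k) * g (v (fst z) (snd z)) * \<phi> z =
        \<bar>w z - k\<bar> * \<phi>t z + sgn (w z - k) * (f (w z) - f k) * \<phi>x z + sgn (w z - k) * g (w z) * \<phi> z"
        using K0[of z] wv(1)[of "fst z" "snd z"] by (cases "fst z \<in> {0..T}") auto
    qed
    also have "\<dots> = (LINT z|lborel. \<bar>V z - k\<bar> * \<phi>t z + sgn (V z - k) * (f (V z) - f k) * \<phi>x z
      + sgn (V z - k) * g (V z) * \<phi> z)"
    proof (rule integral_cong_AE)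
      show "AE z in lborel. \<bar>w z - k\<bar> * \<phi>t z + sgn (w z - k) * (f (w z) - f k) * \<phi>x z + sgn (w z - k) * g (w z) * \<phi> z
        = \<bar>V z - k\<bar> * \<phi>t z + sgn (V z - k) * (f (V z) - f k) * \<phi>x z + sgn (V z - k) * g (V z) * \<phi> z"
        using VvAE
      proof eventually_elim
        case (elim z)
        then show ?case using K0[of z] by (cases "fst z \<in> {0..T}") auto
      qed
    qed measurable
    finally show ?thesis .
  qed
  obtain Lf where Lf: "0 \<le> Lf" "\<And>x y. x \<in> {-N..N} \<Longrightarrow> y \<in> {-N..N} \<Longrightarrow> \<bar>f x - f y\<bar> \<le> Lf * \<bar>x - y\<bar>"
    using Lipschitz_bound_exists[OF f' cont_coeffs(2), of "-N" N] by blast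
  obtain L2 where L2: "0 \<le> L2" "\<And>x y. x \<in> {-N..N} \<Longrightarrow> y \<in> {-N..N} \<Longrightarrow> \<bar>f' x - f' y\<bar> \<le> L2 * \<bar>x - y\<bar>"
    using Lipschitz_bound_exists[OF f'', of "-N" N] by blast
  obtain Lg where Lg: "0 \<le> Lg" "\<And>x y. x \<in> {-N..N} \<Longrightarrow> y \<in> {-N..N} \<Longrightarrow> \<bar>g x - g y\<bar> \<le> Lg * \<bar>x - y\<bar>"
    using Lipschitz_bound_exists[OF g', of "-N" N] by blast
  have M1: "0 \<le> M1" using ux_bound[of "(1, 0)"] by simp
  \<comment> \<open>The factor 2, here and in \<open>\<Lambda>\<close>, turns the square of V - C
    into \<open>D\<close>, which carries a half.\<close>
  define L where "L = 2 * Lf"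
  define \<Lambda> where "\<Lambda> = 2 * (Lg + L2 * M1)"
  have L0: "0 \<le> L" "0 \<le> \<Lambda>" using Lf(1) L2(1) Lg(1) M1 by (auto simp: L_def \<Lambda>_def)
  define D where "D z = (V z - C z)\<^sup>2 / 2" for z
  have D_meas [measurable]: "D \<in> borel_measurable borel" unfolding D_def[abs_def] by measurable
  have D_nonneg: "0 \<le> D z" for z by (simp add: D_def)
  have VC: "\<bar>V z - C z\<bar> \<le> 2 * N" for z using V_bound[of z] C_bound[of z] by linarith
  have D_bound: "\<bar>D z\<bar> \<le> 2 * N\<^sup>2" for z
  proof -
    have "(V z - C z)\<^sup>2 \<le> (2 * N)\<^sup>2" using VC[of z] by (rule abs_le_square_iff[THEN iffD1, OF order_trans]) simp
    then show ?thesis by (simp add: D_def power2_eq_square)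
  qed
  have slice: "(\<lambda>x. h (s, x)) \<in> borel_measurable borel" if "h \<in> borel_measurable borel" for h :: "real \<times> real \<Rightarrow> real" and s
    by (rule measurable_compose[OF _ that]) (intro borel_measurable_continuous_onI continuous_intros)
  have Q_bound: "\<bar>(V z - C z) * f (V z) - (F (V z) - F (C z))\<bar> \<le> L * D z" for z
  proof -
    obtain \<xi> where \<xi>: "F (V z) - F (C z) = f \<xi> * (V z - C z)" "\<bar>\<xi> - V z\<bar> \<le> \<bar>V z - C z\<bar>" "min (V z) (C z) \<le> \<xi>" "\<xi> \<le> max (V z) (C z)"
      using mean_value_between[where h=F and h'=f and v="V z" and c="C z", OF F] by blast
    have "\<bar>f (V z) - f \<xi>\<bar> \<le> Lf * \<bar>V z - \<xi>\<bar>"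
      using \<xi>(3,4) V_bound[of z] C_bound[of z] by (intro Lf(2)) (auto simp: abs_le_iff min_def max_def split: if_splits)
    also have "\<dots> \<le> Lf * \<bar>V z - C z\<bar>" using \<xi>(2) Lf(1) by (intro mult_left_mono) auto
    finally have "\<bar>V z - C z\<bar> * \<bar>f (V z) - f \<xi>\<bar> \<le> \<bar>V z - C z\<bar> * (Lf * \<bar>V z - C z\<bar>)" by (intro mult_left_mono) auto
    also have "\<dots> = L * D z" by (simp add: L_def D_def power2_eq_square flip: abs_mult)
    finally show ?thesis unfolding \<xi>(1) by (simp add: algebra_simps flip: abs_mult)
  qed
  have R_bound: "\<bar>(V z - C z) * (g (V z) - g (C z)) - (f (V z) - f (C z) - f' (C z) * (V z - C z)) * ux z\<bar> \<le> \<Lambda> * D z"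
    if z: "0 < fst z" for z
  proof -
    have mem: "V z \<in> {-N..N}" "C z \<in> {-N..N}" using V_bound[of z] C_bound[of z] by (auto simp: abs_le_iff)
    obtain \<xi> where \<xi>: "f (V z) - f (C z) = f' \<xi> * (V z - C z)" "\<bar>\<xi> - C z\<bar> \<le> \<bar>V z - C z\<bar>" "min (V z) (C z) \<le> \<xi>" "\<xi> \<le> max (V z) (C z)"
      using mean_value_between[where h=f and h'=f' and v="V z" and c="C z", OF f'] by blast
    have "\<bar>f' \<xi> - f' (C z)\<bar> \<le> L2 * \<bar>\<xi> - C z\<bar>"
      using \<xi>(3,4) mem by (intro L2(2)) (auto simp: min_def max_def split: if_splits)
    also have "\<dots> \<le> L2 * \<bar>V z - C z\<bar>" using \<xi>(2) L2(1) by (intro mult_left_mono) auto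
    finally have "\<bar>(f' \<xi> - f' (C z)) * (V z - C z)\<bar> \<le> L2 * \<bar>V z - C z\<bar> * \<bar>V z - C z\<bar>"
      unfolding abs_mult by (rule mult_right_mono) simp
    then have "\<bar>(f' \<xi> - f' (C z)) * (V z - C z) * ux z\<bar> \<le> L2 * \<bar>V z - C z\<bar> * \<bar>V z - C z\<bar> * M1"
      unfolding abs_mult[of _ "ux z"] using ux_bound[OF z] L2(1) by (intro mult_mono) auto
    moreover have "\<bar>(V z - C z) * (g (V z) - g (C z))\<bar> \<le> \<bar>V z - C z\<bar> * (Lg * \<bar>V z - C z\<bar>)"
      unfolding abs_mult by (intro mult_left_mono Lg(2) mem) simp
    moreover have "(f (V z) - f (C z) - f' (C z) * (V z - C z)) * ux z = (f' \<xi> - f' (C z)) * (V z - C z) * ux z"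
      unfolding \<xi>(1) by (simp add: algebra_simps)
    moreover have "\<bar>V z - C z\<bar> * (Lg * \<bar>V z - C z\<bar>) + L2 * \<bar>V z - C z\<bar> * \<bar>V z - C z\<bar> * M1 = \<Lambda> * D z"
      by (simp add: \<Lambda>_def D_def power2_eq_square algebra_simps flip: abs_mult)
    ultimately show ?thesis by (smt (verit) abs_triangle_ineq4)
  qed
  have key: "AE x in lborel. 0 < \<rho> - L * t - sqrt (1 + x\<^sup>2) \<longrightarrow> V (t, x) = C (t, x)" if \<rho>: "\<rho> > 0" for \<rho>
  proof -
    \<comment> \<open>The weight \<open>\<zeta>\<close> lives in a backward cone of slope \<open>L\<close>, which absorbs the flux, and decays at the rate \<open>\<Lambda>\<close>,
      which absorbs the source; \<open>sqrt (1 + x\<^sup>2)\<close> is a smooth substitute for \<open>\<bar>x\<bar>\<close>.\<close>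
    define r where "r z = \<rho> - L * fst z - sqrt (1 + (snd z)\<^sup>2)" for z :: "real \<times> real"
    define e where "e z = exp (- \<Lambda> * fst z)" for z :: "real \<times> real"
    define \<zeta> where "\<zeta> z = e z * (max (r z) 0)\<^sup>2" for z
    define \<beta> where "\<beta> z = e z * (2 * max (r z) 0)" for z
    define \<alpha> where "\<alpha> z = snd z / sqrt (1 + (snd z)\<^sup>2)" for z :: "real \<times> real"
    have sq: "1 + (x::real)\<^sup>2 > 0" "sqrt (1 + x\<^sup>2) > 0" "\<bar>x\<bar> \<le> sqrt (1 + x\<^sup>2)" for x
      by (auto intro!: real_le_rsqrt add_pos_nonneg)
    have r_grad: "has_gradient r (- L) (- \<alpha> z) z" for z
      unfolding r_def[abs_def] \<alpha>_def using sq(1)[of "snd z"] sq(2)[of "snd z"]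
      by (auto intro!: derivative_eq_intros simp: fun_eq_iff field_simps)
    have e_grad: "has_gradient e (- \<Lambda> * e z) 0 z" for z
      unfolding e_def[abs_def] by (auto intro!: derivative_eq_intros simp: fun_eq_iff)
    have \<zeta>_grad: "has_gradient \<zeta> (- \<Lambda> * \<zeta> z - L * \<beta> z) (- \<alpha> z * \<beta> z) z" for z
      using has_gradient_mult[OF e_grad has_gradient_compose[OF r_grad pos_part_square_deriv], of z]
      unfolding \<zeta>_def[abs_def] \<beta>_def by (rule has_derivative_eq_rhs) (auto simp: fun_eq_iff algebra_simps)
    have ne: "sqrt (1 + (snd z)\<^sup>2) \<noteq> 0" for z :: "real \<times> real" using sq(2)[of "snd z"] by linarith
    have cont: "continuous_on UNIV \<zeta>" "continuous_on UNIV \<beta>" "continuous_on UNIV \<alpha>"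
      unfolding \<zeta>_def[abs_def] \<beta>_def[abs_def] \<alpha>_def[abs_def] e_def r_def
      by (intro continuous_intros ballI ne)+
    have \<zeta>_nonneg: "0 \<le> \<zeta> z" and \<beta>_nonneg: "0 \<le> \<beta> z" for z by (auto simp: \<zeta>_def \<beta>_def e_def)
    have \<alpha>1: "\<bar>\<alpha> z\<bar> \<le> 1" for z using sq[of "snd z"] by (simp add: \<alpha>_def)
    have r0: "r z \<le> 0" if "snd z \<notin> {-\<rho>..\<rho>}" "0 \<le> fst z" for z
      using that sq(3)[of "snd z"] mult_nonneg_nonneg[OF L0(1) that(2)] by (auto simp: r_def)
    have \<zeta>_bound: "\<bar>\<zeta> (s, x)\<bar> \<le> indicator {-\<rho>..\<rho>} x * \<rho>\<^sup>2" if "0 \<le> s" for s x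
    proof (cases "x \<in> {-\<rho>..\<rho>}")
      case True
      have "r (s, x) \<le> \<rho>" using sq(2)[of x] mult_nonneg_nonneg[OF L0(1) that] unfolding r_def fst_conv snd_conv by linarith
      then have "(max (r (s, x)) 0)\<^sup>2 \<le> \<rho>\<^sup>2" using \<rho> by (intro power_mono) auto
      moreover have "e (s, x) \<le> 1" "0 \<le> e (s, x)" using that L0(2) by (auto simp: e_def)
      ultimately have "e (s, x) * (max (r (s, x)) 0)\<^sup>2 \<le> 1 * \<rho>\<^sup>2" by (intro mult_mono) auto
      then show ?thesis using True \<zeta>_nonneg[of "(s, x)"] by (simp add: \<zeta>_def)
    next
      case False
      then have "r (s, x) \<le> 0" using that by (intro r0) auto
      then show ?thesis by (simp add: \<zeta>_def max_def)
    qed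
    have \<zeta>_section: "(\<lambda>x. \<zeta> (s, x)) \<in> borel_measurable borel" for s
      by (rule slice[OF borel_measurable_continuous_onI[OF cont(1)]])
    have ind_int: "integrable lborel (indicat_real {-\<rho>..\<rho>})"
      by (rule integrable_real_indicator) (auto simp: emeasure_lborel_Icc_eq)
    have section_int: "integrable lborel (\<lambda>x. D (s', x) * \<zeta> (s, x))" if "0 \<le> s" for s s'
    proof (rule Bochner_Integration.integrable_bound)
      show "integrable lborel (\<lambda>x. 2 * N\<^sup>2 * (indicat_real {-\<rho>..\<rho>} x * \<rho>\<^sup>2))" using ind_int by simp
      show "AE x in lborel. norm (D (s', x) * \<zeta> (s, x)) \<le> norm (2 * N\<^sup>2 * (indicat_real {-\<rho>..\<rho>} x * \<rho>\<^sup>2))"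
        using mult_mono[OF D_bound \<zeta>_bound[OF that]] by (intro AE_I2) (simp add: abs_mult)
    qed (use slice[OF D_meas] \<zeta>_section in measurable)
    define m where "m s = (LINT x|lborel. D (s, x) * \<zeta> (s, x))" for s
    have Fub: "integrable lborel (\<lambda>s. h s * m s) \<and> integrable lborel (\<lambda>z. D z * (h (fst z) * \<zeta> z)) \<and>
        (LINT z|lborel. D z * (h (fst z) * \<zeta> z)) = (LINT s|lborel. h s * m s)"
      if h: "continuous_on UNIV h" "\<And>s. s \<notin> {0..T} \<Longrightarrow> h s = 0" for h
    proof -
      have 1: "integrable lborel (\<lambda>z. D z * (h (fst z) * \<zeta> z))"
      proof (rule integrable_bounded_mult[OF _ _ D_bound])
        show "integrable lborel (\<lambda>z. h (fst z) * \<zeta> z)"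
        proof (rule integrable_compact_support)
          show "continuous_on UNIV (\<lambda>z. h (fst z) * \<zeta> z)"
            by (intro continuous_intros cont continuous_on_compose2[OF h(1)]) auto
          show "compact ({0..T} \<times> {-\<rho>..\<rho>})" by (intro compact_Times compact_Icc)
          show "h (fst z) * \<zeta> z = 0" if "z \<notin> {0..T} \<times> {-\<rho>..\<rho>}" for z
            using that h(2)[of "fst z"] \<zeta>_bound[of "fst z" "snd z"] by (cases "fst z \<in> {0..T}") (auto simp: mem_Times_iff)
        qed
      qed (use D_meas in measurable)
      then have 2: "integrable (lborel \<Otimes>\<^sub>M lborel) (\<lambda>z. D z * (h (fst z) * \<zeta> z))" by (simp add: lborel_prod)
      have 3: "(LINT x|lborel. D (s, x) * (h (fst (s, x)) * \<zeta> (s, x))) = h s * m s" for s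
        unfolding m_def by (subst integral_mult_right_zero[symmetric]) (simp add: algebra_simps)
      have "integrable lborel (\<lambda>s. h s * m s)" "(LINT z|lborel. D z * (h (fst z) * \<zeta> z)) = (LINT s|lborel. h s * m s)"
        using lborel_pair.integrable_fst'[OF 2] lborel_pair.integral_fst'[OF 2] unfolding 3 by (simp_all add: lborel_prod)
      with 1 show ?thesis by blast
    qed
    have "m t = 0"
    proof (rule nonneg_function_zero_of_test[where T=T and m=m and t=t])
      show "0 \<le> m s" for s unfolding m_def using D_nonneg \<zeta>_nonneg by (intro integral_nonneg_AE AE_I2) auto
      have "AE x in lborel. v 0 x = u 0 x" using v by (simp add: entropy_solution_def)
      moreover have "AE x in lborel. V (0, x) = v 0 x" using t by (intro Vv) (auto simp: T_def)
      ultimately have "AE x in lborel. D (0, x) * \<zeta> (0, x) = 0"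
        by eventually_elim (simp add: D_def wv)
      then show "m 0 = 0" unfolding m_def by (rule integral_eq_zero_AE)
      show "integrable lborel (\<lambda>s. h s * m s)" if "continuous_on UNIV h" "\<And>s. s \<notin> {0..T} \<Longrightarrow> h s = 0" for h
        using Fub that by blast
      show "0 \<le> (LINT s|lborel. \<theta>' s * m s)"
        if \<theta>: "\<And>s. (\<theta> has_real_derivative \<theta>' s) (at s)" "continuous_on UNIV \<theta>'" "\<And>s. 0 \<le> \<theta> s"
          and ab: "0 < a" "b < T" and supp: "\<And>s. s \<notin> {a..b} \<Longrightarrow> \<theta> s = 0" for \<theta> \<theta>' a b
      proof -
        have \<theta>'0: "\<theta>' s = 0" if "s \<notin> {a..b}" for s
        proof -
          have "(\<theta> has_real_derivative 0) (at s)"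
            by (rule has_field_derivative_transform_within_open[OF DERIV_const, of "- {a..b}" s 0]) (use that supp in auto)
          then show ?thesis using \<theta>(1) DERIV_unique by blast
        qed
        have cont_\<theta>: "continuous_on UNIV \<theta>" using \<theta>(1) by (meson DERIV_isCont continuous_at_imp_continuous_on)
        define \<phi> where "\<phi> z = \<theta> (fst z) * \<zeta> z" for z
        define \<phi>t where "\<phi>t z = \<theta>' (fst z) * \<zeta> z + \<theta> (fst z) * (- \<Lambda> * \<zeta> z - L * \<beta> z)" for z
        define \<phi>x where "\<phi>x z = \<theta> (fst z) * (- \<alpha> z * \<beta> z)" for z
        have fst_grad: "has_gradient fst 1 0 z" for z :: "real \<times> real"
          by (auto intro!: derivative_eq_intros simp: fun_eq_iff)
        have test: "test_function \<phi> \<phi>t \<phi>x"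
          unfolding test_function_def
        proof (intro conjI allI exI[of _ "{a..b} \<times> {-\<rho>..\<rho>}"] impI)
          show "has_gradient \<phi> (\<phi>t z) (\<phi>x z) z" for z
            using has_gradient_mult[OF has_gradient_compose[OF fst_grad \<theta>(1)] \<zeta>_grad, of z]
            unfolding \<phi>_def[abs_def] \<phi>t_def \<phi>x_def by simp
          show "continuous_on UNIV \<phi>t" "continuous_on UNIV \<phi>x"
            unfolding \<phi>t_def[abs_def] \<phi>x_def[abs_def]
            by (intro continuous_intros cont continuous_on_compose2[OF \<theta>(2)] continuous_on_compose2[OF cont_\<theta>]; simp)+
          show "compact ({a..b} \<times> {-\<rho>..\<rho>})" by (intro compact_Times compact_Icc)
          show "{a..b} \<times> {-\<rho>..\<rho>} \<subseteq> {0<..} \<times> UNIV" using ab by auto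
          show "\<phi> z = 0" if "z \<notin> {a..b} \<times> {-\<rho>..\<rho>}" for z
            using that supp[of "fst z"] \<zeta>_bound[of "fst z" "snd z"] ab
            by (cases "fst z \<in> {a..b}") (auto simp: \<phi>_def mem_Times_iff)
        qed
        have \<phi>0: "0 \<le> \<phi> z" for z using \<theta>(3) \<zeta>_nonneg by (simp add: \<phi>_def)
        have \<phi>T: "T \<le> fst z \<Longrightarrow> \<phi> z = 0" for z using supp[of "fst z"] ab by (auto simp: \<phi>_def)
        define E where "E z = (V z - u (fst z) (snd z))\<^sup>2 / 2 * \<phi>t z
          + ((V z - u (fst z) (snd z)) * f (V z) - (F (V z) - F (u (fst z) (snd z)))) * \<phi>x z
          + ((V z - u (fst z) (snd z)) * (g (V z) - g (u (fst z) (snd z)))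
             - (f (V z) - f (u (fst z) (snd z)) - f' (u (fst z) (snd z)) * (V z - u (fst z) (snd z))) * ux z) * \<phi> z" for z
        have E: "0 \<le> (LINT z|lborel. E z)" "integrable lborel E"
          unfolding E_def[abs_def]
          by (rule relative_entropy_inequality[OF V_meas V_bound N(1) Kruzkov test \<phi>0 \<phi>T]; assumption)+
        \<comment> \<open>The two negative terms of \<open>\<phi>t\<close> that stem from the slope
          of the cone and from the exponential absorb the flux and the remainder. Only the
          derivative of the time cut-off \<open>\<theta>\<close> is left.\<close>
        have E_le: "E z \<le> D z * (\<theta>' (fst z) * \<zeta> z)" for z
        proof (cases "fst z \<in> {a..b}")
          case True
          then have z: "0 < fst z" using ab by auto
          have Cu: "u (fst z) (snd z) = C z" using wv(2)[of "fst z" "snd z"] z by simp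
          define Q where "Q = (V z - C z) * f (V z) - (F (V z) - F (C z))"
          define R where "R = (V z - C z) * (g (V z) - g (C z)) - (f (V z) - f (C z) - f' (C z) * (V z - C z)) * ux z"
          have "- \<alpha> z * Q \<le> 1 * (L * D z)"
          proof -
            have "- \<alpha> z * Q \<le> \<bar>\<alpha> z\<bar> * \<bar>Q\<bar>" by (metis abs_ge_self abs_minus_cancel abs_mult)
            also have "\<dots> \<le> 1 * (L * D z)" using \<alpha>1[of z] Q_bound[of z] by (intro mult_mono) (auto simp: Q_def)
            finally show ?thesis .
          qed
          then have 1: "\<theta> (fst z) * \<beta> z * (- \<alpha> z * Q) \<le> \<theta> (fst z) * \<beta> z * (L * D z)"
            using \<theta>(3) \<beta>_nonneg by (intro mult_left_mono) auto
          have "R \<le> \<Lambda> * D z" using R_bound[OF z] by (simp add: R_def abs_le_iff)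
          then have 2: "\<phi> z * R \<le> \<phi> z * (\<Lambda> * D z)" using \<phi>0 by (intro mult_left_mono) auto
          have "E z = D z * \<phi>t z + Q * \<phi>x z + R * \<phi> z"
            unfolding E_def Cu Q_def R_def D_def by simp
          also have "\<dots> = D z * (\<theta>' (fst z) * \<zeta> z) + \<theta> (fst z) * \<beta> z * (- \<alpha> z * Q) - \<theta> (fst z) * \<beta> z * (L * D z)
              + \<phi> z * R - \<phi> z * (\<Lambda> * D z)"
            by (simp add: \<phi>t_def \<phi>x_def \<phi>_def algebra_simps)
          finally show ?thesis using 1 2 by linarith
        next
          case False
          then show ?thesis using \<theta>'0[of "fst z"] supp[of "fst z"]
            by (simp add: E_def \<phi>_def \<phi>t_def \<phi>x_def)
        qed
        have \<theta>'T: "\<theta>' s = 0" if "s \<notin> {0..T}" for s using \<theta>'0[of s] that ab by auto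
        note Fub' = Fub[OF \<theta>(2) \<theta>'T]
        have "(LINT z|lborel. E z) \<le> (LINT z|lborel. D z * (\<theta>' (fst z) * \<zeta> z))"
          by (rule integral_mono[OF E(2) _ E_le]) (use Fub' in blast)
        also have "\<dots> = (LINT s|lborel. \<theta>' s * m s)" using Fub' by blast
        finally show ?thesis using E(1) by linarith
      qed
      show "(m \<longlongrightarrow> m s) (at s within {0..T})" if s: "0 \<le> s" "s < T" for s
        unfolding tendsto_at_iff_sequentially comp_def
      proof (intro allI impI)
        fix X assume X': "\<forall>i. X i \<in> {0..T} - {s}" and Xs: "X \<longlonglongrightarrow> s"
        then have X: "X i \<in> {0..T}" "0 \<le> X i" for i by auto
        \<comment> \<open>The intermediate quantity moves the weight and freezes \<open>D\<close> at
          time s. It tends to \<open>m s\<close> by dominated convergence, and its distance to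
          \<open>m (X n)\<close> is controlled by the L1 continuity in time of \<open>v\<close> and
          \<open>u\<close> on [- \<rho>, \<rho>].\<close>
        define a where "a n = (LINT x|lborel. D (s, x) * \<zeta> (X n, x))" for n
        have a: "a \<longlonglongrightarrow> m s"
          unfolding a_def[abs_def] m_def
        proof (rule integral_dominated_convergence[where w="\<lambda>x. 2 * N\<^sup>2 * (indicat_real {-\<rho>..\<rho>} x * \<rho>\<^sup>2)"])
          show "integrable lborel (\<lambda>x. 2 * N\<^sup>2 * (indicat_real {-\<rho>..\<rho>} x * \<rho>\<^sup>2))" using ind_int by simp
          show "AE x in lborel. norm (D (s, x) * \<zeta> (X n, x)) \<le> 2 * N\<^sup>2 * (indicat_real {-\<rho>..\<rho>} x * \<rho>\<^sup>2)" for n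
            using mult_mono[OF D_bound \<zeta>_bound[OF X(2)]] by (intro AE_I2) (simp add: abs_mult)
          have "(\<lambda>n. \<zeta> (X n, x)) \<longlonglongrightarrow> \<zeta> (s, x)" for x
            using continuous_on_tendsto_compose[OF cont(1) tendsto_Pair[OF Xs tendsto_const, of x]] by simp
          then show "AE x in lborel. (\<lambda>n. D (s, x) * \<zeta> (X n, x)) \<longlonglongrightarrow> D (s, x) * \<zeta> (s, x)"
            by (intro AE_I2 tendsto_intros)
        qed (use slice[OF D_meas] \<zeta>_section in measurable)
        define Iv where "Iv n = (LINT x:{-\<rho>..\<rho>}|lborel. \<bar>v (X n) x - v s x\<bar>)" for n
        define Iu where "Iu n = (LINT x:{-\<rho>..\<rho>}|lborel. \<bar>u (X n) x - u s x\<bar>)" for n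
        have "((\<lambda>t. LINT x:{-\<rho>..\<rho>}|lborel. \<bar>v t x - v s x\<bar>) \<longlongrightarrow> 0) (at s within {0..})"
          using v s unfolding entropy_solution_def by blast
        then have Iv: "Iv \<longlonglongrightarrow> 0"
          unfolding Iv_def[abs_def] tendsto_at_iff_sequentially comp_def using X' Xs by auto
        have Iu: "Iu \<longlonglongrightarrow> 0"
          unfolding Iu_def[abs_def] by (rule L1_loc_continuous_sequence[OF Xs X(2) s(1)])
        have bd: "\<bar>m (X n) - a n\<bar> \<le> \<rho>\<^sup>2 * (2 * N) * (Iv n + Iu n)" for n
        proof -
          define h where "h x = indicat_real {-\<rho>..\<rho>} x * \<bar>V (X n, x) - V (s, x)\<bar>" for x
          define k where "k x = indicat_real {-\<rho>..\<rho>} x * \<bar>C (X n, x) - C (s, x)\<bar>" for x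
          note [measurable] = slice[OF V_meas] slice[OF C_meas] slice[OF w_meas]
          have h_int: "integrable lborel h"
            unfolding h_def[abs_def]
          proof (rule Bochner_Integration.integrable_bound)
            show "integrable lborel (\<lambda>x. indicat_real {-\<rho>..\<rho>} x * (2 * N))" using ind_int by simp
            have "\<bar>V (X n, x) - V (s, x)\<bar> \<le> 2 * N" for x using V_bound[of "(X n, x)"] V_bound[of "(s, x)"] by linarith
            then show "AE x in lborel. norm (indicat_real {-\<rho>..\<rho>} x * \<bar>V (X n, x) - V (s, x)\<bar>) \<le> norm (indicat_real {-\<rho>..\<rho>} x * (2 * N))"
              using N by (intro AE_I2) (auto simp: indicator_def)
          qed measurable
          have k_int: "integrable lborel k"
            unfolding k_def[abs_def]
          proof (rule Bochner_Integration.integrable_bound)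
            show "integrable lborel (\<lambda>x. indicat_real {-\<rho>..\<rho>} x * (2 * N))" using ind_int by simp
            have "\<bar>C (X n, x) - C (s, x)\<bar> \<le> 2 * N" for x using C_bound[of "(X n, x)"] C_bound[of "(s, x)"] by linarith
            then show "AE x in lborel. norm (indicat_real {-\<rho>..\<rho>} x * \<bar>C (X n, x) - C (s, x)\<bar>) \<le> norm (indicat_real {-\<rho>..\<rho>} x * (2 * N))"
              using N by (intro AE_I2) (auto simp: indicator_def)
          qed measurable
          have hv: "(LINT x|lborel. h x) = Iv n"
          proof -
            have "(LINT x|lborel. h x) = (LINT x|lborel. indicat_real {-\<rho>..\<rho>} x * \<bar>w (X n, x) - w (s, x)\<bar>)"
              unfolding h_def
            proof (rule integral_cong_AE)
              show "AE x in lborel. indicat_real {-\<rho>..\<rho>} x * \<bar>V (X n, x) - V (s, x)\<bar> = indicat_real {-\<rho>..\<rho>} x * \<bar>w (X n, x) - w (s, x)\<bar>"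
                using Vv[OF X(1)[of n]] Vv[of s] s by (auto simp: wv X(2))
            qed measurable
            also have "\<dots> = Iv n" by (simp add: Iv_def set_lebesgue_integral_def wv X(2) s)
            finally show ?thesis .
          qed
          have ku: "(LINT x|lborel. k x) = Iu n"
            by (simp add: k_def Iu_def set_lebesgue_integral_def wv X(2) s)
          have pw: "\<bar>D (X n, x) * \<zeta> (X n, x) - D (s, x) * \<zeta> (X n, x)\<bar> \<le> \<rho>\<^sup>2 * (2 * N) * (h x + k x)" for x
          proof -
            define p where "p = V (X n, x) - C (X n, x)"
            define q where "q = V (s, x) - C (s, x)"
            have pq: "\<bar>p + q\<bar> \<le> 4 * N" using VC[of "(X n, x)"] VC[of "(s, x)"] unfolding p_def q_def by linarith
            have "\<bar>D (X n, x) - D (s, x)\<bar> = \<bar>p + q\<bar> * \<bar>p - q\<bar> / 2"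
              unfolding D_def p_def[symmetric] q_def[symmetric] by (simp add: power2_eq_square algebra_simps flip: abs_mult diff_divide_distrib)
            also have "\<dots> \<le> 4 * N * (\<bar>V (X n, x) - V (s, x)\<bar> + \<bar>C (X n, x) - C (s, x)\<bar>) / 2"
              using pq N(3) by (intro divide_right_mono mult_mono) (auto simp: p_def q_def)
            finally have 1: "\<bar>D (X n, x) - D (s, x)\<bar> \<le> 2 * N * (\<bar>V (X n, x) - V (s, x)\<bar> + \<bar>C (X n, x) - C (s, x)\<bar>)" by simp
            have "\<bar>(D (X n, x) - D (s, x)) * \<zeta> (X n, x)\<bar> \<le>
               (2 * N * (\<bar>V (X n, x) - V (s, x)\<bar> + \<bar>C (X n, x) - C (s, x)\<bar>)) * (indicat_real {-\<rho>..\<rho>} x * \<rho>\<^sup>2)"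
              unfolding abs_mult using N(3) by (intro mult_mono 1 \<zeta>_bound X(2)) auto
            then show ?thesis by (simp add: h_def k_def algebra_simps)
          qed
          have "\<bar>m (X n) - a n\<bar> = \<bar>LINT x|lborel. D (X n, x) * \<zeta> (X n, x) - D (s, x) * \<zeta> (X n, x)\<bar>"
            unfolding m_def a_def using section_int X(2) by (subst Bochner_Integration.integral_diff) auto
          also have "\<dots> \<le> (LINT x|lborel. \<bar>D (X n, x) * \<zeta> (X n, x) - D (s, x) * \<zeta> (X n, x)\<bar>)"
            by (rule integral_abs_bound)
          also have "\<dots> \<le> (LINT x|lborel. \<rho>\<^sup>2 * (2 * N) * (h x + k x))"
            using section_int[OF X(2)] h_int k_int by (intro integral_mono pw) auto
          also have "\<dots> = \<rho>\<^sup>2 * (2 * N) * (Iv n + Iu n)"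
            using h_int k_int hv ku by simp
          finally show ?thesis .
        qed
        have "(\<lambda>n. \<rho>\<^sup>2 * (2 * N) * (Iv n + Iu n)) \<longlonglongrightarrow> \<rho>\<^sup>2 * (2 * N) * (0 + 0)"
          by (intro tendsto_intros Iv Iu)
        then have lim: "(\<lambda>n. \<rho>\<^sup>2 * (2 * N) * (Iv n + Iu n)) \<longlonglongrightarrow> 0" by simp
        have "(\<lambda>n. m (X n) - a n) \<longlonglongrightarrow> 0"
          by (rule Lim_null_comparison[OF always_eventually lim]) (simp add: bd)
        from tendsto_add[OF this a] show "(\<lambda>n. m (X n)) \<longlonglongrightarrow> m s" by simp
      qed
    qed (use t T in auto)
    then have "AE x in lborel. D (t, x) * \<zeta> (t, x) = 0"
      unfolding m_def using section_int[of t t] t D_nonneg \<zeta>_nonneg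
      by (subst (asm) integral_nonneg_eq_0_iff_AE) auto
    then show ?thesis
    proof eventually_elim
      case (elim x)
      show ?case
      proof
        assume "0 < \<rho> - L * t - sqrt (1 + x\<^sup>2)"
        then have "\<zeta> (t, x) > 0" by (simp add: \<zeta>_def r_def e_def)
        with elim show "V (t, x) = C (t, x)" by (simp add: D_def)
      qed
    qed
  qed
  \<comment> \<open>Integer radii suffice to exhaust the line, and they keep the union of the
    exceptional sets null.\<close>
  have "AE x in lborel. \<forall>n::nat. 0 < real (Suc n) - L * t - sqrt (1 + x\<^sup>2) \<longrightarrow> V (t, x) = C (t, x)"
    unfolding AE_all_countable using key by simp
  moreover have "AE x in lborel. V (t, x) = v t x" using t T by (intro Vv) auto
  ultimately show ?thesis
  proof eventually_elim
    case (elim x)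
    obtain n :: nat where "L * t + sqrt (1 + x\<^sup>2) < real n" using reals_Archimedean2 by blast
    then have "0 < real (Suc n) - L * t - sqrt (1 + x\<^sup>2)" by simp
    then have "V (t, x) = C (t, x)" using elim(1) by blast
    then show ?case using elim(2) wv t by simp
  qed
qed

end

subsection \<open>The weighted norm and the profile equation\<close>

lemma AE_open_empty:
  fixes S :: "'a::euclidean_space set"
  assumes "open S" "AE x in lborel. x \<notin> S"
  shows "S = {}"
proof (rule ccontr)
  assume "S \<noteq> {}"
  have "S \<in> null_sets lborel" using assms by (subst AE_iff_null_sets) auto
  then have "negligible S" by (simp add: negligible_iff_null_sets null_sets_completionI)
  then show False using open_not_negligible[OF assms(1) \<open>S \<noteq> {}\<close>] by simp
qed

lemma AE_continuous_nonneg: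
  fixes p :: "real \<Rightarrow> real"
  assumes "continuous_on UNIV p" "AE x in lborel. 0 \<le> p x"
  shows "0 \<le> p x"
proof -
  have "open {x. p x < 0}" using assms(1) by (intro open_Collect_less) auto
  moreover have "AE x in lborel. x \<notin> {x. p x < 0}" using assms(2) by eventually_elim auto
  ultimately have "{x. p x < 0} = {}" by (rule AE_open_empty)
  then show ?thesis by (metis (mono_tags) empty_Collect_eq not_less)
qed

lemma Omega_plus_eq: "Omega_plus \<kappa> x = exp (- \<kappa> * max x 0)"
  by (simp add: Omega_plus_def Omega_def)

lemma Omega_plus_pos: "0 < Omega_plus \<kappa> x"
  by (simp add: Omega_plus_eq)

lemma Omega_plus_continuous: "continuous_on A (Omega_plus \<kappa>)"
  unfolding Omega_plus_eq[abs_def] by (intro continuous_intros)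

lemma weak_derivative_classical:
  assumes v: "\<And>x. (v has_real_derivative v' x) (at x)" "continuous_on UNIV v'"
  shows "weak_derivative v v'"
  unfolding weak_derivative_def
proof (intro conjI allI impI)
  have cont_v: "continuous_on UNIV v" using v(1) by (meson DERIV_isCont continuous_at_imp_continuous_on)
  show "set_integrable lborel {a..b} v" "set_integrable lborel {a..b} v'" for a b
    unfolding set_integrable_def
    by (intro borel_integrable_compact compact_Icc continuous_on_subset[OF cont_v] continuous_on_subset[OF v(2)]; simp)+
  fix \<phi> \<phi>'
  assume *: "(\<forall>x. (\<phi> has_real_derivative \<phi>' x) (at x)) \<and> continuous_on UNIV \<phi>' \<and> (\<exists>R. \<forall>x. R < \<bar>x\<bar> \<longrightarrow> \<phi> x = 0)"
  then have \<phi>: "\<And>x. (\<phi> has_real_derivative \<phi>' x) (at x)" "continuous_on UNIV \<phi>'" by auto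
  obtain R where R: "\<And>x. R < \<bar>x\<bar> \<Longrightarrow> \<phi> x = 0" using * by blast
  have \<phi>'0: "\<phi>' x = 0" if "R < \<bar>x\<bar>" for x
  proof -
    have "open {x :: real. R < \<bar>x\<bar>}" by (intro open_Collect_less continuous_intros)
    then have "(\<phi> has_real_derivative 0) (at x)"
      by (rule has_field_derivative_transform_within_open[OF DERIV_const]) (use that R in auto)
    then show ?thesis using \<phi>(1) DERIV_unique by blast
  qed
  have cont_\<phi>: "continuous_on UNIV \<phi>" using \<phi>(1) by (meson DERIV_isCont continuous_at_imp_continuous_on)
  have out: "R < \<bar>x\<bar>" if "x \<notin> {-R..R}" for x using that by (auto simp: abs_if)
  have int: "integrable lborel (\<lambda>x. v x * \<phi>' x)"
    by (rule integrable_compact_support[OF continuous_on_mult[OF cont_v \<phi>(2)] compact_Icc[of "-R" R]])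
      (simp add: \<phi>'0[OF out])
  have int': "integrable lborel (\<lambda>x. v' x * \<phi> x)"
    by (rule integrable_compact_support[OF continuous_on_mult[OF v(2) cont_\<phi>] compact_Icc[of "-R" R]])
      (simp add: R[OF out])
  have "(LINT x|lborel. v x * \<phi>' x + v' x * \<phi> x) = 0"
  proof (rule integral_FTC_support[where F="\<lambda>x. v x * \<phi> x" and R=R])
    show "((\<lambda>x. v x * \<phi> x) has_real_derivative v x * \<phi>' x + v' x * \<phi> x) (at x)" for x
      by (rule DERIV_cong[OF DERIV_mult[OF v(1) \<phi>(1)]]) simp
  qed (use R in \<open>auto intro!: continuous_on_add continuous_on_mult cont_v cont_\<phi> v \<phi>\<close>)
  then show "(LINT x|lborel. v x * \<phi>' x) = - (LINT x|lborel. v' x * \<phi> x)"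
    using int int' by simp
qed

text \<open>The factor 2 comes from bounding the Euclidean norm of a pair by the sum of the absolute
  values of its entries.\<close>

lemma W1inf_norm_le:
  assumes v: "\<And>x. (v has_real_derivative v' x) (at x)" "continuous_on UNIV v'"
    and bound: "\<And>x. \<bar>v x\<bar> \<le> B * Omega_plus \<kappa> x" "\<And>x. \<bar>v' x\<bar> \<le> B * Omega_plus \<kappa> x"
  shows "W1inf_norm \<kappa> v \<le> ennreal (2 * B)"
proof -
  have cont_v: "continuous_on UNIV v" using v(1) by (meson DERIV_isCont continuous_at_imp_continuous_on)
  have "W1inf_norm \<kappa> v \<le> esssup lborel (\<lambda>x. ennreal (norm (v x, v' x) / Omega_plus \<kappa> x))"
    unfolding W1inf_norm_def by (rule INF_lower) (simp add: weak_derivative_classical[OF v])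
  also have "\<dots> \<le> ennreal (2 * B)"
  proof (rule esssup_I)
    have ne: "Omega_plus \<kappa> x \<noteq> 0" for x using Omega_plus_pos[of \<kappa> x] by simp
    have "continuous_on UNIV (\<lambda>x. norm (v x, v' x) / Omega_plus \<kappa> x)"
      by (intro continuous_on_divide continuous_on_norm continuous_on_Pair cont_v v(2) Omega_plus_continuous ballI ne)
    then have "(\<lambda>x. norm (v x, v' x) / Omega_plus \<kappa> x) \<in> borel_measurable borel"
      by (rule borel_measurable_continuous_onI)
    then show "(\<lambda>x. ennreal (norm (v x, v' x) / Omega_plus \<kappa> x)) \<in> borel_measurable lborel" by simp
    show "AE x in lborel. ennreal (norm (v x, v' x) / Omega_plus \<kappa> x) \<le> ennreal (2 * B)"
    proof (intro AE_I2 ennreal_leI)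
      fix x
      have "norm (v x, v' x) \<le> 2 * B * Omega_plus \<kappa> x"
        using norm_Pair_le[of "v x" "v' x"] bound[of x] by simp
      then show "norm (v x, v' x) / Omega_plus \<kappa> x \<le> 2 * B" using Omega_plus_pos[of \<kappa> x] by (simp add: pos_divide_le_eq)
    qed
  qed
  finally show ?thesis .
qed

lemma bump_deriv:
  fixes r x0 :: real
  shows "((\<lambda>x. (max (r\<^sup>2 - (x - x0)\<^sup>2) 0)\<^sup>2) has_real_derivative
    2 * max (r\<^sup>2 - (x - x0)\<^sup>2) 0 * (- 2 * (x - x0))) (at x)"
  by (rule DERIV_cong[OF DERIV_chain2[OF pos_part_square_deriv]]) (auto intro!: derivative_eq_intros)

text \<open>The norm controls some weak derivative \<open>w\<close>, and only almost everywhere. If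
  the continuous \<open>v'\<close> exceeded \<open>p\<close> at \<open>x0\<close>, it would do so on
  a ball; a bump there, weighted by the sign of \<open>v' x0\<close>, would give different integrals
  to \<open>v'\<close> and \<open>w\<close>, although both are weak derivatives of
  \<open>v\<close>.\<close>

lemma weak_derivative_bound:
  assumes v: "\<And>x. (v has_real_derivative v' x) (at x)" "continuous_on UNIV v'"
    and w: "weak_derivative v w" "AE x in lborel. \<bar>w x\<bar> \<le> p x"
    and p: "continuous_on UNIV p"
  shows "\<bar>v' x0\<bar> \<le> p x0"
proof (rule ccontr)
  assume "\<not> \<bar>v' x0\<bar> \<le> p x0"
  define s where "s = sgn (v' x0)"
  have s: "s * v' x0 = \<bar>v' x0\<bar>" "\<bar>s\<bar> \<le> 1" by (auto simp: s_def abs_sgn sgn_if)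
  have sw: "s * c \<le> \<bar>c\<bar>" for c
  proof -
    have "s * c \<le> \<bar>s\<bar> * \<bar>c\<bar>" by (simp flip: abs_mult)
    also have "\<dots> \<le> 1 * \<bar>c\<bar>" by (rule mult_right_mono[OF s(2)]) simp
    finally show ?thesis by simp
  qed
  define A where "A = {x. p x < s * v' x}"
  have "open A" unfolding A_def using p v(2) by (intro open_Collect_less continuous_intros)
  moreover have "x0 \<in> A" using \<open>\<not> _\<close> s by (simp add: A_def)
  ultimately obtain r where r: "0 < r" "cball x0 r \<subseteq> A" using open_contains_cball by blast
  define \<phi> where "\<phi> x = (max (r\<^sup>2 - (x - x0)\<^sup>2) 0)\<^sup>2" for x
  define \<phi>' where "\<phi>' x = 2 * max (r\<^sup>2 - (x - x0)\<^sup>2) 0 * (- 2 * (x - x0))" for x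
  have \<phi>: "(\<phi> has_real_derivative \<phi>' x) (at x)" for x
    unfolding \<phi>_def[abs_def] \<phi>'_def by (rule bump_deriv)
  have cont: "continuous_on UNIV \<phi>" "continuous_on UNIV \<phi>'"
    unfolding \<phi>_def[abs_def] \<phi>'_def[abs_def] by (intro continuous_intros)+
  have \<phi>0: "\<phi> x = 0" if "x \<notin> cball x0 r" for x
  proof -
    have "r < \<bar>x - x0\<bar>" using that by (simp add: dist_real_def abs_minus_commute)
    then have "r\<^sup>2 \<le> (x - x0)\<^sup>2" using r(1) abs_le_square_iff[of r "x - x0"] by simp
    then show ?thesis by (simp add: \<phi>_def max_def)
  qed
  have \<phi>pos: "0 < \<phi> x" if "x \<in> ball x0 r" for x
  proof -
    have "\<bar>x - x0\<bar> < r" using that by (simp add: dist_real_def abs_minus_commute)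
    then have "(x - x0)\<^sup>2 < r\<^sup>2" using r(1) power_strict_mono[of "\<bar>x - x0\<bar>" r 2] by simp
    then show ?thesis by (simp add: \<phi>_def)
  qed
  have \<phi>_nonneg: "0 \<le> \<phi> x" for x by (simp add: \<phi>_def)
  have test: "(\<forall>x. (\<phi> has_real_derivative \<phi>' x) (at x)) \<and> continuous_on UNIV \<phi>' \<and> (\<exists>R. \<forall>x. R < \<bar>x\<bar> \<longrightarrow> \<phi> x = 0)"
  proof (intro conjI allI exI[of _ "\<bar>x0\<bar> + r"] impI \<phi> cont)
    show "\<phi> x = 0" if "\<bar>x0\<bar> + r < \<bar>x\<bar>" for x
      using that r(1) by (intro \<phi>0) (auto simp: dist_real_def)
  qed
  have "(LINT x|lborel. v x * \<phi>' x) = - (LINT x|lborel. w x * \<phi> x)"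
    using w(1) test unfolding weak_derivative_def by blast
  moreover have "(LINT x|lborel. v x * \<phi>' x) = - (LINT x|lborel. v' x * \<phi> x)"
    using weak_derivative_classical[OF v] test unfolding weak_derivative_def by blast
  ultimately have eq: "(LINT x|lborel. w x * \<phi> x) = (LINT x|lborel. v' x * \<phi> x)" by simp
  have int1: "integrable lborel (\<lambda>x. v' x * \<phi> x)"
    by (rule integrable_compact_support[of _ "cball x0 r"]) (auto intro!: continuous_on_mult v cont simp: \<phi>0)
  have "set_integrable lborel {x0 - r..x0 + r} w" using w(1) unfolding weak_derivative_def by blast
  then have "integrable lborel (\<lambda>x. \<phi> x * (indicator {x0 - r..x0 + r} x *\<^sub>R w x))"
    unfolding set_integrable_def
  proof (rule integrable_bounded_mult[where B="(r\<^sup>2)\<^sup>2"])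
    show "\<phi> \<in> borel_measurable lborel" using borel_measurable_continuous_onI[OF cont(1)] by simp
    show "\<bar>\<phi> x\<bar> \<le> (r\<^sup>2)\<^sup>2" for x
      using power_mono[of "max (r\<^sup>2 - (x - x0)\<^sup>2) 0" "r\<^sup>2" 2] by (simp add: \<phi>_def)
  qed
  moreover have "\<phi> x * (indicator {x0 - r..x0 + r} x *\<^sub>R w x) = w x * \<phi> x" for x
    using \<phi>0[of x] by (cases "x \<in> cball x0 r") (auto simp: indicator_def dist_real_def abs_if split: if_splits)
  ultimately have int2: "integrable lborel (\<lambda>x. w x * \<phi> x)" by (simp only:)
  have nonneg: "AE x in lborel. 0 \<le> s * (v' x * \<phi> x) - s * (w x * \<phi> x)"
    using w(2)
  proof eventually_elim
    case (elim x)
    show ?case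
    proof (cases "x \<in> cball x0 r")
      case True
      then have "x \<in> A" using r(2) by auto
      then have "p x < s * v' x" by (simp add: A_def)
      moreover have "s * w x \<le> \<bar>w x\<bar>" by (rule sw)
      ultimately have "0 \<le> (s * v' x - s * w x) * \<phi> x" using elim \<phi>_nonneg by (intro mult_nonneg_nonneg) auto
      then show ?thesis by (simp add: algebra_simps)
    qed (simp add: \<phi>0)
  qed
  have "(LINT x|lborel. s * (v' x * \<phi> x) - s * (w x * \<phi> x)) = 0"
    using int1 int2 eq by simp
  then have "AE x in lborel. s * (v' x * \<phi> x) - s * (w x * \<phi> x) = 0"
    using integral_nonneg_eq_0_iff_AE[OF _ nonneg] int1 int2 by simp
  then have "AE x in lborel. x \<notin> ball x0 r"
    using w(2)
  proof eventually_elim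
    case (elim x)
    show ?case
    proof
      assume x: "x \<in> ball x0 r"
      then have "x \<in> A" using r(2) by auto
      then have "p x < s * v' x" by (simp add: A_def)
      moreover have "s * w x \<le> \<bar>w x\<bar>" by (rule sw)
      ultimately have "0 < (s * v' x - s * w x) * \<phi> x" using elim(2) \<phi>pos[OF x] by (intro mult_pos_pos) auto
      moreover have "(s * v' x - s * w x) * \<phi> x = s * (v' x * \<phi> x) - s * (w x * \<phi> x)"
        by (simp add: algebra_simps)
      ultimately show False using elim(1) by linarith
    qed
  qed
  then have "ball x0 r = {}" by (intro AE_open_empty) auto
  then show False using r(1) by simp
qed

text \<open>The inequality is strict because an infimum below \<open>e\<close> yields a weak
  derivative whose essential supremum is below \<open>e\<close>. Continuity then turns bounds almost
  everywhere into bounds everywhere.\<close>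

lemma W1inf_norm_bounds:
  assumes v: "\<And>x. (v has_real_derivative v' x) (at x)" "continuous_on UNIV v'"
    and less: "W1inf_norm \<kappa> v < ennreal e"
  shows "\<bar>v x\<bar> \<le> e * Omega_plus \<kappa> x" "\<bar>v' x\<bar> \<le> e * Omega_plus \<kappa> x"
proof -
  have cont_v: "continuous_on UNIV v" using v(1) by (meson DERIV_isCont continuous_at_imp_continuous_on)
  obtain w where w: "weak_derivative v w" and e: "esssup lborel (\<lambda>x. ennreal (norm (v x, w x) / Omega_plus \<kappa> x)) < ennreal e"
    using less unfolding W1inf_norm_def INF_less_iff by blast
  have e0: "0 \<le> e" using e by (metis ennreal_neg not_less_zero less_eq_real_def linorder_not_le)
  have "AE x in lborel. ennreal (norm (v x, w x) / Omega_plus \<kappa> x) \<le> esssup lborel (\<lambda>x. ennreal (norm (v x, w x) / Omega_plus \<kappa> x))"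
    by (rule esssup_AE)
  then have AE: "AE x in lborel. norm (v x, w x) \<le> e * Omega_plus \<kappa> x"
  proof eventually_elim
    case (elim x)
    then have "ennreal (norm (v x, w x) / Omega_plus \<kappa> x) \<le> ennreal e" using e by simp
    then have "norm (v x, w x) / Omega_plus \<kappa> x \<le> e" using e0 by (simp add: ennreal_le_iff)
    then show ?case using Omega_plus_pos[of \<kappa> x] by (simp add: pos_divide_le_eq)
  qed
  have "AE x in lborel. 0 \<le> e * Omega_plus \<kappa> x - \<bar>v x\<bar>"
    using AE by eventually_elim (metis diff_ge_0_iff_ge norm_fst_le order_trans real_norm_def)
  then have "0 \<le> e * Omega_plus \<kappa> x - \<bar>v x\<bar>"
    by (rule AE_continuous_nonneg[rotated]) (intro continuous_intros cont_v Omega_plus_continuous)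
  then show "\<bar>v x\<bar> \<le> e * Omega_plus \<kappa> x" by simp
  have "AE x in lborel. \<bar>w x\<bar> \<le> e * Omega_plus \<kappa> x"
    using AE by eventually_elim (metis norm_snd_le order_trans real_norm_def)
  then show "\<bar>v' x\<bar> \<le> e * Omega_plus \<kappa> x"
    by (rule weak_derivative_bound[OF v w]) (intro continuous_intros Omega_plus_continuous)
qed

lemma W1inf_norm_bounds_le:
  assumes v: "\<And>x. (v has_real_derivative v' x) (at x)" "continuous_on UNIV v'"
    and eq: "W1inf_norm \<kappa> v = ennreal e" and e: "0 \<le> e"
  shows "\<bar>v x\<bar> \<le> e * Omega_plus \<kappa> x" "\<bar>v' x\<bar> \<le> e * Omega_plus \<kappa> x"
proof -
  have *: "\<bar>v x\<bar> \<le> e' * Omega_plus \<kappa> x" "\<bar>v' x\<bar> \<le> e' * Omega_plus \<kappa> x" if "e < e'" for e'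
    using W1inf_norm_bounds[OF v, of \<kappa> e'] that e eq by (auto simp: ennreal_less_iff)
  have "\<bar>v x\<bar> / Omega_plus \<kappa> x \<le> e"
  proof (rule dense_ge)
    fix e' assume "e < e'"
    from *(1)[OF this] show "\<bar>v x\<bar> / Omega_plus \<kappa> x \<le> e'"
      by (simp only: pos_divide_le_eq[OF Omega_plus_pos])
  qed
  then show "\<bar>v x\<bar> \<le> e * Omega_plus \<kappa> x" by (simp only: pos_divide_le_eq[OF Omega_plus_pos])
  have "\<bar>v' x\<bar> / Omega_plus \<kappa> x \<le> e"
  proof (rule dense_ge)
    fix e' assume "e < e'"
    from *(2)[OF this] show "\<bar>v' x\<bar> / Omega_plus \<kappa> x \<le> e'"
      by (simp only: pos_divide_le_eq[OF Omega_plus_pos])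
  qed
  then show "\<bar>v' x\<bar> \<le> e * Omega_plus \<kappa> x" by (simp only: pos_divide_le_eq[OF Omega_plus_pos])
qed

section \<open>From the entropy formulation to the differential equation of the profile\<close>

text \<open>The wave is known only as an entropy solution. Subtracting an integration by parts from
  its weak equality shows that the residual \<open>r\<close>, which is continuous, has integral 0
  against every nonnegative test function; a bump where \<open>r\<close> has a sign gives a
  contradiction.\<close>

lemma profile_equation:
  fixes f f' g U U' :: "real \<Rightarrow> real"
  assumes f': "\<And>r. (f has_real_derivative f' r) (at r)" "continuous_on UNIV f'"
    and g: "continuous_on UNIV g"
    and U: "\<And>y. (U has_real_derivative U' y) (at y)" "continuous_on UNIV U'" "\<And>y. \<bar>U y\<bar> \<le> M"
    and sol: "entropy_solution f g U (\<lambda>t x. U (x - \<sigma> * t))"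
  shows "(f' (U y) - \<sigma>) * U' y = g (U y)"
proof (rule ccontr)
  assume ne: "(f' (U y) - \<sigma>) * U' y \<noteq> g (U y)"
  have cont_f: "continuous_on UNIV f" using f'(1) by (meson DERIV_isCont continuous_at_imp_continuous_on)
  have cont_U: "continuous_on UNIV U" using U(1) by (meson DERIV_isCont continuous_at_imp_continuous_on)
  define l where "l z = snd z - \<sigma> * fst z" for z :: "real \<times> real"
  have l_cont: "continuous_on UNIV l" unfolding l_def[abs_def] by (intro continuous_intros)
  have l_grad: "has_gradient l (- \<sigma>) 1 z" for z
    unfolding l_def[abs_def] by (auto intro!: derivative_eq_intros simp: fun_eq_iff)
  define V where "V z = U (l z)" for z
  have V_cont: "continuous_on UNIV V" unfolding V_def[abs_def] by (rule continuous_on_compose2[OF cont_U l_cont]) simp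
  have VC: "C1_half_plane V (\<lambda>z. - \<sigma> * U' (l z)) (\<lambda>z. U' (l z))"
    unfolding C1_half_plane_def
  proof (intro conjI allI impI)
    show "has_gradient V (- \<sigma> * U' (l z)) (U' (l z)) z" for z
      using has_gradient_compose[OF l_grad U(1), of z] unfolding V_def[abs_def] by (simp add: mult.commute)
    show "continuous_on ({0<..} \<times> UNIV) (\<lambda>z. U' (l z))"
      by (rule continuous_on_compose2[OF U(2) continuous_on_subset[OF l_cont]]) auto
    then show "continuous_on ({0<..} \<times> UNIV) (\<lambda>z. - \<sigma> * U' (l z))" by (rule continuous_on_mult_left)
  qed
  have fVC: "C1_half_plane (\<lambda>z. f (V z)) (\<lambda>z. f' (V z) * (- \<sigma> * U' (l z))) (\<lambda>z. f' (V z) * U' (l z))"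
    by (rule C1_half_plane_compose[OF VC f'])
  define r where "r y = g (U y) - (f' (U y) - \<sigma>) * U' y" for y
  have r_cont: "continuous_on UNIV r"
    unfolding r_def[abs_def]
    by (intro continuous_on_diff continuous_on_mult continuous_on_const U(2)
        continuous_on_compose2[OF g cont_U] continuous_on_compose2[OF f'(2) cont_U] subset_UNIV)
  have rl_cont: "continuous_on UNIV (\<lambda>z. r (l z))" by (rule continuous_on_compose2[OF r_cont l_cont]) simp
  have zero: "(LINT z|lborel. r (l z) * \<phi> z) = 0" if test: "test_function \<phi> \<phi>t \<phi>x" and nonneg: "\<And>z. 0 \<le> \<phi> z" for \<phi> \<phi>t \<phi>x
  proof -
    have Kr: "0 \<le> (LINT z|lborel. \<bar>V z - k\<bar> * \<phi>t z + sgn (V z - k) * (f (V z) - f k) * \<phi>x z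
      + sgn (V z - k) * g (V z) * \<phi> z)" for k
      using sol test nonneg unfolding entropy_solution_def by (simp add: case_prod_unfold V_def l_def)
    have V: "V \<in> borel_measurable borel" "\<And>z. \<bar>V z\<bar> \<le> M"
      using borel_measurable_continuous_onI[OF V_cont] U(3) by (auto simp: V_def)
    note W = weak_equality[OF cont_f g V test Kr]
    define B where "B z = V z * \<phi>t z + f (V z) * \<phi>x z + (- \<sigma> * U' (l z) + f' (V z) * U' (l z)) * \<phi> z" for z
    have B0: "(LINT z|lborel. B z) = 0"
      unfolding B_def by (rule integral_by_parts_test_function[OF test VC fVC])
    have "integrable lborel B"
      unfolding B_def[abs_def]
      by (intro Bochner_Integration.integrable_add integrable_test_function_mult(1-3)[OF test] continuous_on_add
          C1_half_plane_continuous[OF VC] C1_half_plane_continuous[OF fVC])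
    moreover have "r (l z) * \<phi> z = (V z * \<phi>t z + f (V z) * \<phi>x z + g (V z) * \<phi> z) - B z" for z
      by (simp add: r_def B_def V_def algebra_simps)
    ultimately show ?thesis using W B0 by simp
  qed
  define s where "s = sgn (r y)"
  have s: "0 < s * r y" using ne by (auto simp: s_def r_def sgn_if)
  \<comment> \<open>The point of the line x - \<sigma> t = y at time 1; balls of radius at most 1/2
    around it stay in t > 0.\<close>
  define z0 where "z0 = (1 :: real, y + \<sigma>)"
  define A where "A = {z. 0 < s * r (l z)}"
  have "open A" unfolding A_def using rl_cont by (intro open_Collect_less continuous_intros)
  moreover have "z0 \<in> A" using s by (simp add: A_def z0_def l_def)
  ultimately obtain \<rho>0 where \<rho>0: "0 < \<rho>0" "cball z0 \<rho>0 \<subseteq> A" using open_contains_cball by blast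
  define \<rho> where "\<rho> = min \<rho>0 (1/2)"
  have \<rho>: "0 < \<rho>" "cball z0 \<rho> \<subseteq> A" "\<rho> \<le> 1/2" using \<rho>0 by (auto simp: \<rho>_def)
  define d where "d z = \<rho>\<^sup>2 - ((fst z - 1)\<^sup>2 + (snd z - (y + \<sigma>))\<^sup>2)" for z :: "real \<times> real"
  have d: "d z = \<rho>\<^sup>2 - (dist z0 z)\<^sup>2" for z
    by (cases z) (simp add: d_def z0_def dist_Pair_Pair dist_real_def power2_commute real_sqrt_pow2)
  have d_grad: "has_gradient d (- 2 * (fst z - 1)) (- 2 * (snd z - (y + \<sigma>))) z" for z
    unfolding d_def[abs_def] by (auto intro!: derivative_eq_intros simp: fun_eq_iff algebra_simps)
  define \<phi> where "\<phi> z = (max (d z) 0)\<^sup>2" for z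
  define \<phi>t where "\<phi>t z = 2 * max (d z) 0 * (- 2 * (fst z - 1))" for z
  define \<phi>x where "\<phi>x z = 2 * max (d z) 0 * (- 2 * (snd z - (y + \<sigma>)))" for z
  have d_cont: "continuous_on UNIV d" unfolding d_def[abs_def] by (intro continuous_intros)
  have \<phi>0: "\<phi> z = 0" if "z \<notin> cball z0 \<rho>" for z
  proof -
    have "\<rho>\<^sup>2 \<le> (dist z0 z)\<^sup>2" using that \<rho>(1) by (intro power_mono) auto
    then show ?thesis by (simp add: \<phi>_def d max_def)
  qed
  have \<phi>pos: "0 < \<phi> z" if "z \<in> ball z0 \<rho>" for z
  proof -
    have "(dist z0 z)\<^sup>2 < \<rho>\<^sup>2" using that by (intro power_strict_mono) auto
    then show ?thesis by (simp add: \<phi>_def d)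
  qed
  have test: "test_function \<phi> \<phi>t \<phi>x"
    unfolding test_function_def
  proof (intro conjI allI exI[of _ "cball z0 \<rho>"] impI)
    show "has_gradient \<phi> (\<phi>t z) (\<phi>x z) z" for z
      using has_gradient_compose[OF d_grad pos_part_square_deriv, of z] unfolding \<phi>_def[abs_def] \<phi>t_def \<phi>x_def .
    show "continuous_on UNIV \<phi>t" "continuous_on UNIV \<phi>x"
      unfolding \<phi>t_def[abs_def] \<phi>x_def[abs_def] by (intro continuous_intros d_cont)+
    show "cball z0 \<rho> \<subseteq> {0<..} \<times> UNIV"
    proof
      fix z assume "z \<in> cball z0 \<rho>"
      then have "\<bar>1 - fst z\<bar> \<le> \<rho>" using dist_fst_le[of z0 z] by (simp add: z0_def dist_real_def)
      then show "z \<in> {0<..} \<times> UNIV" using \<rho>(3) by (cases z) auto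
    qed
  qed (use \<phi>0 in auto)
  have nonneg: "AE z in lborel. 0 \<le> s * (r (l z) * \<phi> z)"
  proof (rule AE_I2)
    fix z
    show "0 \<le> s * (r (l z) * \<phi> z)"
    proof (cases "z \<in> cball z0 \<rho>")
      case True
      then have "z \<in> A" using \<rho>(2) by blast
      then have "0 \<le> s * r (l z)" by (simp add: A_def)
      moreover have "0 \<le> \<phi> z" by (simp add: \<phi>_def)
      ultimately have "0 \<le> (s * r (l z)) * \<phi> z" by (rule mult_nonneg_nonneg)
      then show ?thesis by (simp add: mult.assoc)
    qed (simp add: \<phi>0)
  qed
  have int: "integrable lborel (\<lambda>z. s * (r (l z) * \<phi> z))"
    using integrable_test_function_mult(1)[OF test continuous_on_subset[OF rl_cont]] by auto
  have "(LINT z|lborel. s * (r (l z) * \<phi> z)) = 0" using zero[OF test] by (simp add: \<phi>_def)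
  then have "AE z in lborel. s * (r (l z) * \<phi> z) = 0"
    using integral_nonneg_eq_0_iff_AE[OF int nonneg] by simp
  then have "AE z in lborel. z \<notin> ball z0 \<rho>"
  proof eventually_elim
    case (elim z)
    show ?case
    proof
      assume z: "z \<in> ball z0 \<rho>"
      then have "z \<in> cball z0 \<rho>" by simp
      then have "z \<in> A" using \<rho>(2) by blast
      then have "0 < s * r (l z)" by (simp add: A_def)
      then have "0 < (s * r (l z)) * \<phi> z" using \<phi>pos[OF z] by simp
      then show False using elim by (simp add: mult.assoc)
    qed
  qed
  then have "ball z0 \<rho> = {}" by (intro AE_open_empty) auto
  then show False using \<rho>(1) by simp
qed

subsection \<open>Coordinates adapted to the profile\<close>

text \<open>The simple zero of \<open>h\<close> at \<open>z\<close> is a zero of \<open>n\<close>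
  too, so the quotient n / h extends continuously by the quotient d / m of the derivatives, and a
  continuous function has a primitive. It yields the correction \<open>R\<close> below and the time
  corrections at both endstates.\<close>

lemma primitive_of_quotient:
  fixes h n :: "real \<Rightarrow> real"
  assumes z: "\<alpha> < z" "z < \<beta>"
    and h: "\<And>w. \<alpha> < w \<Longrightarrow> w < \<beta> \<Longrightarrow> isCont h w" "\<And>w. \<alpha> < w \<Longrightarrow> w < \<beta> \<Longrightarrow> w \<noteq> z \<Longrightarrow> h w \<noteq> 0"
      "(h has_real_derivative m) (at z)" "m \<noteq> 0" "h z = 0"
    and n: "\<And>w. \<alpha> < w \<Longrightarrow> w < \<beta> \<Longrightarrow> isCont n w" "(n has_real_derivative d) (at z)" "n z = 0"
  obtains N c where "\<And>w. \<alpha> < w \<Longrightarrow> w < \<beta> \<Longrightarrow> (N has_real_derivative c w) (at w)"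
    "\<And>w. \<alpha> < w \<Longrightarrow> w < \<beta> \<Longrightarrow> isCont c w" "\<And>w. \<alpha> < w \<Longrightarrow> w < \<beta> \<Longrightarrow> c w * h w = n w"
proof -
  define c where "c w = (if w = z then d / m else n w / h w)" for w
  have c: "isCont c w" if w: "\<alpha> < w" "w < \<beta>" for w
  proof (cases "w = z")
    case True
    have "((\<lambda>y. (n y - n z) / (y - z) / ((h y - h z) / (y - z))) \<longlongrightarrow> d / m) (at z)"
      using h(3,4) n(2) unfolding has_field_derivative_iff by (intro tendsto_divide) auto
    moreover have "\<forall>\<^sub>F y in at z. (n y - n z) / (y - z) / ((h y - h z) / (y - z)) = c y"
      unfolding eventually_at by (intro exI[of _ 1]) (auto simp: c_def h(5) n(3))
    ultimately have "(c \<longlongrightarrow> d / m) (at z)" by (rule Lim_transform_eventually)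
    then show ?thesis using True by (simp add: isCont_def c_def)
  next
    case False
    have 1: "isCont (\<lambda>y. n y / h y) w" using w h n False by (intro continuous_intros) auto
    have 2: "\<forall>\<^sub>F y in nhds w. n y / h y = c y"
      using t1_space_nhds[OF False] by eventually_elim (auto simp: c_def)
    show ?thesis using isCont_cong[OF 2] 1 by simp
  qed
  have "\<exists>N. \<forall>w::real. ereal \<alpha> < ereal w \<longrightarrow> ereal w < ereal \<beta> \<longrightarrow> (N has_vector_derivative c w) (at w)"
    by (rule einterval_antiderivative) (use z c in auto)
  then obtain N where N: "\<And>w. \<alpha> < w \<Longrightarrow> w < \<beta> \<Longrightarrow> (N has_real_derivative c w) (at w)"
    by (auto simp: has_real_derivative_iff_has_vector_derivative)
  show ?thesis
    by (rule that[OF N c]) (use h n in \<open>auto simp: c_def\<close>)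
qed

text \<open>One-dimensional linearization at a hyperbolic zero \<open>z\<close> of the vector field \<open>h\<close>:
  \<open>H w = (w - z) exp (R w)\<close> with \<open>R' = m / h - 1 / (w - z)\<close>, whose singularity at \<open>z\<close> is removable.\<close>

lemma linearizing_coordinate:
  fixes h h' :: "real \<Rightarrow> real"
  assumes z: "\<alpha> < z" "z < \<beta>"
    and h: "\<And>w. \<alpha> < w \<Longrightarrow> w < \<beta> \<Longrightarrow> (h has_real_derivative h' w) (at w)" "(h' has_real_derivative d) (at z)"
      "h z = 0" "h' z = m" "m \<noteq> 0"
    and sign: "\<And>w. \<alpha> < w \<Longrightarrow> w < \<beta> \<Longrightarrow> w \<noteq> z \<Longrightarrow> 0 < m * (w - z) * h w"
  obtains H H' where "\<And>w. \<alpha> < w \<Longrightarrow> w < \<beta> \<Longrightarrow> (H has_real_derivative H' w) (at w)"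
    "\<And>w. \<alpha> < w \<Longrightarrow> w < \<beta> \<Longrightarrow> isCont H' w" "\<And>w. \<alpha> < w \<Longrightarrow> w < \<beta> \<Longrightarrow> H' w * h w = m * H w"
    "\<And>w. \<alpha> < w \<Longrightarrow> w < \<beta> \<Longrightarrow> 0 < H' w" "H z = 0"
proof -
  \<comment> \<open>Then n / h = m / h - 1 / (w - z), the required \<open>R'\<close>. The quotient
    extends through \<open>z\<close> once \<open>n\<close>, given the value 0 there, is shown to be
    differentiable at \<open>z\<close>.\<close>
  define n where "n w = (if w = z then 0 else m - h w / (w - z))" for w
  have hz: "(h has_real_derivative m) (at z)" using h(1)[OF z] h(4) by simp
  have near: "\<forall>\<^sub>F w in at z. \<alpha> < w \<and> w < \<beta> \<and> w \<noteq> z"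
    unfolding eventually_conj_iff
    by (intro conjI eventually_at_topological[THEN iffD2] exI[of _ "{\<alpha><..<\<beta>}"])
      (use z in \<open>auto simp: eventually_at_topological\<close>)
  \<comment> \<open>The second order expansion of \<open>h\<close> at \<open>z\<close>, obtained by
    l'Hospital from the derivative \<open>d\<close> of \<open>h'\<close> at the single point
    \<open>z\<close>.\<close>
  have "((\<lambda>w. (m * (w - z) - h w) / (w - z)\<^sup>2) \<longlongrightarrow> - d / 2) (at z)"
  proof (rule lhopital[where f' = "\<lambda>w. m - h' w" and g' = "\<lambda>w. 2 * (w - z)"])
    have "isCont (\<lambda>w. m * (w - z) - h w) z" using DERIV_isCont[OF hz] by (intro continuous_intros)
    then show "((\<lambda>w. m * (w - z) - h w) \<longlongrightarrow> 0) (at z)" by (simp add: isCont_def h(3))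
    have "isCont (\<lambda>w. (w - z)\<^sup>2) z" by (intro continuous_intros)
    then show "((\<lambda>w. (w - z)\<^sup>2) \<longlongrightarrow> 0) (at z)" by (simp add: isCont_def)
    show "\<forall>\<^sub>F w in at z. (w - z)\<^sup>2 \<noteq> 0" "\<forall>\<^sub>F w in at z. 2 * (w - z) \<noteq> 0"
      using near by (eventually_elim; auto)+
    show "\<forall>\<^sub>F w in at z. ((\<lambda>w. m * (w - z) - h w) has_real_derivative m - h' w) (at w)"
      using near by eventually_elim (auto intro!: derivative_eq_intros h(1))
    show "\<forall>\<^sub>F w in at z. ((\<lambda>w. (w - z)\<^sup>2) has_real_derivative 2 * (w - z)) (at w)"
      by (intro always_eventually allI) (auto intro!: derivative_eq_intros)
    have "((\<lambda>w. - ((h' w - h' z) / (w - z)) / 2) \<longlongrightarrow> - d / 2) (at z)"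
      using h(2) unfolding has_field_derivative_iff by (intro tendsto_intros) auto
    moreover have "\<forall>\<^sub>F w in at z. - ((h' w - h' z) / (w - z)) / 2 = (m - h' w) / (2 * (w - z))"
      using near by eventually_elim (auto simp: h(4) field_simps)
    ultimately show "((\<lambda>w. (m - h' w) / (2 * (w - z))) \<longlongrightarrow> - d / 2) (at z)"
      by (rule Lim_transform_eventually)
  qed
  moreover have "\<forall>\<^sub>F w in at z. (m * (w - z) - h w) / (w - z)\<^sup>2 = (n w - n z) / (w - z)"
    using near by eventually_elim (auto simp: n_def field_simps power2_eq_square)
  ultimately have nz: "(n has_real_derivative - d / 2) (at z)"
    unfolding has_field_derivative_iff by (rule Lim_transform_eventually)
  have n_cont: "isCont n w" if w: "\<alpha> < w" "w < \<beta>" for w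
  proof (cases "w = z")
    case True
    then show ?thesis using DERIV_isCont[OF nz] by simp
  next
    case False
    have 1: "isCont (\<lambda>y. m - h y / (y - z)) w" using w DERIV_isCont[OF h(1)] False by (intro continuous_intros) auto
    have 2: "\<forall>\<^sub>F y in nhds w. m - h y / (y - z) = n y"
      using t1_space_nhds[OF False] by eventually_elim (auto simp: n_def)
    show ?thesis using isCont_cong[OF 2] 1 by simp
  qed
  have h_cont: "isCont h w" if "\<alpha> < w" "w < \<beta>" for w by (rule DERIV_isCont[OF h(1)[OF that]])
  have h_ne: "h w \<noteq> 0" if "\<alpha> < w" "w < \<beta>" "w \<noteq> z" for w using sign[OF that] by auto
  have n0: "n z = 0" by (simp add: n_def)
  obtain R r where R: "\<And>w. \<alpha> < w \<Longrightarrow> w < \<beta> \<Longrightarrow> (R has_real_derivative r w) (at w)"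
    "\<And>w. \<alpha> < w \<Longrightarrow> w < \<beta> \<Longrightarrow> isCont r w" "\<And>w. \<alpha> < w \<Longrightarrow> w < \<beta> \<Longrightarrow> r w * h w = n w"
    using primitive_of_quotient[OF z h_cont h_ne hz h(5,3) n_cont nz n0] by blast
  define H where "H w = (w - z) * exp (R w)" for w
  define H' where "H' w = exp (R w) * (1 + (w - z) * r w)" for w
  have eq: "H' w * h w = m * H w" if w: "\<alpha> < w" "w < \<beta>" for w
  proof (cases "w = z")
    case False
    have "H' w * h w = exp (R w) * (h w + (w - z) * (r w * h w))" by (simp add: H'_def algebra_simps)
    also have "\<dots> = m * H w" unfolding R(3)[OF w] using False by (simp add: n_def H_def field_simps)
    finally show ?thesis .
  qed (simp add: h(3) H_def)
  show ?thesis
  proof (rule that[of H H'])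
    show "(H has_real_derivative H' w) (at w)" if "\<alpha> < w" "w < \<beta>" for w
      unfolding H_def[abs_def] H'_def using R(1)[OF that] by (auto intro!: derivative_eq_intros simp: algebra_simps)
    show "isCont H' w" if "\<alpha> < w" "w < \<beta>" for w
      unfolding H'_def[abs_def] using R(2)[OF that] DERIV_isCont[OF R(1)[OF that]] by (intro continuous_intros)
    show "0 < H' w" if w: "\<alpha> < w" "w < \<beta>" for w
    proof (cases "w = z")
      case False
      have "0 < (m * (w - z) * h w) * exp (R w)" using sign[OF w False] by simp
      also have "\<dots> = m * H w * h w" by (simp add: H_def)
      also have "\<dots> = H' w * (h w)\<^sup>2" by (simp add: power2_eq_square flip: eq[OF w])
      finally show ?thesis by (simp add: zero_less_mult_iff)
    qed (simp add: H'_def)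
  qed (use eq in \<open>auto simp: H_def\<close>)
qed

lemma bounded_on_Icc:
  fixes f :: "real \<Rightarrow> real"
  assumes "\<And>w. x \<le> w \<Longrightarrow> w \<le> y \<Longrightarrow> isCont f w"
  shows "\<exists>B\<ge>0. \<forall>w. x \<le> w \<and> w \<le> y \<longrightarrow> \<bar>f w\<bar> \<le> B"
proof -
  have "continuous_on {x..y} f" using assms by (intro continuous_at_imp_continuous_on) auto
  then have "bounded (f ` {x..y})" by (intro compact_imp_bounded compact_continuous_image) auto
  then obtain B where B: "\<forall>r\<in>f ` {x..y}. norm r \<le> B" unfolding bounded_iff by blast
  have "\<bar>f w\<bar> \<le> \<bar>B\<bar>" if "x \<le> w" "w \<le> y" for w using bspec[OF B, of "f w"] that by auto
  then show ?thesis by (intro exI[of _ "\<bar>B\<bar>"]) auto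
qed

lemma positive_bounds_on_Icc:
  fixes f :: "real \<Rightarrow> real"
  assumes "\<And>w. x \<le> w \<Longrightarrow> w \<le> y \<Longrightarrow> isCont f w" "\<And>w. x \<le> w \<Longrightarrow> w \<le> y \<Longrightarrow> 0 < f w"
  shows "\<exists>B\<ge>0. \<forall>w. x \<le> w \<and> w \<le> y \<longrightarrow> f w \<le> B \<and> 1 \<le> B * f w"
proof -
  obtain B1 where B1: "B1 \<ge> 0" "\<And>w. x \<le> w \<Longrightarrow> w \<le> y \<Longrightarrow> \<bar>f w\<bar> \<le> B1"
    using bounded_on_Icc[of x y f] assms by blast
  have "isCont (\<lambda>w. 1 / f w) w" if "x \<le> w" "w \<le> y" for w
    using assms(1)[OF that] assms(2)[OF that] by (intro continuous_intros) auto
  then obtain B2 where B2: "B2 \<ge> 0" "\<And>w. x \<le> w \<Longrightarrow> w \<le> y \<Longrightarrow> \<bar>1 / f w\<bar> \<le> B2"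
    using bounded_on_Icc[of x y "\<lambda>w. 1 / f w"] by blast
  have "f w \<le> B1 + B2 \<and> 1 \<le> (B1 + B2) * f w" if w: "x \<le> w" "w \<le> y" for w
  proof -
    have "1 / f w \<le> B1 + B2" using B2(2)[OF w] B1(1) by linarith
    then show ?thesis using assms(2)[OF w] B1(2)[OF w] B2(1) by (auto simp: field_simps)
  qed
  then show ?thesis using B1(1) B2(1) by (intro exI[of _ "B1 + B2"]) auto
qed

lemma less_of_positive_deriv:
  fixes f f' :: "real \<Rightarrow> real"
  assumes "x < y" "\<And>w. x \<le> w \<Longrightarrow> w \<le> y \<Longrightarrow> (f has_real_derivative f' w) (at w)"
    "\<And>w. x \<le> w \<Longrightarrow> w \<le> y \<Longrightarrow> 0 < f' w"
  shows "f x < f y"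
  by (rule DERIV_pos_imp_increasing[OF assms(1)]) (use assms(2,3) in blast)

text \<open>Values \<open>w\<close> which, in the coordinate \<open>H\<close>, differ from \<open>U y\<close> by at most a factor of two for \<open>y \<ge> 0\<close>; for
  \<open>y \<le> 0\<close> the value may also lie slightly beyond the left endstate. Near such values \<open>H'\<close> and \<open>\<beta>'\<close> have
  the size that they have on the profile.\<close>

definition comparable :: "(real \<Rightarrow> real) \<Rightarrow> real \<Rightarrow> real \<Rightarrow> real \<Rightarrow> real \<Rightarrow> real \<Rightarrow> bool" where
  "comparable H \<mu> lo up y w \<longleftrightarrow> lo \<le> w \<and> w < up \<and> H w \<le> 2 * exp (\<mu> * max y 0) \<and> (0 \<le> y \<longrightarrow> exp (\<mu> * y) / 2 \<le> H w)"

text \<open>\<open>H\<close> and \<open>\<beta>\<close> are regular through \<open>um\<close> and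
  singular at \<open>up\<close>, so compactness alone gives no bound near \<open>up\<close>. There
  they are compared, along the profile, with objects that are regular at \<open>up\<close>: the
  coordinate \<open>P\<close> that linearizes \<open>h\<close> at \<open>up\<close>, which shows
  that \<open>H'\<close> behaves like exp ((\<mu> + \<nu>) y), and the primitive
  \<open>\<gamma>\<close> built from b - b up, which differs from \<open>\<beta>\<close> by an
  affine function of y with slope b up - b um.\<close>

lemma profile_coordinates:
  fixes h h' b U :: "real \<Rightarrow> real"
  assumes lt: "um < up" "0 < \<eta>" "0 < \<mu>" "0 < \<nu>"
    and h: "\<And>w. um - \<eta> < w \<Longrightarrow> w < up + \<eta> \<Longrightarrow> (h has_real_derivative h' w) (at w)"
      "(h' has_real_derivative d1) (at um)" "(h' has_real_derivative d2) (at up)"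
      "h um = 0" "h up = 0" "h' um = \<mu>" "h' up = - \<nu>"
    and sign: "\<And>w. um < w \<Longrightarrow> w < up \<Longrightarrow> 0 < h w" "\<And>w. um - \<eta> < w \<Longrightarrow> w < um \<Longrightarrow> h w < 0"
      "\<And>w. up < w \<Longrightarrow> w < up + \<eta> \<Longrightarrow> h w < 0"
    and b: "\<And>w. um - \<eta> < w \<Longrightarrow> w < up + \<eta> \<Longrightarrow> isCont b w" "(b has_real_derivative e1) (at um)"
      "(b has_real_derivative e2) (at up)"
    and U: "\<And>y. (U has_real_derivative h (U y)) (at y)" "\<And>y. um < U y" "\<And>y. U y < up"
      "\<And>w. um < w \<Longrightarrow> w < up \<Longrightarrow> \<exists>z. w = U z"
  obtains H H' \<beta> \<beta>' C where
    "\<And>w. um - \<eta> < w \<Longrightarrow> w < up \<Longrightarrow> (H has_real_derivative H' w) (at w)"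
    "\<And>w. um - \<eta> < w \<Longrightarrow> w < up \<Longrightarrow> isCont H' w"
    "\<And>w. um - \<eta> < w \<Longrightarrow> w < up \<Longrightarrow> H' w * h w = \<mu> * H w"
    "\<And>w. um - \<eta> < w \<Longrightarrow> w < up \<Longrightarrow> 0 < H' w"
    "H um = 0" "\<And>y. H (U y) = exp (\<mu> * y)"
    "\<And>w. um - \<eta> < w \<Longrightarrow> w < up \<Longrightarrow> (\<beta> has_real_derivative \<beta>' w) (at w)"
    "\<And>w. um - \<eta> < w \<Longrightarrow> w < up \<Longrightarrow> isCont \<beta>' w"
    "\<And>w. um - \<eta> < w \<Longrightarrow> w < up \<Longrightarrow> \<beta>' w * h w = b w - b um"
    "1 \<le> C"
    "\<And>y w. comparable H \<mu> (um - \<eta> / 2) up y w \<Longrightarrow> H' w \<le> C * exp ((\<mu> + \<nu>) * max y 0)"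
    "\<And>y w. comparable H \<mu> (um - \<eta> / 2) up y w \<Longrightarrow> exp ((\<mu> + \<nu>) * max y 0) \<le> C * H' w"
    "\<And>y w. comparable H \<mu> (um - \<eta> / 2) up y w \<Longrightarrow> \<bar>\<beta>' w\<bar> \<le> C * exp (\<nu> * max y 0)"
    "\<And>y w. comparable H \<mu> (um - \<eta> / 2) up y w \<Longrightarrow> \<bar>\<beta> w - (b up - b um) * max y 0\<bar> \<le> C"
proof -
  have hm: "(h has_real_derivative \<mu>) (at um)" and hp: "(h has_real_derivative - \<nu>) (at up)"
    using h(1)[of um] h(1)[of up] h(6,7) lt by auto
  have h0: "h w \<noteq> 0" if "um - \<eta> < w" "w < up + \<eta>" "w \<noteq> um" "w \<noteq> up" for w
    using sign[of w] that by (metis less_irrefl not_less_iff_gr_or_eq)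
  have h_cont: "isCont h w" if "um - \<eta> < w" "w < up + \<eta>" for w using DERIV_isCont[OF h(1)[OF that]] .
  obtain G G' where G: "\<And>w. um - \<eta> < w \<Longrightarrow> w < up \<Longrightarrow> (G has_real_derivative G' w) (at w)"
    "\<And>w. um - \<eta> < w \<Longrightarrow> w < up \<Longrightarrow> isCont G' w" "\<And>w. um - \<eta> < w \<Longrightarrow> w < up \<Longrightarrow> G' w * h w = \<mu> * G w"
    "\<And>w. um - \<eta> < w \<Longrightarrow> w < up \<Longrightarrow> 0 < G' w" "G um = 0"
  proof (rule linearizing_coordinate[of "um - \<eta>" um up h h' d1 \<mu>])
    show "0 < \<mu> * (w - um) * h w" if "um - \<eta> < w" "w < up" "w \<noteq> um" for w
      using sign(1)[of w] sign(2)[of w] that lt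
      by (cases "w < um") (auto simp: zero_less_mult_iff mult_less_0_iff)
  qed (use lt h in auto)
  obtain P P' where P: "\<And>w. um < w \<Longrightarrow> w < up + \<eta> \<Longrightarrow> (P has_real_derivative P' w) (at w)"
    "\<And>w. um < w \<Longrightarrow> w < up + \<eta> \<Longrightarrow> isCont P' w" "\<And>w. um < w \<Longrightarrow> w < up + \<eta> \<Longrightarrow> P' w * h w = - \<nu> * P w"
    "\<And>w. um < w \<Longrightarrow> w < up + \<eta> \<Longrightarrow> 0 < P' w" "P up = 0"
  proof (rule linearizing_coordinate[of um up "up + \<eta>" h h' d2 "- \<nu>"])
    show "0 < - \<nu> * (w - up) * h w" if "um < w" "w < up + \<eta>" "w \<noteq> up" for w
      using sign(1)[of w] sign(3)[of w] that lt
      by (cases "w < up") (auto simp: zero_less_mult_iff mult_less_0_iff)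
  qed (use lt h in auto)
  have bm: "((\<lambda>w. b w - b um) has_real_derivative e1) (at um)" and bp: "((\<lambda>w. b w - b up) has_real_derivative e2) (at up)"
    using b(2,3) by (auto intro!: derivative_eq_intros)
  obtain \<beta> \<beta>' where \<beta>: "\<And>w. um - \<eta> < w \<Longrightarrow> w < up \<Longrightarrow> (\<beta> has_real_derivative \<beta>' w) (at w)"
    "\<And>w. um - \<eta> < w \<Longrightarrow> w < up \<Longrightarrow> isCont \<beta>' w" "\<And>w. um - \<eta> < w \<Longrightarrow> w < up \<Longrightarrow> \<beta>' w * h w = b w - b um"
    by (rule primitive_of_quotient[of "um - \<eta>" um up h \<mu> "\<lambda>w. b w - b um" e1])
      (use lt h(4) hm bm h0 h_cont b(1) in \<open>auto intro!: continuous_intros\<close>)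
  obtain \<gamma> \<gamma>' where \<gamma>: "\<And>w. um < w \<Longrightarrow> w < up + \<eta> \<Longrightarrow> (\<gamma> has_real_derivative \<gamma>' w) (at w)"
    "\<And>w. um < w \<Longrightarrow> w < up + \<eta> \<Longrightarrow> isCont \<gamma>' w" "\<And>w. um < w \<Longrightarrow> w < up + \<eta> \<Longrightarrow> \<gamma>' w * h w = b w - b up"
    by (rule primitive_of_quotient[of um up "up + \<eta>" h "- \<nu>" "\<lambda>w. b w - b up" e2])
      (use lt h(5) hp bp h0 h_cont b(1) in \<open>auto intro!: continuous_intros\<close>)
  have Um: "um - \<eta> < U y" "U y < up + \<eta>" for y using U(2,3)[of y] lt by auto
  have G_less: "G x < G y" if "um - \<eta> < x" "x < y" "y < up" for x y
    by (rule less_of_positive_deriv[OF that(2) G(1) G(4)]) (use that in linarith)+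
  have G0: "0 < G (U 0)" using G_less[of um "U 0"] G(5) U(2,3)[of 0] lt by auto
  have GU: "G (U y) = G (U 0) * exp (\<mu> * y)" for y
  proof -
    have "((\<lambda>y. G (U y) * exp (- \<mu> * y)) has_real_derivative
        G' (U x) * h (U x) * exp (- \<mu> * x) - \<mu> * exp (- \<mu> * x) * G (U x)) (at x)" for x
      by (rule derivative_eq_intros DERIV_chain2[OF G(1) U(1)] Um U refl | simp)+
    moreover have "G' (U x) * h (U x) * exp (- \<mu> * x) - \<mu> * exp (- \<mu> * x) * G (U x) = 0" for x
      using G(3)[OF Um(1) U(3), of x] by (simp add: algebra_simps)
    ultimately have "\<forall>x. ((\<lambda>y. G (U y) * exp (- \<mu> * y)) has_real_derivative 0) (at x)" by simp
    from DERIV_isconst_all[OF this, of y 0] show ?thesis by (simp add: exp_minus field_simps)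
  qed
  define H where "H w = G w / G (U 0)" for w
  define H' where "H' w = G' w / G (U 0)" for w
  have H1: "(H has_real_derivative H' w) (at w)" if "um - \<eta> < w" "w < up" for w
    unfolding H_def[abs_def] H'_def by (rule DERIV_cdivide[OF G(1)[OF that]])
  have H2: "isCont H' w" if "um - \<eta> < w" "w < up" for w
    unfolding H'_def[abs_def] by (intro continuous_intros G(2)[OF that]) (use G0 in simp)
  have H3: "H' w * h w = \<mu> * H w" if "um - \<eta> < w" "w < up" for w
    using G(3)[OF that] by (simp add: H_def H'_def)
  have H4: "0 < H' w" if "um - \<eta> < w" "w < up" for w
    using G(4)[OF that] G0 by (simp add: H'_def)
  have H5: "H um = 0" "H (U y) = exp (\<mu> * y)" for y
    using G(5) G0 GU[of y] by (simp_all add: H_def)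
  note H = H1 H2 H3 H4 H5
  have H_less: "H x < H y" if "um - \<eta> < x" "x < y" "y < up" for x y
    using G_less[OF that] G0 by (simp add: H_def divide_strict_right_mono)
  have U_less: "U x < U y" if "x < y" for x y
    by (rule less_of_positive_deriv[OF that U(1) sign(1)]) (rule U)+
  have PU: "P (U y) = P (U 0) * exp (- \<nu> * y)" for y
  proof -
    have "((\<lambda>y. P (U y) * exp (\<nu> * y)) has_real_derivative
        P' (U x) * h (U x) * exp (\<nu> * x) + \<nu> * exp (\<nu> * x) * P (U x)) (at x)" for x
      by (rule derivative_eq_intros DERIV_chain2[OF P(1) U(1)] Um U refl | simp)+
    moreover have "P' (U x) * h (U x) * exp (\<nu> * x) + \<nu> * exp (\<nu> * x) * P (U x) = 0" for x
      using P(3)[OF U(2) Um(2), of x] by (simp add: algebra_simps)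
    ultimately have "\<forall>x. ((\<lambda>y. P (U y) * exp (\<nu> * y)) has_real_derivative 0) (at x)" by simp
    from DERIV_isconst_all[OF this, of y 0] show ?thesis by (simp add: exp_minus field_simps)
  qed
  have P0: "P (U 0) < 0"
  proof -
    have "P (U 0) < P up"
      by (rule less_of_positive_deriv[OF U(3) P(1) P(4)]) (use U(2)[of 0] lt in linarith)+
    then show ?thesis using P(5) by simp
  qed
  \<comment> \<open>The constant value of
    \<open>P' (U z) * h (U z) * exp (\<nu> * z)\<close>.\<close>
  define A where "A = \<nu> * - P (U 0)"
  have A: "0 < A" using P0 lt by (simp add: A_def mult_pos_neg)
  have hU: "P' (U z) * h (U z) = A * exp (- \<nu> * z)" for z
    using P(3)[OF U(2) Um(2), of z] PU[of z] by (simp add: A_def)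
  have H'U: "A * H' (U z) = \<mu> * P' (U z) * exp ((\<mu> + \<nu>) * z)" for z
  proof -
    have hpos: "0 < h (U z)" using sign(1) U by blast
    have "A * H' (U z) * h (U z) = A * (\<mu> * exp (\<mu> * z))" using H(3)[OF Um(1) U(3), of z] H(6)[of z] by simp
    also have "\<dots> = \<mu> * P' (U z) * exp ((\<mu> + \<nu>) * z) * h (U z)"
      using hU[of z] by (simp add: algebra_simps exp_add exp_minus field_simps)
    finally show ?thesis using hpos by simp
  qed
  have \<beta>U: "\<beta> (U y) - \<gamma> (U y) - (b up - b um) * y = \<beta> (U 0) - \<gamma> (U 0)" for y
  proof -
    have "((\<lambda>y. \<beta> (U y) - \<gamma> (U y) - (b up - b um) * y) has_real_derivative
        \<beta>' (U x) * h (U x) - \<gamma>' (U x) * h (U x) - (b up - b um)) (at x)" for x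
      by (rule derivative_eq_intros DERIV_chain2[OF \<beta>(1) U(1)] DERIV_chain2[OF \<gamma>(1) U(1)] Um U refl | simp)+
    moreover have "\<beta>' (U x) * h (U x) - \<gamma>' (U x) * h (U x) - (b up - b um) = 0" for x
      using \<beta>(3)[OF Um(1) U(3), of x] \<gamma>(3)[OF U(2) Um(2), of x] by simp
    ultimately have "\<forall>x. ((\<lambda>y. \<beta> (U y) - \<gamma> (U y) - (b up - b um) * y) has_real_derivative 0) (at x)" by simp
    from DERIV_isconst_all[OF this, of y 0] show ?thesis by simp
  qed
  \<comment> \<open>Since \<open>H (U y)\<close> is exp (\<mu> y), a factor 2 in \<open>H\<close> is
    a translation of the profile by this length.\<close>
  define l where "l = ln 2 / \<mu>"
  have l: "0 < l" "\<mu> * l = ln 2" using lt by (auto simp: l_def)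
  \<comment> \<open>A comparable value lies in a compact set away from \<open>up\<close> if y \<le>
    0; if 0 \<le> y, it is a value of the profile at a point within \<open>l\<close> of y, and it
    lies in a compact set away from \<open>um\<close>. Bounds on these two compact sets produce all
    the constants.\<close>
  have cases: "(y \<le> 0 \<and> um - \<eta> / 2 \<le> w \<and> w \<le> U l) \<or> (0 \<le> y \<and> (\<exists>z. w = U z \<and> \<bar>z - y\<bar> \<le> l \<and> U (- l) \<le> U z \<and> U z \<le> up))"
    if c: "comparable H \<mu> (um - \<eta> / 2) up y w" for y w
  proof (cases "0 \<le> y")
    case True
    with c have Hw: "exp (\<mu> * y) / 2 \<le> H w" "H w \<le> 2 * exp (\<mu> * y)" "um - \<eta> / 2 \<le> w" "w < up" by (auto simp: comparable_def)
    have "um < w"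
    proof (rule ccontr)
      assume "\<not> um < w"
      then have "H w \<le> H um" using H_less[of w um] Hw lt by (cases "w = um") auto
      then show False using Hw(1) H(5) exp_gt_zero[of "\<mu> * y"] by linarith
    qed
    then obtain z where z: "w = U z" using U(4) Hw by blast
    have e2: "exp (\<mu> * l) = 2" using l by simp
    have "exp (\<mu> * y) \<le> exp (\<mu> * (z + l))" "exp (\<mu> * z) \<le> exp (\<mu> * (y + l))"
      using Hw(1,2) H(6)[of z] z e2 by (simp_all add: distrib_left exp_add)
    then have zl: "\<bar>z - y\<bar> \<le> l" using lt by (auto simp: mult_le_cancel_left)
    then have "- l \<le> z" using True by linarith
    then have "U (- l) \<le> U z" using U_less[of "- l" z] by (cases "- l = z") auto
    then show ?thesis using True z zl U(3)[of z] by (intro disjI2) auto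
  next
    case False
    then have "H w \<le> H (U l)" using c H(6)[of l] l by (auto simp: comparable_def)
    then have "\<not> U l < w" using H_less[of "U l" w] c Um(1)[of l] by (auto simp: comparable_def)
    then show ?thesis using False c by (simp add: comparable_def)
  qed
  have exp_cmp: "exp (k * z) \<le> exp (k * l) * exp (k * y)" "exp (k * y) \<le> exp (k * l) * exp (k * z)"
    if "\<bar>z - y\<bar> \<le> l" "0 < k" for k y z :: real
  proof -
    have "k * z \<le> k * (l + y)" "k * y \<le> k * (l + z)" using that by (auto intro!: mult_left_mono)
    then show "exp (k * z) \<le> exp (k * l) * exp (k * y)" "exp (k * y) \<le> exp (k * l) * exp (k * z)"
      by (simp_all add: distrib_left flip: exp_add)
  qed
  have lowIn: "um - \<eta> < w \<and> w < up" if "um - \<eta> / 2 \<le> w" "w \<le> U l" for w using that lt U(3)[of l] by auto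
  have highIn: "um < w \<and> w < up + \<eta>" if "U (- l) \<le> w" "w \<le> up" for w using that lt U(2)[of "- l"] by auto
  obtain B1 where B1: "0 \<le> B1" "\<And>w. um - \<eta> / 2 \<le> w \<Longrightarrow> w \<le> U l \<Longrightarrow> H' w \<le> B1" "\<And>w. um - \<eta> / 2 \<le> w \<Longrightarrow> w \<le> U l \<Longrightarrow> 1 \<le> B1 * H' w"
    using positive_bounds_on_Icc[of "um - \<eta> / 2" "U l" H'] H(2,4) lowIn by blast
  obtain B2 where B2: "0 \<le> B2" "\<And>w. U (- l) \<le> w \<Longrightarrow> w \<le> up \<Longrightarrow> P' w \<le> B2" "\<And>w. U (- l) \<le> w \<Longrightarrow> w \<le> up \<Longrightarrow> 1 \<le> B2 * P' w"
    using positive_bounds_on_Icc[of "U (- l)" up P'] P(2,4) highIn by blast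
  obtain B3 where B3: "0 \<le> B3" "\<And>w. um - \<eta> / 2 \<le> w \<Longrightarrow> w \<le> U l \<Longrightarrow> \<bar>\<beta>' w\<bar> \<le> B3"
    using bounded_on_Icc[of "um - \<eta> / 2" "U l" \<beta>'] \<beta>(2) lowIn by blast
  obtain B4 where B4: "0 \<le> B4" "\<And>w. um - \<eta> / 2 \<le> w \<Longrightarrow> w \<le> U l \<Longrightarrow> \<bar>\<beta> w\<bar> \<le> B4"
    using bounded_on_Icc[of "um - \<eta> / 2" "U l" \<beta>] DERIV_isCont[OF \<beta>(1)] lowIn by blast
  obtain B5 where B5: "0 \<le> B5" "\<And>w. U (- l) \<le> w \<Longrightarrow> w \<le> up \<Longrightarrow> \<bar>\<gamma> w\<bar> \<le> B5"
    using bounded_on_Icc[of "U (- l)" up \<gamma>] DERIV_isCont[OF \<gamma>(1)] highIn by blast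
  have "isCont (\<lambda>w. b w - b um) w" if "U (- l) \<le> w" "w \<le> up" for w
    using b(1)[of w] highIn[OF that] lt by (intro continuous_intros) auto
  then obtain B6 where B6: "0 \<le> B6" "\<And>w. U (- l) \<le> w \<Longrightarrow> w \<le> up \<Longrightarrow> \<bar>b w - b um\<bar> \<le> B6"
    using bounded_on_Icc[of "U (- l)" up "\<lambda>w. b w - b um"] by blast
  \<comment> \<open>The cost of replacing the point z, where \<open>w = U z\<close>, by y in an
    exponential of rate \<mu> + \<nu>.\<close>
  define M where "M = exp ((\<mu> + \<nu>) * l)"
  define C1 where "C1 = \<mu> / A * B2 * M"
  define C2 where "C2 = A * B2 / \<mu> * M"
  define C3 where "C3 = B6 * B2 / A * exp (\<nu> * l)"
  define C4 where "C4 = \<bar>\<beta> (U 0) - \<gamma> (U 0)\<bar> + B5 + \<bar>b up - b um\<bar> * l"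
  define C where "C = 1 + B1 + B3 + B4 + C1 + C2 + C3 + C4"
  have C14: "0 \<le> C1" "0 \<le> C2" "0 \<le> C3" "0 \<le> C4"
    using A lt B2(1) B5(1) B6(1) l(1) by (auto simp: C1_def C2_def C3_def C4_def M_def)
  have C: "1 \<le> C" "B1 \<le> C" "B3 \<le> C" "B4 \<le> C" "C1 \<le> C" "C2 \<le> C" "C3 \<le> C" "C4 \<le> C"
    using C14 B1(1) B3(1) B4(1) by (auto simp: C_def)
  show ?thesis
  proof (rule that[of H H' \<beta> \<beta>' C])
    fix y w assume c: "comparable H \<mu> (um - \<eta> / 2) up y w"
    then have w: "um - \<eta> < w" "w < up" using lt by (auto simp: comparable_def)
    have H'w: "0 < H' w" using H(4)[OF w] .
    have "H' w \<le> C * exp ((\<mu> + \<nu>) * max y 0) \<and> exp ((\<mu> + \<nu>) * max y 0) \<le> C * H' w \<and>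
      \<bar>\<beta>' w\<bar> \<le> C * exp (\<nu> * max y 0) \<and> \<bar>\<beta> w - (b up - b um) * max y 0\<bar> \<le> C"
      using cases[OF c]
    proof (elim disjE conjE exE)
      assume y: "y \<le> 0" and w: "um - \<eta> / 2 \<le> w" "w \<le> U l"
      have "B1 * H' w \<le> C * H' w" using C(2) H'w by (intro mult_right_mono) auto
      then show ?thesis using y B1(2,3)[OF w] B3(2)[OF w] B4(2)[OF w] C by (auto simp: max_def)
    next
      fix z assume y: "0 \<le> y" and z: "w = U z" "\<bar>z - y\<bar> \<le> l" "U (- l) \<le> U z" "U z \<le> up"
      have my: "max y 0 = y" using y by simp
      have P'pos: "0 < P' (U z)" using P(4) U Um by blast
      have hpos: "0 < h (U z)" using sign(1) U by blast
      have munu: "0 < \<mu> + \<nu>" using lt by simp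
      have "A * H' w = \<mu> * P' (U z) * exp ((\<mu> + \<nu>) * z)" using H'U z(1) by simp
      also have "\<dots> \<le> \<mu> * B2 * (M * exp ((\<mu> + \<nu>) * y))"
        using B2(1) B2(2)[OF z(3,4)] lt P'pos exp_cmp(1)[OF z(2) munu] by (intro mult_mono) (auto simp: M_def)
      finally have "H' w \<le> C1 * exp ((\<mu> + \<nu>) * y)" using A by (simp add: C1_def field_simps)
      then have 1: "H' w \<le> C * exp ((\<mu> + \<nu>) * y)" using C(5) by (meson exp_ge_zero mult_right_mono order_trans)
      have "\<mu> * exp ((\<mu> + \<nu>) * y) \<le> \<mu> * (M * exp ((\<mu> + \<nu>) * z))"
        using exp_cmp(2)[OF z(2) munu] lt by (intro mult_left_mono) (auto simp: M_def)
      also have "\<dots> \<le> \<mu> * (M * exp ((\<mu> + \<nu>) * z)) * (B2 * P' (U z))"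
        using mult_left_mono[OF B2(3)[OF z(3,4)], of "\<mu> * (M * exp ((\<mu> + \<nu>) * z))"] lt by (simp add: M_def)
      also have "\<dots> = M * B2 * (A * H' w)" using H'U z(1) by simp
      finally have "exp ((\<mu> + \<nu>) * y) \<le> C2 * H' w" using lt by (simp add: C2_def field_simps)
      then have 2: "exp ((\<mu> + \<nu>) * y) \<le> C * H' w" using C(6) H'w by (meson less_imp_le mult_right_mono order_trans)
      have "A * \<bar>\<beta>' w\<bar> = exp (\<nu> * z) * P' (U z) * (h (U z) * \<bar>\<beta>' w\<bar>)"
        using hU[of z] by (simp add: exp_minus field_simps)
      also have "h (U z) * \<bar>\<beta>' w\<bar> = \<bar>b w - b um\<bar>"
        using \<beta>(3)[OF w] hpos z(1) by (metis abs_mult abs_of_pos mult.commute)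
      also have "exp (\<nu> * z) * P' (U z) * \<bar>b w - b um\<bar> \<le> (exp (\<nu> * l) * exp (\<nu> * y)) * B2 * B6"
        using B2(1) B2(2)[OF z(3,4)] B6(2)[OF z(3,4)] P'pos z(1) exp_cmp(1)[OF z(2) lt(4)] by (intro mult_mono) auto
      finally have "\<bar>\<beta>' w\<bar> \<le> C3 * exp (\<nu> * y)" using A by (simp add: C3_def field_simps)
      then have 3: "\<bar>\<beta>' w\<bar> \<le> C * exp (\<nu> * y)" using C(7) by (meson exp_ge_zero mult_right_mono order_trans)
      have "\<beta> w - (b up - b um) * y = (\<beta> (U 0) - \<gamma> (U 0)) + \<gamma> (U z) + (b up - b um) * (z - y)"
        using \<beta>U[of z] z(1) by (simp add: algebra_simps)
      moreover have "\<bar>(b up - b um) * (z - y)\<bar> \<le> \<bar>b up - b um\<bar> * l"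
        unfolding abs_mult using z(2) by (intro mult_left_mono) auto
      ultimately have "\<bar>\<beta> w - (b up - b um) * y\<bar> \<le> C4"
        using B5(2)[OF z(3,4)] unfolding C4_def by linarith
      then have 4: "\<bar>\<beta> w - (b up - b um) * y\<bar> \<le> C" using C(8) by linarith
      show ?thesis using 1 2 3 4 my by simp
    qed
    then show "H' w \<le> C * exp ((\<mu> + \<nu>) * max y 0)" "exp ((\<mu> + \<nu>) * max y 0) \<le> C * H' w"
      "\<bar>\<beta>' w\<bar> \<le> C * exp (\<nu> * max y 0)" "\<bar>\<beta> w - (b up - b um) * max y 0\<bar> \<le> C" by auto
  qed (use H \<beta> C(1) in auto)
qed

subsection \<open>Solution by characteristics\<close>

text \<open>\<open>b\<close> is the slowness, that is, the time spent per unit length. Per unit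
  length the weight decays by \<mu> near \<open>um\<close> and by \<kappa> - \<nu> near
  \<open>up\<close>; the conditions on \<open>\<omega>\<close> say that this pays for the rate
  \<open>\<omega>\<close> during the time needed. The bounds on \<open>E\<close> keep the datum
  comparable to the profile, keep it inside the domain on the side of \<open>um\<close>, and prevent
  characteristics from crossing.\<close>

locale characteristic_coordinates =
  fixes h b U H H' \<beta> \<beta>' w0 w0' :: "real \<Rightarrow> real" and um up \<eta> \<mu> \<nu> C Lh bmin \<kappa> \<omega> E :: real
  assumes lt: "um < up" "0 < \<eta>" "0 < \<mu>" "0 < \<nu>" "\<nu> \<le> \<kappa>"
    and h_lip: "\<And>x y. um - \<eta> / 2 \<le> x \<Longrightarrow> x < up \<Longrightarrow> um - \<eta> / 2 \<le> y \<Longrightarrow> y < up \<Longrightarrow> \<bar>h x - h y\<bar> \<le> Lh * \<bar>x - y\<bar>" "0 \<le> Lh"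
    and h_cont: "\<And>w. um - \<eta> < w \<Longrightarrow> w < up \<Longrightarrow> isCont h w"
    and b_cont: "\<And>w. um - \<eta> < w \<Longrightarrow> w < up \<Longrightarrow> isCont b w"
    and b_min: "\<And>w. um - \<eta> / 2 \<le> w \<Longrightarrow> w < up \<Longrightarrow> bmin \<le> b w" "0 < bmin" "0 \<le> b up"
    and U: "\<And>y. (U has_real_derivative h (U y)) (at y)" "\<And>y. um < U y" "\<And>y. U y < up"
    and H: "\<And>w. um - \<eta> < w \<Longrightarrow> w < up \<Longrightarrow> (H has_real_derivative H' w) (at w)"
      "\<And>w. um - \<eta> < w \<Longrightarrow> w < up \<Longrightarrow> isCont H' w"
      "\<And>w. um - \<eta> < w \<Longrightarrow> w < up \<Longrightarrow> H' w * h w = \<mu> * H w"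
      "\<And>w. um - \<eta> < w \<Longrightarrow> w < up \<Longrightarrow> 0 < H' w"
      "H um = 0" "\<And>y. H (U y) = exp (\<mu> * y)"
    and \<beta>: "\<And>w. um - \<eta> < w \<Longrightarrow> w < up \<Longrightarrow> (\<beta> has_real_derivative \<beta>' w) (at w)"
      "\<And>w. um - \<eta> < w \<Longrightarrow> w < up \<Longrightarrow> isCont \<beta>' w"
      "\<And>w. um - \<eta> < w \<Longrightarrow> w < up \<Longrightarrow> \<beta>' w * h w = b w - b um"
    and C: "1 \<le> C"
      "\<And>y w. comparable H \<mu> (um - \<eta> / 2) up y w \<Longrightarrow> H' w \<le> C * exp ((\<mu> + \<nu>) * max y 0)"
      "\<And>y w. comparable H \<mu> (um - \<eta> / 2) up y w \<Longrightarrow> exp ((\<mu> + \<nu>) * max y 0) \<le> C * H' w"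
      "\<And>y w. comparable H \<mu> (um - \<eta> / 2) up y w \<Longrightarrow> \<bar>\<beta>' w\<bar> \<le> C * exp (\<nu> * max y 0)"
      "\<And>y w. comparable H \<mu> (um - \<eta> / 2) up y w \<Longrightarrow> \<bar>\<beta> w - (b up - b um) * max y 0\<bar> \<le> C"
    and \<omega>: "0 \<le> \<omega>" "\<omega> * b um \<le> \<mu>" "\<omega> * b up \<le> \<kappa> - \<nu>"
    and w0: "\<And>y. (w0 has_real_derivative w0' y) (at y)" "continuous_on UNIV w0'"
      "\<And>y. \<bar>w0 y - U y\<bar> \<le> E * exp (- \<kappa> * max y 0)"
      "\<And>y. \<bar>w0' y - h (U y)\<bar> \<le> E * exp (- \<kappa> * max y 0)"
    and E: "0 \<le> E" "2 * C * E \<le> 1" "E \<le> \<eta> / 2" "(C + C * C * C) * (1 + Lh) * E \<le> bmin / 2"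
begin

section \<open>Comparable values, the initial datum and the orbits issued from it\<close>

abbreviation "good \<equiv> comparable H \<mu> (um - \<eta> / 2) up"

lemma good_dom: "good y w \<Longrightarrow> um - \<eta> < w" "good y w \<Longrightarrow> w < up" "good y w \<Longrightarrow> um - \<eta> / 2 \<le> w"
  using lt by (auto simp: comparable_def)

lemma H_less: "um - \<eta> < x \<Longrightarrow> x < y \<Longrightarrow> y < up \<Longrightarrow> H x < H y"
  by (rule less_of_positive_deriv[of x y H H']) (use H(1,4) in auto)

lemma H_le: "um - \<eta> < x \<Longrightarrow> x \<le> y \<Longrightarrow> y < up \<Longrightarrow> H x \<le> H y"
  using H_less[of x y] by (cases "x = y") auto

lemma H_le_iff: "um - \<eta> < x \<Longrightarrow> x < up \<Longrightarrow> um - \<eta> < y \<Longrightarrow> y < up \<Longrightarrow> H x \<le> H y \<longleftrightarrow> x \<le> y"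
  using H_less[of y x] H_le[of x y] by (cases "x \<le> y") auto

lemma good_between:
  assumes "good y v" "good y w" "v \<le> \<xi>" "\<xi> \<le> w"
  shows "good y \<xi>"
  using assms good_dom[OF assms(1)] good_dom[OF assms(2)] H_le[of v \<xi>] H_le[of \<xi> w]
  by (auto simp: comparable_def)

text \<open>\<open>H\<close> is increasing, so a mean value point between two comparable values is
  again comparable, and \<open>H'\<close> has a known size there.\<close>

lemma H_mean_value:
  assumes v: "good y v" and w: "good y w"
  shows "\<bar>H v - H w\<bar> \<le> C * exp ((\<mu> + \<nu>) * max y 0) * \<bar>v - w\<bar>"
    and "exp ((\<mu> + \<nu>) * max y 0) * \<bar>v - w\<bar> \<le> C * \<bar>H v - H w\<bar>"
proof -
  have step: "\<exists>\<xi>. good y \<xi> \<and> \<bar>H v - H w\<bar> = H' \<xi> * \<bar>v - w\<bar>" if v: "good y v" and w: "good y w" and vw: "v < w" for v w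
  proof -
    have "\<exists>\<xi>>v. \<xi> < w \<and> H w - H v = (w - v) * H' \<xi>"
      by (rule MVT2[OF vw H(1)]) (use good_dom[OF v] good_dom[OF w] in linarith)+
    then obtain \<xi> where \<xi>: "v < \<xi>" "\<xi> < w" "H w - H v = (w - v) * H' \<xi>" by blast
    have g: "good y \<xi>" using good_between[OF v w] \<xi> by simp
    have "H v < H w" using H_less[OF good_dom(1)[OF v] vw good_dom(2)[OF w]] .
    then show ?thesis using g \<xi> vw by (intro exI[of _ \<xi>]) (auto simp: abs_if algebra_simps)
  qed
  consider "v < w" | "v = w" | "w < v" by linarith
  then have "\<exists>\<xi>. good y \<xi> \<and> \<bar>H v - H w\<bar> = H' \<xi> * \<bar>v - w\<bar>"
  proof cases
    case 1
    then show ?thesis by (rule step[OF v w])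
  next
    case 2
    then show ?thesis using v by auto
  next
    case 3
    from step[OF w v this] show ?thesis by (simp add: abs_minus_commute)
  qed
  then obtain \<xi> where \<xi>: "good y \<xi>" "\<bar>H v - H w\<bar> = H' \<xi> * \<bar>v - w\<bar>" by blast
  show "\<bar>H v - H w\<bar> \<le> C * exp ((\<mu> + \<nu>) * max y 0) * \<bar>v - w\<bar>"
    unfolding \<xi>(2) by (intro mult_right_mono C(2)[OF \<xi>(1)]) auto
  have "exp ((\<mu> + \<nu>) * max y 0) * \<bar>v - w\<bar> \<le> C * H' \<xi> * \<bar>v - w\<bar>"
    by (intro mult_right_mono C(3)[OF \<xi>(1)]) auto
  then show "exp ((\<mu> + \<nu>) * max y 0) * \<bar>v - w\<bar> \<le> C * \<bar>H v - H w\<bar>" unfolding \<xi>(2) by (simp add: mult.assoc)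
qed

lemma U_le: "x \<le> y \<Longrightarrow> U x \<le> U y"
  using H_le_iff[of "U x" "U y"] U(2)[of x] U(2)[of y] U(3) H(6) lt by simp

lemma U_low: "um - \<eta> / 2 \<le> U y"
  using U(2)[of y] lt by simp

lemma good_U: "good y (U y)"
proof -
  have "exp (\<mu> * y) \<le> exp (\<mu> * max y 0)" using lt by simp
  then have "exp (\<mu> * y) \<le> 2 * exp (\<mu> * max y 0)" using exp_gt_zero[of "\<mu> * max y 0"] by linarith
  then show ?thesis using U(3)[of y] U_low[of y] by (simp add: comparable_def H(6))
qed

text \<open>Two comparable values whose images under \<open>H\<close> are exp (\<mu> m) / 2 apart
  are themselves at least exp (- \<nu> m) / (2 C) apart. Since \<open>\<nu> \<le> \<kappa>\<close>
  and 2 C E \<le> 1, the datum deviates from the profile by no more than that. Hence it stays below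
  the profile translated by \<open>l\<close> and, for 0 \<le> y, above the profile translated the
  other way; in particular it stays below \<open>up\<close>.\<close>

lemma good_w0: "good y (w0 y)"
proof -
  define m where "m = max y 0"
  define D where "D = E * exp (- \<kappa> * m)"
  define l where "l = ln 2 / \<mu>"
  have l: "0 < l" "exp (\<mu> * l) = 2" using lt by (auto simp: l_def)
  have m: "0 \<le> m" "y \<le> m" by (auto simp: m_def)
  have "exp (- \<kappa> * m) \<le> exp (- \<nu> * m)" using lt m by (simp add: mult_right_mono)
  then have "2 * C * D \<le> (2 * C * E) * exp (- \<nu> * m)"
    using E(1) C(1) by (simp add: D_def mult.assoc mult_left_mono)
  also have "\<dots> \<le> 1 * exp (- \<nu> * m)" by (intro mult_right_mono E) auto
  finally have D: "2 * C * D \<le> exp (- \<nu> * m)" by simp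
  have "exp (- \<kappa> * m) \<le> 1" using m lt by simp
  then have "D \<le> \<eta> / 2" using E(1,3) mult_left_mono[of "exp (- \<kappa> * m)" 1 E] by (simp add: D_def)
  have D0: "0 \<le> D" using E by (simp add: D_def)
  have near: "\<bar>w0 y - U y\<bar> \<le> D" using w0(3)[of y] by (simp add: D_def m_def)
  have gU: "good m (U (m + l))" "good m (U m)"
    using m U(3) U_low lt l by (auto simp: comparable_def H(6) distrib_left exp_add max_def)
  have shift: "exp (- \<nu> * m) \<le> 2 * C * \<bar>v - v'\<bar>" if "good m v" "good m v'" "exp (\<mu> * m) / 2 \<le> \<bar>H v - H v'\<bar>" for v v'
  proof -
    have "exp (\<mu> * m) \<le> 2 * (C * exp ((\<mu> + \<nu>) * m) * \<bar>v - v'\<bar>)"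
      using H_mean_value(1)[OF that(1,2)] that(3) m by (simp add: max_def)
    then have "exp (\<mu> * m) * 1 \<le> exp (\<mu> * m) * (exp (\<nu> * m) * (2 * C * \<bar>v - v'\<bar>))"
      by (simp add: distrib_right exp_add algebra_simps)
    then have "1 \<le> exp (\<nu> * m) * (2 * C * \<bar>v - v'\<bar>)" by (simp only: mult_le_cancel_left_pos exp_gt_zero)
    then show ?thesis by (simp add: exp_minus field_simps)
  qed
  have "exp (- \<nu> * m) \<le> 2 * C * \<bar>U (m + l) - U m\<bar>"
    by (rule shift[OF gU]) (use l in \<open>simp add: H(6) distrib_left exp_add\<close>)
  with D have "2 * C * D \<le> 2 * C * \<bar>U (m + l) - U m\<bar>" by linarith
  then have "D \<le> \<bar>U (m + l) - U m\<bar>" using C(1) by simp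
  then have "w0 y \<le> U (m + l)" using near U_le[OF m(2)] U_le[of m "m + l"] l by (auto simp: abs_le_iff abs_if split: if_splits)
  then have up: "w0 y < up" "H (w0 y) \<le> 2 * exp (\<mu> * m)" if "um - \<eta> < w0 y"
    using U(3)[of "m + l"] H_le[OF that, of "U (m + l)"] l by (auto simp: H(6) distrib_left exp_add)
  have low: "um - \<eta> / 2 \<le> w0 y" using near \<open>D \<le> \<eta> / 2\<close> U(2)[of y] by (auto simp: abs_le_iff)
  then have dom: "um - \<eta> < w0 y" using lt by simp
  moreover have "exp (\<mu> * y) / 2 \<le> H (w0 y)" if y: "0 \<le> y"
  proof -
    have my: "m = y" using y by (simp add: m_def)
    have Hl: "H (U (y - l)) = exp (\<mu> * y) / 2" using l by (simp add: H(6) right_diff_distrib exp_diff)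
    have "good m (U (y - l))"
    proof -
      have "H (U (y - l)) \<le> 2 * exp (\<mu> * y)" using Hl exp_gt_zero[of "\<mu> * y"] by linarith
      moreover have "exp (\<mu> * y) / 2 \<le> H (U (y - l))" using Hl by simp
      ultimately show ?thesis using my U(3)[of "y - l"] U_low[of "y - l"] y unfolding comparable_def by simp
    qed
    then have "exp (- \<nu> * m) \<le> 2 * C * \<bar>U m - U (y - l)\<bar>"
      by (rule shift[OF gU(2)]) (simp add: Hl, simp add: H(6) my)
    with D have "2 * C * D \<le> 2 * C * \<bar>U m - U (y - l)\<bar>" by linarith
    then have "D \<le> \<bar>U y - U (y - l)\<bar>" using C(1) my by simp
    then have "U (y - l) \<le> w0 y" using near U_le[of "y - l" y] l by (auto simp: abs_le_iff abs_if split: if_splits)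
    then have "H (U (y - l)) \<le> H (w0 y)" using U(2)[of "y - l"] lt up(1)[OF dom] by (intro H_le) auto
    then show ?thesis using Hl by simp
  qed
  ultimately show ?thesis using low up by (auto simp: comparable_def m_def)
qed

lemmas w0_dom = good_dom[OF good_w0]

text \<open>On the characteristic issued from \<open>(s, w0 s)\<close>, the value at abscissa \<open>y \<le> s\<close> is \<open>W s y\<close>, reached at
  time \<open>F s y\<close>; \<open>Ws\<close> and \<open>Fs\<close> are the derivatives in \<open>s\<close>. All of them are junk for \<open>y > s\<close>. The weight
  \<open>X s y\<close> is the amplification of the perturbation between \<open>s\<close> and \<open>y\<close>.\<close>

definition e0 where "e0 y = w0' y - h (w0 y)"
definition q where "q y = H (w0 y) * exp (- \<mu> * y)"
definition q' where "q' y = H' (w0 y) * exp (- \<mu> * y) * e0 y"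
definition K where "K = inv_into {um - \<eta><..<up} H"
definition W where "W s y = K (q s * exp (\<mu> * y))"
definition Ws where "Ws s y = q' s * exp (\<mu> * y) / H' (W s y)"
definition F where "F s y = b um * (s - y) + \<beta> (w0 s) - \<beta> (W s y)"
definition Fs where "Fs s y = b (w0 s) + \<beta>' (w0 s) * e0 s - \<beta>' (W s y) * Ws s y"
definition X where "X s y = exp (- (\<mu> + \<nu>) * max y 0 + \<mu> * y - \<mu> * s + (\<mu> + \<nu> - \<kappa>) * max s 0)"

text \<open>\<open>e0\<close> is the slope of the graph of the datum minus the slope of the orbit
  through the same point. It vanishes for the profile itself, and it is the source of every
  derivative with respect to the foot.\<close>

lemma e0_bound: "\<bar>e0 y\<bar> \<le> (1 + Lh) * E * exp (- \<kappa> * max y 0)"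
proof -
  have "\<bar>h (U y) - h (w0 y)\<bar> \<le> Lh * \<bar>U y - w0 y\<bar>"
    by (rule h_lip) (use good_dom[OF good_U] w0_dom in auto)
  also have "\<dots> \<le> Lh * (E * exp (- \<kappa> * max y 0))"
    using w0(3)[of y] h_lip(2) by (intro mult_left_mono) (auto simp: abs_minus_commute)
  finally have "\<bar>e0 y\<bar> \<le> E * exp (- \<kappa> * max y 0) + Lh * (E * exp (- \<kappa> * max y 0))"
    using w0(4)[of y] unfolding e0_def by linarith
  then show ?thesis by (simp add: algebra_simps)
qed

lemma q_deriv: "(q has_real_derivative q' y) (at y)"
proof -
  have "(q has_real_derivative H' (w0 y) * w0' y * exp (- \<mu> * y) - \<mu> * exp (- \<mu> * y) * H (w0 y)) (at y)"
    unfolding q_def[abs_def]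
    by (rule derivative_eq_intros DERIV_chain2[OF H(1) w0(1)] w0_dom refl | simp)+
  moreover have "H' (w0 y) * w0' y * exp (- \<mu> * y) - \<mu> * exp (- \<mu> * y) * H (w0 y) = q' y"
    using H(3)[OF w0_dom(1,2), of y] by (simp add: q'_def e0_def algebra_simps)
  ultimately show ?thesis by simp
qed

text \<open>\<open>q\<close> labels the orbits and equals 1 on the profile. The exponent collects
  exp ((\<mu> + \<nu>) max y 0) from \<open>H'\<close>, exp (- \<kappa> max y 0) from the datum, and
  exp (- \<mu> y) from the definition of \<open>q\<close>.\<close>

lemma q_bounds:
  "\<bar>q y - 1\<bar> \<le> C * E * exp ((\<mu> + \<nu> - \<kappa>) * max y 0 - \<mu> * y)"
  "\<bar>q' y\<bar> \<le> C * (1 + Lh) * E * exp ((\<mu> + \<nu> - \<kappa>) * max y 0 - \<mu> * y)"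
proof -
  have e: "exp ((\<mu> + \<nu> - \<kappa>) * max y 0 - \<mu> * y) = exp ((\<mu> + \<nu>) * max y 0) * exp (- \<kappa> * max y 0) * exp (- \<mu> * y)"
    by (simp add: algebra_simps flip: exp_add)
  have "q y - 1 = exp (- \<mu> * y) * (H (w0 y) - H (U y))"
    by (simp add: q_def H(6) algebra_simps exp_minus field_simps)
  then have "\<bar>q y - 1\<bar> = exp (- \<mu> * y) * \<bar>H (w0 y) - H (U y)\<bar>" by (simp add: abs_mult)
  also have "\<dots> \<le> exp (- \<mu> * y) * (C * exp ((\<mu> + \<nu>) * max y 0) * (E * exp (- \<kappa> * max y 0)))"
    using C(1) by (intro mult_left_mono order_trans[OF H_mean_value(1)[OF good_w0 good_U]] w0(3)) auto
  finally show "\<bar>q y - 1\<bar> \<le> C * E * exp ((\<mu> + \<nu> - \<kappa>) * max y 0 - \<mu> * y)" unfolding e by (simp add: algebra_simps)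
  have "\<bar>q' y\<bar> = H' (w0 y) * exp (- \<mu> * y) * \<bar>e0 y\<bar>"
    using H(4)[OF w0_dom(1,2), of y] by (simp add: q'_def abs_mult)
  also have "\<dots> \<le> (C * exp ((\<mu> + \<nu>) * max y 0)) * exp (- \<mu> * y) * ((1 + Lh) * E * exp (- \<kappa> * max y 0))"
    using C(1) by (intro mult_mono C(2) good_w0 e0_bound) auto
  finally show "\<bar>q' y\<bar> \<le> C * (1 + Lh) * E * exp ((\<mu> + \<nu> - \<kappa>) * max y 0 - \<mu> * y)" unfolding e by (simp add: algebra_simps)
qed

lemma K_H: "um - \<eta> < w \<Longrightarrow> w < up \<Longrightarrow> K (H w) = w"
  unfolding K_def
  by (rule inv_into_f_f) (auto intro!: inj_onI simp: H_less antisym H_le_iff[THEN iffD1, OF _ _ _ _ eq_refl])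

lemma H_isCont: "um - \<eta> < w \<Longrightarrow> w < up \<Longrightarrow> isCont H w"
  by (rule DERIV_isCont[OF H(1)])

text \<open>Going from s back to y \<le> s multiplies \<open>H\<close> by a factor in (0, 1], so the
  value moves towards \<open>um\<close>, the zero of \<open>H\<close>; the intermediate value
  theorem finds it between \<open>um\<close> and \<open>w0 s\<close>. The bounds that define
  comparability decrease no faster than \<open>H\<close> does, and the lower one decreases at the
  same rate.\<close>

lemma W_props:
  assumes "y \<le> s"
  shows "good y (W s y)" "H (W s y) = q s * exp (\<mu> * y)"
proof -
  define \<theta> where "\<theta> = exp (- \<mu> * (s - y))"
  have \<theta>: "0 < \<theta>" "\<theta> \<le> 1" using assms lt by (auto simp: \<theta>_def)
  define p where "p = H (w0 s) * \<theta>"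
  have p: "p = q s * exp (\<mu> * y)" by (simp add: p_def q_def \<theta>_def algebra_simps flip: exp_add)
  note d = w0_dom[of s]
  have "\<exists>w. min um (w0 s) \<le> w \<and> w \<le> max um (w0 s) \<and> H w = p"
  proof (cases "0 \<le> H (w0 s)")
    case True
    then have "um \<le> w0 s" using H_le_iff[of um "w0 s"] d lt H(5) by simp
    moreover have "0 \<le> p" "p \<le> H (w0 s)" using True \<theta> by (auto simp: p_def mult_left_le)
    ultimately have "\<exists>w. um \<le> w \<and> w \<le> w0 s \<and> H w = p"
      using d lt H(5) by (intro IVT) (auto intro!: H_isCont)
    then show ?thesis by force
  next
    case False
    then have "w0 s \<le> um" using H_le_iff[of "w0 s" um] d lt H(5) by simp
    moreover have "p \<le> 0" "H (w0 s) \<le> p" using False \<theta> by (auto simp: p_def mult_le_0_iff mult_le_cancel_left1)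
    ultimately have "\<exists>w. w0 s \<le> w \<and> w \<le> um \<and> H w = p"
      using d lt H(5) by (intro IVT) (auto intro!: H_isCont)
    then show ?thesis by force
  qed
  then obtain w where w: "min um (w0 s) \<le> w" "w \<le> max um (w0 s)" "H w = p" by blast
  have dom: "um - \<eta> < w" "w < up" "um - \<eta> / 2 \<le> w" using w d lt by (auto simp: min_def max_def split: if_splits)
  have W: "W s y = w" using K_H[OF dom(1,2)] w(3) p by (simp add: W_def)
  have g: "H (w0 s) \<le> 2 * exp (\<mu> * max s 0)" "0 \<le> s \<Longrightarrow> exp (\<mu> * s) / 2 \<le> H (w0 s)"
    using good_w0[of s] by (auto simp: comparable_def)
  have "p \<le> 2 * exp (\<mu> * max s 0) * \<theta>" unfolding p_def using g(1) \<theta> by (intro mult_right_mono) auto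
  also have "\<dots> = 2 * exp (\<mu> * max s 0 - \<mu> * (s - y))" by (simp add: \<theta>_def flip: exp_add)
  also have "\<dots> \<le> 2 * exp (\<mu> * max y 0)"
  proof -
    have "\<mu> * (max s 0 - (s - y)) \<le> \<mu> * max y 0" using assms lt by (intro mult_left_mono) (auto simp: max_def)
    then show ?thesis by (simp add: right_diff_distrib)
  qed
  finally have 1: "p \<le> 2 * exp (\<mu> * max y 0)" .
  have 2: "exp (\<mu> * y) / 2 \<le> p" if "0 \<le> y"
  proof -
    have "exp (\<mu> * y) / 2 = exp (\<mu> * s) / 2 * \<theta>" by (simp add: \<theta>_def algebra_simps flip: exp_add)
    also have "\<dots> \<le> p" unfolding p_def using g(2) that assms \<theta> by (intro mult_right_mono) auto
    finally show ?thesis .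
  qed
  show "good y (W s y)" using 1 2 dom w(3) W by (auto simp: comparable_def)
  show "H (W s y) = q s * exp (\<mu> * y)" using W w(3) p by simp
qed

lemmas W_dom = good_dom[OF W_props(1)]

lemma W_diag: "W s s = w0 s"
  using K_H[OF w0_dom(1,2)] by (simp add: W_def q_def mult.assoc flip: exp_add)

lemma K_deriv:
  assumes "um - \<eta> < w" "w < up"
  shows "(K has_real_derivative 1 / H' w) (at (H w))"
proof -
  have "(K has_derivative (\<lambda>x. x / H' w)) (at (H w))"
    by (rule has_derivative_inverse_strong[of "{um - \<eta><..<up}" w H K "\<lambda>x. H' w * x"])
      (use assms H(1)[OF assms] H(4)[OF assms] K_H H_isCont in
        \<open>auto intro!: continuous_at_imp_continuous_on simp: has_field_derivative_def fun_eq_iff\<close>)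
  then show ?thesis unfolding has_field_derivative_def by (rule has_derivative_eq_rhs) (auto simp: fun_eq_iff)
qed

lemma W_gradient:
  assumes "y \<le> s"
  shows "has_gradient (\<lambda>z. W (fst z) (snd z)) (Ws s y) (h (W s y)) (s, y)"
proof -
  have 1: "has_gradient (\<lambda>z. q (fst z)) (q' s) 0 (s, y)"
  proof -
    have "has_gradient fst 1 0 (s, y)" by (auto intro!: derivative_eq_intros simp: fun_eq_iff)
    from has_gradient_compose[OF this, of q "q' s"] q_deriv[of s] show ?thesis by simp
  qed
  have 2: "has_gradient (\<lambda>z. exp (\<mu> * snd z)) 0 (\<mu> * exp (\<mu> * y)) (s, y)"
    by (auto intro!: derivative_eq_intros simp: fun_eq_iff)
  note 3 = has_gradient_mult[OF 1 2]
  have "(K has_real_derivative 1 / H' (W s y)) (at (q (fst (s, y)) * exp (\<mu> * snd (s, y))))"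
    using K_deriv[OF W_dom(1,2)[OF assms]] W_props(2)[OF assms] by simp
  note 4 = has_gradient_compose[OF 3 this]
  have e1: "1 / H' (W s y) * (q' s * exp (\<mu> * snd (s, y)) + q (fst (s, y)) * 0) = Ws s y"
    by (simp add: Ws_def)
  have e2: "1 / H' (W s y) * (0 * exp (\<mu> * snd (s, y)) + q (fst (s, y)) * (\<mu> * exp (\<mu> * y))) = h (W s y)"
    using H(3)[OF W_dom(1,2)[OF assms]] H(4)[OF W_dom(1,2)[OF assms]] W_props(2)[OF assms] by (simp add: field_simps)
  show ?thesis using 4[unfolded e1 e2] unfolding W_def .
qed

text \<open>Along an orbit, \<beta> corrects the constant slowness b um to the true one, since
  \<open>\<beta>' * h\<close> is b - b um. Hence the derivative in y is minus the slowness at the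
  current value.\<close>

lemma F_gradient:
  assumes "y \<le> s"
  shows "has_gradient (\<lambda>z. F (fst z) (snd z)) (Fs s y) (- b (W s y)) (s, y)"
proof -
  have 1: "has_gradient (\<lambda>z. \<beta> (W (fst z) (snd z))) (\<beta>' (W s y) * Ws s y) (\<beta>' (W s y) * h (W s y)) (s, y)"
    by (rule has_gradient_compose[OF W_gradient[OF assms]]) (use \<beta>(1) W_dom[OF assms] in simp)
  have fst: "has_gradient fst 1 0 (s, y)" by (auto intro!: derivative_eq_intros simp: fun_eq_iff)
  have "((\<lambda>s. \<beta> (w0 s)) has_real_derivative \<beta>' (w0 s) * w0' s) (at s)"
    by (rule DERIV_chain2[OF \<beta>(1) w0(1)]) (rule w0_dom)+
  then have 2: "has_gradient (\<lambda>z. \<beta> (w0 (fst z))) (\<beta>' (w0 s) * w0' s * 1) (\<beta>' (w0 s) * w0' s * 0) (s, y)"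
    using has_gradient_compose[OF fst, of "\<lambda>s. \<beta> (w0 s)"] by simp
  have 3: "has_gradient (\<lambda>z. b um * (fst z - snd z)) (b um) (- b um) (s, y)"
    by (auto intro!: derivative_eq_intros simp: fun_eq_iff algebra_simps)
  have eqs: "\<beta>' (w0 s) * w0' s = \<beta>' (w0 s) * e0 s + (b (w0 s) - b um)"
    using \<beta>(3)[OF w0_dom(1,2), of s] by (simp add: e0_def algebra_simps)
  have Fs: "Fs s y = b um + \<beta>' (w0 s) * w0' s - \<beta>' (W s y) * Ws s y"
    by (simp add: Fs_def eqs)
  have Fy: "b (W s y) = b um + \<beta>' (W s y) * h (W s y)"
    by (simp add: \<beta>(3)[OF W_dom(1,2)[OF assms]])
  show ?thesis
    unfolding F_def Fs Fy
    by (rule has_derivative_eq_rhs[OF has_derivative_diff[OF has_derivative_add[OF 3 2] 1]])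
      (auto simp: fun_eq_iff algebra_simps)
qed

lemma weight_inverse: "exp (- (\<mu> + \<nu>) * max y 0) = inverse (exp ((\<mu> + \<nu>) * max y 0))"
  by (simp only: mult_minus_left exp_minus)

lemma Ws_bound:
  assumes "y \<le> s"
  shows "\<bar>Ws s y\<bar> \<le> C * C * (1 + Lh) * E * X s y"
proof -
  have H': "0 < H' (W s y)" "exp ((\<mu> + \<nu>) * max y 0) \<le> C * H' (W s y)"
    using H(4) W_dom[OF assms] C(3)[OF W_props(1)[OF assms]] by auto
  define e where "e = exp ((\<mu> + \<nu>) * max y 0)"
  have "1 / H' (W s y) \<le> C * exp (- (\<mu> + \<nu>) * max y 0)"
    using H' unfolding weight_inverse e_def[symmetric] by (simp add: e_def field_simps)
  then have "\<bar>Ws s y\<bar> \<le> (C * (1 + Lh) * E * exp ((\<mu> + \<nu> - \<kappa>) * max s 0 - \<mu> * s)) * exp (\<mu> * y) * (C * exp (- (\<mu> + \<nu>) * max y 0))"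
    using mult_mono[OF mult_right_mono[OF q_bounds(2)[of s], of "exp (\<mu> * y)"], of "1 / H' (W s y)" "C * exp (- (\<mu> + \<nu>) * max y 0)"] H'(1) C(1) E(1) h_lip(2)
    by (simp add: Ws_def abs_mult)
  also have "\<dots> = C * C * (1 + Lh) * E * (exp ((\<mu> + \<nu> - \<kappa>) * max s 0 - \<mu> * s) * exp (\<mu> * y) * exp (- (\<mu> + \<nu>) * max y 0))"
    by (simp only: mult.assoc mult.left_commute mult.commute)
  also have "exp ((\<mu> + \<nu> - \<kappa>) * max s 0 - \<mu> * s) * exp (\<mu> * y) * exp (- (\<mu> + \<nu>) * max y 0) = X s y"
    unfolding X_def exp_add[symmetric] by (simp add: algebra_simps)
  finally show ?thesis .
qed

lemma W_bound:
  assumes "y \<le> s"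
  shows "\<bar>W s y - U y\<bar> \<le> C * C * E * X s y"
proof -
  have "H (W s y) - H (U y) = exp (\<mu> * y) * (q s - 1)"
    using W_props(2)[OF assms] by (simp add: H(6) algebra_simps)
  then have d: "\<bar>H (W s y) - H (U y)\<bar> = exp (\<mu> * y) * \<bar>q s - 1\<bar>" by (simp add: abs_mult)
  have "\<bar>W s y - U y\<bar> = exp (- (\<mu> + \<nu>) * max y 0) * (exp ((\<mu> + \<nu>) * max y 0) * \<bar>W s y - U y\<bar>)"
    unfolding weight_inverse by simp
  also have "\<dots> \<le> exp (- (\<mu> + \<nu>) * max y 0) * (C * \<bar>H (W s y) - H (U y)\<bar>)"
    by (intro mult_left_mono H_mean_value(2) W_props(1) assms good_U) auto
  also have "\<dots> \<le> exp (- (\<mu> + \<nu>) * max y 0) * (C * (exp (\<mu> * y) * (C * E * exp ((\<mu> + \<nu> - \<kappa>) * max s 0 - \<mu> * s))))"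
    unfolding d using C(1) by (intro mult_left_mono q_bounds) auto
  also have "\<dots> = C * C * E * (exp ((\<mu> + \<nu> - \<kappa>) * max s 0 - \<mu> * s) * exp (\<mu> * y) * exp (- (\<mu> + \<nu>) * max y 0))"
    by (simp only: mult.assoc mult.left_commute mult.commute)
  also have "exp ((\<mu> + \<nu> - \<kappa>) * max s 0 - \<mu> * s) * exp (\<mu> * y) * exp (- (\<mu> + \<nu>) * max y 0) = X s y"
    unfolding X_def exp_add[symmetric] by (simp add: algebra_simps)
  finally show ?thesis .
qed

section \<open>Weights and travel times\<close>

text \<open>Splitting y and s into positive and negative parts exhibits the weight as the target
  weight exp (- \<kappa> max y 0) times one exponential decay per side: rate \<mu> for the distance
  travelled in y < 0, rate \<kappa> - \<nu> for the distance travelled in y > 0.\<close>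

lemma X_exponent: "- (\<mu> + \<nu>) * max y 0 + \<mu> * y - \<mu> * s + (\<mu> + \<nu> - \<kappa>) * max s 0 =
    - \<kappa> * max y 0 - (\<mu> * (max (- y) 0 - max (- s) 0) + (\<kappa> - \<nu>) * (max s 0 - max y 0))"
proof -
  have "y = max y 0 - max (- y) 0" "s = max s 0 - max (- s) 0" by (auto simp: max_def)
  then have "\<mu> * y = \<mu> * max y 0 - \<mu> * max (- y) 0" "\<mu> * s = \<mu> * max s 0 - \<mu> * max (- s) 0"
    by (metis right_diff_distrib)+
  then show ?thesis by (simp add: algebra_simps)
qed

lemma parts_mono: "y \<le> s \<Longrightarrow> 0 \<le> max (- y) 0 - max (- s) (0::real)" "y \<le> s \<Longrightarrow> 0 \<le> max s 0 - max y (0::real)"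
  by (auto simp: max_def)

text \<open>\<open>\<beta>'\<close> may be as large as exp (\<nu> max y 0) near \<open>up\<close>;
  because \<open>\<nu> \<le> \<kappa>\<close>, the weight compensates for it.\<close>

lemma X_weighted:
  assumes "y \<le> s"
  shows "exp (\<nu> * max y 0) * X s y \<le> 1"
proof -
  have "0 \<le> \<mu> * (max (- y) 0 - max (- s) 0) + (\<kappa> - \<nu>) * (max s 0 - max y 0)"
    using parts_mono[OF assms] lt by (intro add_nonneg_nonneg mult_nonneg_nonneg) auto
  moreover have "0 \<le> (\<kappa> - \<nu>) * max y 0" using lt by simp
  ultimately show ?thesis
    unfolding X_def X_exponent exp_add[symmetric] by (simp add: algebra_simps)
qed

text \<open>Characteristics do not cross. For the profile only the slowness b (w0 s) is present; the
  two other terms are proportional to \<open>E\<close>, and the last smallness condition on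
  \<open>E\<close> leaves half of \<open>bmin\<close>.\<close>

lemma Fs_lower:
  assumes "y \<le> s"
  shows "bmin / 2 \<le> Fs s y"
proof -
  have "\<bar>\<beta>' (w0 s) * e0 s\<bar> \<le> (C * exp (\<nu> * max s 0)) * ((1 + Lh) * E * exp (- \<kappa> * max s 0))"
    unfolding abs_mult using C(1) by (intro mult_mono C(4) good_w0 e0_bound) auto
  also have "\<dots> = C * (1 + Lh) * E * exp ((\<nu> - \<kappa>) * max s 0)" by (simp add: algebra_simps flip: exp_add)
  also have "\<dots> \<le> C * (1 + Lh) * E * 1"
    using C(1) E(1) h_lip(2) lt by (intro mult_left_mono) (auto simp: mult_le_0_iff)
  finally have 1: "\<bar>\<beta>' (w0 s) * e0 s\<bar> \<le> C * (1 + Lh) * E" by simp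
  have "\<bar>\<beta>' (W s y) * Ws s y\<bar> \<le> (C * exp (\<nu> * max y 0)) * (C * C * (1 + Lh) * E * X s y)"
    unfolding abs_mult using C(1) by (intro mult_mono C(4) W_props(1) Ws_bound assms) auto
  also have "\<dots> = C * C * C * (1 + Lh) * E * (exp (\<nu> * max y 0) * X s y)" by (simp add: algebra_simps)
  also have "\<dots> \<le> C * C * C * (1 + Lh) * E * 1"
    using C(1) E(1) h_lip(2) by (intro mult_left_mono X_weighted assms) auto
  finally have 2: "\<bar>\<beta>' (W s y) * Ws s y\<bar> \<le> C * C * C * (1 + Lh) * E" by simp
  have "bmin \<le> b (w0 s)" using b_min(1) w0_dom by blast
  moreover have "C * (1 + Lh) * E + C * C * C * (1 + Lh) * E \<le> bmin / 2" using E(4) by (simp add: algebra_simps)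
  ultimately show ?thesis using 1 2 unfolding Fs_def by linarith
qed

lemma F_deriv: "y \<le> s \<Longrightarrow> ((\<lambda>s. F s y) has_real_derivative Fs s y) (at s)"
  using has_gradient_partials(1)[OF F_gradient] by simp

lemma F_diag: "F s s = 0" by (simp add: F_def W_diag)

lemma F_lower:
  assumes "y \<le> s"
  shows "bmin / 2 * (s - y) \<le> F s y"
proof -
  have "F y y - bmin / 2 * y \<le> F s y - bmin / 2 * s"
  proof (rule DERIV_nonneg_imp_nondecreasing[OF assms])
    fix r assume "y \<le> r" "r \<le> s"
    then show "\<exists>d. ((\<lambda>s. F s y - bmin / 2 * s) has_real_derivative d) (at r) \<and> 0 \<le> d"
      using Fs_lower[of y r]
      by (intro exI[of _ "Fs r y - bmin / 2"]) (auto intro!: derivative_eq_intros F_deriv)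
  qed
  then show ?thesis by (simp add: F_diag algebra_simps)
qed

lemma F_strict_mono: "y \<le> r \<Longrightarrow> r < s \<Longrightarrow> F r y < F s y"
proof (rule less_of_positive_deriv[of r s "\<lambda>s. F s y" "\<lambda>s. Fs s y"])
  fix w assume "y \<le> r" "r \<le> w"
  then show "((\<lambda>s. F s y) has_real_derivative Fs w y) (at w)" "0 < Fs w y"
    using F_deriv Fs_lower[of y w] b_min(2) by auto
qed auto

text \<open>At both ends of the orbit \<beta> is within \<open>C\<close> of (b up - b um) max y 0.
  Inserting this splits the travel time into the distances on each side of 0, weighted by the
  slowness of the corresponding endstate, up to 2 C.\<close>

lemma F_upper:
  assumes "y \<le> s"
  shows "F s y \<le> b um * (max (- y) 0 - max (- s) 0) + b up * (max s 0 - max y 0) + 2 * C"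
proof -
  have "\<bar>\<beta> (w0 s) - (b up - b um) * max s 0\<bar> \<le> C" "\<bar>\<beta> (W s y) - (b up - b um) * max y 0\<bar> \<le> C"
    by (rule C(5)[OF good_w0], rule C(5)[OF W_props(1)[OF assms]])
  then have "F s y \<le> b um * (s - y) + (b up - b um) * max s 0 - (b up - b um) * max y 0 + 2 * C"
    unfolding F_def by linarith
  moreover have "s - y = (max s 0 - max y 0) + (max (- y) 0 - max (- s) 0)" by (auto simp: max_def)
  then have "b um * (s - y) = b um * (max s 0 - max y 0) + b um * (max (- y) 0 - max (- s) 0)"
    by (metis distrib_left)
  ultimately show ?thesis by (simp add: algebra_simps)
qed

text \<open>The foot of the characteristic through \<open>(t, y)\<close>.\<close>

definition S where "S t y = (THE s. y \<le> s \<and> F s y = t)"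

lemma F_inj: "y \<le> r \<Longrightarrow> y \<le> s \<Longrightarrow> F r y = F s y \<Longrightarrow> r = s"
  using F_strict_mono[of y r s] F_strict_mono[of y s r] by (cases r s rule: linorder_cases) auto

lemma S_F: "y \<le> s \<Longrightarrow> S (F s y) y = s"
  unfolding S_def by (rule the_equality) (auto intro: F_inj)

lemma S_props:
  assumes "0 \<le> t"
  shows "y \<le> S t y" "F (S t y) y = t" "S t y - y \<le> 2 * t / bmin" "0 < t \<Longrightarrow> y < S t y"
proof -
  \<comment> \<open>\<open>F\<close> vanishes at the foot s = y and grows at least with slope bmin /
    2, so it has reached t at this abscissa.\<close>
  define r where "r = y + 2 * t / bmin"
  have r: "y \<le> r" using assms b_min(2) by (simp add: r_def)
  have "t \<le> F r y" using F_lower[OF r] b_min(2) by (simp add: r_def)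
  then have "\<exists>s. y \<le> s \<and> s \<le> r \<and> F s y = t"
    using r assms F_diag by (intro IVT) (auto intro!: DERIV_isCont[OF F_deriv])
  then obtain s where s: "y \<le> s" "s \<le> r" "F s y = t" by blast
  have "S t y = s" using S_F[OF s(1)] s(3) by simp
  with s show "y \<le> S t y" "F (S t y) y = t" "S t y - y \<le> 2 * t / bmin" "0 < t \<Longrightarrow> y < S t y"
    using F_diag[of y] by (auto simp: r_def less_le)
qed

text \<open>The distances \<open>A\<close> and \<open>B\<close> are traded for time through
  \<open>F_upper\<close>; the conditions on \<open>\<omega>\<close> apply to each separately, and
  the additive error 2 C of the travel time costs only the factor exp (2 C \<omega>).\<close>

lemma X_decay:
  assumes "0 \<le> t"
  shows "X (S t y) y \<le> exp (2 * C * \<omega>) * exp (- \<kappa> * max y 0 - \<omega> * t)"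
proof -
  define s where "s = S t y"
  have s: "y \<le> s" "F s y = t" using S_props[OF assms] by (auto simp: s_def)
  define A where "A = max (- y) 0 - max (- s) 0"
  define B where "B = max s 0 - max y 0"
  have AB: "0 \<le> A" "0 \<le> B" using parts_mono[OF s(1)] by (auto simp: A_def B_def)
  have "t \<le> b um * A + b up * B + 2 * C" using F_upper[OF s(1)] s(2) by (simp add: A_def B_def)
  then have "\<omega> * t \<le> \<omega> * (b um * A + b up * B + 2 * C)" using \<omega>(1) by (intro mult_left_mono) auto
  also have "\<dots> = (\<omega> * b um) * A + (\<omega> * b up) * B + 2 * C * \<omega>" by (simp add: algebra_simps)
  also have "\<dots> \<le> \<mu> * A + (\<kappa> - \<nu>) * B + 2 * C * \<omega>" using AB \<omega> by (intro add_mono mult_right_mono order_refl)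
  finally have "- \<kappa> * max y 0 - (\<mu> * A + (\<kappa> - \<nu>) * B) \<le> 2 * C * \<omega> + (- \<kappa> * max y 0 - \<omega> * t)" by simp
  then show ?thesis
    unfolding s_def[symmetric] X_def X_exponent exp_add[symmetric] A_def B_def by simp
qed

section \<open>The solution in the frame of the wave, its regularity and its bounds\<close>

definition w where "w z = W (S (fst z) (snd z)) (snd z)"
definition wt where "wt z = Ws (S (fst z) (snd z)) (snd z) / Fs (S (fst z) (snd z)) (snd z)"
text \<open>The equation solved for the space derivative, with h = g / a and b = - 1 / a. It agrees
  with the chain rule by \<open>w_gradient\<close>, so the equation holds by mere algebra.\<close>

definition wx where "wx z = h (w z) + b (w z) * wt z"

text \<open>Inverse function theorem for (s, y) to (F s y, y) on the open set y < s. The derivative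
  is triangular, and it is invertible because \<open>Fs\<close> is positive.\<close>

lemma S_derivative:
  fixes t y :: real
  assumes "0 < t"
  defines "s \<equiv> S t y"
  shows "((\<lambda>z. (S (fst z) (snd z), snd z)) has_derivative
    (\<lambda>(dt, dy). ((dt + b (W s y) * dy) / Fs s y, dy))) (at (t, y))"
proof -
  have s: "y < s" "F s y = t" using S_props[of t y] assms by auto
  define \<Psi> where "\<Psi> z = (F (fst z) (snd z), snd z)" for z :: "real \<times> real"
  have \<Psi>_der: "(\<Psi> has_derivative (\<lambda>(ds, dy). (Fs (fst z) (snd z) * ds - b (W (fst z) (snd z)) * dy, dy))) (at z)"
    if "snd z \<le> fst z" for z
  proof -
    have "(\<Psi> has_derivative (\<lambda>v. ((\<lambda>(ds, dy). Fs (fst z) (snd z) * ds + - b (W (fst z) (snd z)) * dy) v, snd v))) (at z)"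
      unfolding \<Psi>_def[abs_def]
      using F_gradient[OF that] by (intro has_derivative_Pair has_derivative_snd has_derivative_ident) simp
    then show ?thesis by (rule has_derivative_eq_rhs) (auto simp: fun_eq_iff)
  qed
  have "((\<lambda>z. (S (fst z) (snd z), snd z)) has_derivative
    (\<lambda>(dt, dy). ((dt + b (W s y) * dy) / Fs s y, dy))) (at (\<Psi> (s, y)))"
  proof (rule has_derivative_inverse_strong[where S="{z. snd z < fst z}" and f = \<Psi> and x = "(s, y)"
        and f' = "\<lambda>(ds, dy). (Fs s y * ds - b (W s y) * dy, dy)"])
    show "open {z :: real \<times> real. snd z < fst z}" by (intro open_Collect_less continuous_intros)
    show "continuous_on {z. snd z < fst z} \<Psi>"
    proof (intro continuous_at_imp_continuous_on ballI)
      fix z :: "real \<times> real" assume "z \<in> {z. snd z < fst z}"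
      then have "snd z \<le> fst z" by simp
      from has_derivative_continuous[OF \<Psi>_der[OF this]] show "isCont \<Psi> z" .
    qed
    show "(S (fst (\<Psi> z)) (snd (\<Psi> z)), snd (\<Psi> z)) = z" if "z \<in> {z. snd z < fst z}" for z
      using that S_F[of "snd z" "fst z"] by (simp add: \<Psi>_def)
    show "(\<Psi> has_derivative (\<lambda>(ds, dy). (Fs s y * ds - b (W s y) * dy, dy))) (at (s, y))"
      using \<Psi>_der[of "(s, y)"] s by simp
    have "Fs s y > 0" using Fs_lower[of y s] s b_min(2) by simp
    then show "(\<lambda>(ds, dy). (Fs s y * ds - b (W s y) * dy, dy)) \<circ> (\<lambda>(dt, dy). ((dt + b (W s y) * dy) / Fs s y, dy)) = id"
      by (auto simp: fun_eq_iff)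
  qed (use s in auto)
  then show ?thesis using s by (simp add: \<Psi>_def)
qed

lemma w_gradient:
  assumes "0 < fst z"
  shows "has_gradient w (wt z) (wx z) z"
proof -
  obtain t y where z: "z = (t, y)" by (cases z)
  then have t: "0 < t" using assms by simp
  define s where "s = S t y"
  have s: "y \<le> s" using S_props[of t y] t by (auto simp: s_def)
  have "((\<lambda>z. W (fst z) (snd z)) has_derivative (\<lambda>(ds, dy). Ws s y * ds + h (W s y) * dy)) (at (S (fst (t, y)) (snd (t, y)), snd (t, y)))"
    using W_gradient[OF s] by (simp add: s_def)
  from has_derivative_compose[OF S_derivative[OF t] this]
  have "(w has_derivative (\<lambda>x. case case x of (dt, dy) \<Rightarrow> ((dt + b (W s y) * dy) / Fs s y, dy) of (ds, dy) \<Rightarrow> Ws s y * ds + h (W s y) * dy)) (at (t, y))"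
    by (simp add: w_def[abs_def] s_def)
  then show ?thesis
    unfolding z by (rule has_derivative_eq_rhs)
      (auto simp: fun_eq_iff wx_def wt_def w_def s_def add_divide_distrib algebra_simps)
qed

text \<open>At t = 0 the foot lies on the boundary of the set y < s, out of reach of the inverse
  function theorem; there continuity follows by squeezing, since the foot is at distance at most 2 t
  / bmin from y.\<close>

lemma S_continuous: "continuous_on ({0..} \<times> UNIV) (\<lambda>z. S (fst z) (snd z))"
  unfolding continuous_on_eq_continuous_within
proof
  fix z :: "real \<times> real" assume z: "z \<in> {0..} \<times> UNIV"
  obtain t y where ty: "z = (t, y)" by (cases z)
  show "continuous (at z within {0..} \<times> UNIV) (\<lambda>z. S (fst z) (snd z))"
  proof (cases "t = 0")
    case False
    then have "0 < t" using z ty by simp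
    from has_derivative_continuous[OF S_derivative[OF this, of y]]
    have "isCont (\<lambda>z. fst (S (fst z) (snd z), snd z)) z" unfolding ty by (intro continuous_fst)
    then show ?thesis using continuous_at_imp_continuous_at_within by simp
  next
    case True
    have S0: "S 0 y = y" using S_props[of 0 y] by simp
    have "((\<lambda>z'. S (fst z') (snd z') - y) \<longlongrightarrow> 0) (at z within {0..} \<times> UNIV)"
    proof (rule Lim_null_comparison)
      show "\<forall>\<^sub>F z' in at z within {0..} \<times> UNIV. norm (S (fst z') (snd z') - y) \<le> 2 * fst z' / bmin + \<bar>snd z' - y\<bar>"
        unfolding eventually_at
      proof (intro exI[of _ 1] conjI ballI impI)
        fix z' :: "real \<times> real" assume "z' \<in> {0..} \<times> UNIV"
        then have "0 \<le> fst z'" by auto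
        from S_props(1,3)[OF this, of "snd z'"]
        show "norm (S (fst z') (snd z') - y) \<le> 2 * fst z' / bmin + \<bar>snd z' - y\<bar>" by auto
      qed auto
      have "isCont (\<lambda>z'. 2 * fst z' / bmin + \<bar>snd z' - y\<bar>) z"
        by (intro continuous_intros) (use b_min(2) in auto)
      then have "((\<lambda>z'. 2 * fst z' / bmin + \<bar>snd z' - y\<bar>) \<longlongrightarrow> 2 * fst z / bmin + \<bar>snd z - y\<bar>) (at z)"
        by (simp add: isCont_def)
      then show "((\<lambda>z'. 2 * fst z' / bmin + \<bar>snd z' - y\<bar>) \<longlongrightarrow> 0) (at z within {0..} \<times> UNIV)"
        using True ty by (auto intro: tendsto_within_subset)
    qed
    then have "((\<lambda>z'. S (fst z') (snd z')) \<longlongrightarrow> y) (at z within {0..} \<times> UNIV)"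
      by (rule LIM_zero_cancel)
    then show ?thesis using True ty S0 by (simp add: continuous_within)
  qed
qed

abbreviation "foot z \<equiv> (S (fst z) (snd z), snd z)"

lemma compose_foot:
  assumes "continuous_on {z. snd z \<le> fst z} (\<lambda>z. c (fst z) (snd z))"
  shows "continuous_on ({0..} \<times> UNIV) (\<lambda>z. c (S (fst z) (snd z)) (snd z))"
proof -
  have "continuous_on ({0..} \<times> UNIV) (\<lambda>z. foot z)"
    by (intro continuous_on_Pair S_continuous continuous_intros)
  moreover have "foot ` ({0..} \<times> UNIV) \<subseteq> {z. snd z \<le> fst z}" using S_props(1) by auto
  ultimately show ?thesis using continuous_on_compose2[OF assms] by fastforce
qed

lemma W_continuous: "continuous_on {z. snd z \<le> fst z} (\<lambda>z. W (fst z) (snd z))"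
proof (intro continuous_at_imp_continuous_on ballI)
  fix z :: "real \<times> real" assume "z \<in> {z. snd z \<le> fst z}"
  then have "snd z \<le> fst z" by simp
  from has_derivative_continuous[OF W_gradient[OF this]] show "isCont (\<lambda>z. W (fst z) (snd z)) z" by simp
qed

lemma compose_dom:
  assumes "\<And>w. um - \<eta> < w \<Longrightarrow> w < up \<Longrightarrow> isCont c w" "continuous_on A v" "\<And>z. z \<in> A \<Longrightarrow> um - \<eta> < v z \<and> v z < up"
  shows "continuous_on A (\<lambda>z. c (v z))"
proof -
  have "continuous_on {um - \<eta><..<up} c" using assms(1) by (intro continuous_at_imp_continuous_on) auto
  moreover have "v ` A \<subseteq> {um - \<eta><..<up}" using assms(3) by auto
  ultimately show ?thesis by (rule continuous_on_compose2[OF _ assms(2)])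
qed

lemma w0_fst_continuous: "continuous_on A (\<lambda>z. w0 (fst z))" "continuous_on A (\<lambda>z. w0' (fst z))" for A :: "(real \<times> real) set"
proof -
  have "continuous_on UNIV w0" using w0(1) by (meson DERIV_isCont continuous_at_imp_continuous_on)
  then show "continuous_on A (\<lambda>z. w0 (fst z))" by (rule continuous_on_compose2) (auto intro: continuous_intros)
  show "continuous_on A (\<lambda>z. w0' (fst z))" by (rule continuous_on_compose2[OF w0(2)]) (auto intro: continuous_intros)
qed

lemma coefficients_continuous:
  "continuous_on {z. snd z \<le> fst z} (\<lambda>z. Ws (fst z) (snd z))"
  "continuous_on {z. snd z \<le> fst z} (\<lambda>z. Fs (fst z) (snd z))"
proof -
  let ?A = "{z :: real \<times> real. snd z \<le> fst z}"
  have W: "um - \<eta> < W (fst z) (snd z) \<and> W (fst z) (snd z) < up" if "z \<in> ?A" for z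
    using W_dom[of "snd z" "fst z"] that by simp
  have w0d: "um - \<eta> < w0 (fst z) \<and> w0 (fst z) < up" for z :: "real \<times> real" using w0_dom by simp
  have e0: "continuous_on ?A (\<lambda>z. e0 (fst z))"
    unfolding e0_def by (intro continuous_on_diff w0_fst_continuous compose_dom[OF h_cont w0_fst_continuous(1)] w0d)
  have H'W: "continuous_on ?A (\<lambda>z. H' (W (fst z) (snd z)))" by (rule compose_dom[OF H(2) W_continuous W])
  have H'0: "H' (W (fst z) (snd z)) \<noteq> 0" if "z \<in> ?A" for z using H(4) W[OF that] by (metis less_irrefl)
  have H'w0: "continuous_on ?A (\<lambda>z. H' (w0 (fst z)))" by (rule compose_dom[OF H(2) w0_fst_continuous(1) w0d])
  have ex: "continuous_on ?A (\<lambda>z. exp (- \<mu> * fst z))" "continuous_on ?A (\<lambda>z. exp (\<mu> * snd z))"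
    by (intro continuous_intros)+
  have q': "continuous_on ?A (\<lambda>z. q' (fst z))"
    unfolding q'_def by (intro continuous_on_mult H'w0 ex e0)
  show Ws: "continuous_on ?A (\<lambda>z. Ws (fst z) (snd z))"
    unfolding Ws_def by (intro continuous_on_divide continuous_on_mult q' ex H'W ballI H'0)
  show "continuous_on ?A (\<lambda>z. Fs (fst z) (snd z))"
    unfolding Fs_def
    by (intro continuous_on_diff continuous_on_add continuous_on_mult e0 Ws compose_dom[OF b_cont w0_fst_continuous(1)]
        compose_dom[OF \<beta>(2) w0_fst_continuous(1)] compose_dom[OF \<beta>(2) W_continuous W] w0d)
qed

lemma w_dom: "0 \<le> fst z \<Longrightarrow> um - \<eta> / 2 \<le> w z" "0 \<le> fst z \<Longrightarrow> w z < up" "0 \<le> fst z \<Longrightarrow> um - \<eta> < w z"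
  using W_dom[OF S_props(1)] by (auto simp: w_def)

lemma w_continuous:
  "continuous_on ({0..} \<times> UNIV) w" "continuous_on ({0..} \<times> UNIV) wt" "continuous_on ({0..} \<times> UNIV) wx"
proof -
  show w: "continuous_on ({0..} \<times> UNIV) w"
    unfolding w_def[abs_def] by (rule compose_foot[OF W_continuous])
  have "Fs (S (fst z) (snd z)) (snd z) \<noteq> 0" if "z \<in> {0..} \<times> UNIV" for z
    using Fs_lower[OF S_props(1), of "fst z" "snd z"] that b_min(2) by auto
  then show wt: "continuous_on ({0..} \<times> UNIV) wt"
    unfolding wt_def[abs_def]
    by (intro continuous_on_divide compose_foot coefficients_continuous) auto
  show "continuous_on ({0..} \<times> UNIV) wx"
    unfolding wx_def[abs_def] using w_dom
    by (intro continuous_on_add continuous_on_mult wt compose_dom[OF h_cont w] compose_dom[OF b_cont w]) auto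
qed

lemma w_C1: "C1_half_plane w wt wx"
  unfolding C1_half_plane_def
proof (intro conjI allI impI)
  show "has_gradient w (wt z) (wx z) z" if "0 < fst z" for z by (rule w_gradient[OF that])
  show "continuous_on ({0<..} \<times> UNIV) wt" by (rule continuous_on_subset[OF w_continuous(2)]) auto
  show "continuous_on ({0<..} \<times> UNIV) wx" by (rule continuous_on_subset[OF w_continuous(3)]) auto
qed

lemma w_initial: "w (0, y) = w0 y"
  using S_props[of 0 y] W_diag[of y] by (simp add: w_def)

lemma wt_bound:
  assumes "0 \<le> fst z"
  shows "\<bar>wt z\<bar> \<le> 2 / bmin * (C * C * (1 + Lh)) * E * (exp (2 * C * \<omega>) * exp (- \<kappa> * max (snd z) 0 - \<omega> * fst z))"
proof -
  define s where "s = S (fst z) (snd z)"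
  have s: "snd z \<le> s" using S_props[OF assms] by (simp add: s_def)
  have Fs: "bmin / 2 \<le> Fs s (snd z)" by (rule Fs_lower[OF s])
  then have "\<bar>wt z\<bar> \<le> \<bar>Ws s (snd z)\<bar> / (bmin / 2)"
    using b_min(2) by (simp add: wt_def s_def[symmetric] abs_div del: divide_divide_eq_right) (intro divide_left_mono; simp)
  also have "\<dots> \<le> (C * C * (1 + Lh) * E * (exp (2 * C * \<omega>) * exp (- \<kappa> * max (snd z) 0 - \<omega> * fst z))) / (bmin / 2)"
    using b_min(2) C(1) h_lip(2) E(1) X_decay[OF assms, of "snd z"]
    by (intro divide_right_mono order_trans[OF Ws_bound[OF s]] mult_left_mono) (auto simp: s_def)
  finally show ?thesis by (simp add: field_simps)
qed

lemma w_bound: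
  assumes "0 \<le> fst z"
  shows "\<bar>w z - U (snd z)\<bar> \<le> C * C * E * (exp (2 * C * \<omega>) * exp (- \<kappa> * max (snd z) 0 - \<omega> * fst z))"
  unfolding w_def
  by (rule order_trans[OF W_bound[OF S_props(1)[OF assms]] mult_left_mono[OF X_decay[OF assms]]])
    (use C(1) E(1) in simp)

text \<open>The profile satisfies \<open>wx = h (w) + b (w) * wt\<close> with zero time derivative,
  so the difference is a Lipschitz term in w - U plus b times \<open>wt\<close>; both decay.\<close>

lemma wx_bound:
  assumes "0 \<le> fst z" "b (w z) \<le> Bmax" "0 \<le> Bmax"
  shows "\<bar>wx z - h (U (snd z))\<bar> \<le> (Lh * (C * C) + Bmax * (2 / bmin * (C * C * (1 + Lh)))) * E
    * (exp (2 * C * \<omega>) * exp (- \<kappa> * max (snd z) 0 - \<omega> * fst z))"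
proof -
  define e where "e = exp (2 * C * \<omega>) * exp (- \<kappa> * max (snd z) 0 - \<omega> * fst z)"
  have bw: "0 \<le> b (w z)" using b_min(1)[OF w_dom(1)[OF assms(1)] w_dom(2)[OF assms(1)]] b_min(2) by simp
  have "\<bar>h (w z) - h (U (snd z))\<bar> \<le> Lh * \<bar>w z - U (snd z)\<bar>"
    using w_dom[OF assms(1)] good_dom[OF good_U[of "snd z"]] by (intro h_lip) auto
  also have "\<dots> \<le> Lh * (C * C * E * e)"
    unfolding e_def by (intro mult_left_mono w_bound assms h_lip)
  finally have 1: "\<bar>h (w z) - h (U (snd z))\<bar> \<le> Lh * (C * C * E * e)" .
  have "\<bar>b (w z) * wt z\<bar> \<le> Bmax * (2 / bmin * (C * C * (1 + Lh)) * E * e)"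
    unfolding abs_mult e_def using bw assms by (intro mult_mono wt_bound) auto
  with 1 have "\<bar>wx z - h (U (snd z))\<bar> \<le> Lh * (C * C * E * e) + Bmax * (2 / bmin * (C * C * (1 + Lh)) * E * e)"
    unfolding wx_def by linarith
  then show ?thesis unfolding e_def by (simp add: algebra_simps)
qed

end

subsection \<open>Noncharacteristic traveling waves\<close>

lemma bounded_of_limits:
  fixes p :: "real \<Rightarrow> real"
  assumes "continuous_on UNIV p" "(p \<longlongrightarrow> l1) at_bot" "(p \<longlongrightarrow> l2) at_top"
  shows "\<exists>M. \<forall>x. \<bar>p x\<bar> \<le> M"
proof -
  obtain x1 where x1: "\<And>x. x \<le> x1 \<Longrightarrow> dist (p x) l1 < 1"
    using tendstoD[OF assms(2), of 1] unfolding eventually_at_bot_linorder by auto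
  obtain x2 where x2: "\<And>x. x2 \<le> x \<Longrightarrow> dist (p x) l2 < 1"
    using tendstoD[OF assms(3), of 1] unfolding eventually_at_top_linorder by auto
  obtain B where B: "\<And>w. x1 \<le> w \<Longrightarrow> w \<le> x2 \<Longrightarrow> \<bar>p w\<bar> \<le> B"
    using bounded_on_Icc[of x1 x2 p] assms(1) unfolding continuous_on_eq_continuous_at[OF open_UNIV] by blast
  have "\<bar>p x\<bar> \<le> \<bar>B\<bar> + \<bar>l1\<bar> + \<bar>l2\<bar> + 1" for x
  proof -
    consider "x \<le> x1" | "x2 \<le> x" | "x1 \<le> x" "x \<le> x2" by linarith
    then show ?thesis
    proof cases
      case 1
      then show ?thesis using x1[of x] by (simp add: dist_real_def)
    next
      case 2
      then show ?thesis using x2[of x] by (simp add: dist_real_def)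
    next
      case 3
      then show ?thesis using B[of x] by linarith
    qed
  qed
  then show ?thesis by blast
qed

text \<open>Gronwall in the form of a monotone quantity: exp (k x) times the square of U - c is
  nonincreasing to the right of \<open>x0\<close> for k = - 2 L, nondecreasing to its left for k = 2
  L, and zero at \<open>x0\<close>.\<close>

lemma ode_constant:
  fixes U U' :: "real \<Rightarrow> real"
  assumes U: "\<And>x. (U has_real_derivative U' x) (at x)" "\<And>x. \<bar>U' x\<bar> \<le> L * \<bar>U x - c\<bar>" and c: "U x0 = c"
  shows "U x = c"
proof -
  have est: "\<bar>(U x - c) * U' x\<bar> \<le> L * (U x - c)\<^sup>2" for x
    using mult_left_mono[OF U(2)[of x] abs_ge_zero[of "U x - c"]]
    by (simp add: abs_mult power2_eq_square mult.left_commute)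
  have der: "((\<lambda>x. exp (k * x) * (U x - c)\<^sup>2) has_real_derivative exp (k * x) * (k * (U x - c)\<^sup>2 + 2 * ((U x - c) * U' x))) (at x)" for k x
    by (rule derivative_eq_intros U(1) refl | simp add: algebra_simps)+
  have "exp (k * x) * (U x - c)\<^sup>2 \<le> 0" if k: "(k = - 2 * L \<and> x0 \<le> x) \<or> (k = 2 * L \<and> x \<le> x0)" for k
    using k
  proof (elim disjE conjE)
    assume k: "k = - 2 * L" "x0 \<le> x"
    have "exp (k * x) * (U x - c)\<^sup>2 \<le> exp (k * x0) * (U x0 - c)\<^sup>2"
    proof (rule DERIV_nonpos_imp_nonincreasing[OF k(2)])
      fix r
      have "k * (U r - c)\<^sup>2 + 2 * ((U r - c) * U' r) \<le> 0" using est[of r] unfolding k by linarith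
      then show "\<exists>y. ((\<lambda>x. exp (k * x) * (U x - c)\<^sup>2) has_real_derivative y) (at r) \<and> y \<le> 0"
        by (intro exI[of _ "exp (k * r) * (k * (U r - c)\<^sup>2 + 2 * ((U r - c) * U' r))"] conjI der mult_nonneg_nonpos) simp_all
    qed
    then show ?thesis by (simp add: c)
  next
    assume k: "k = 2 * L" "x \<le> x0"
    have "exp (k * x) * (U x - c)\<^sup>2 \<le> exp (k * x0) * (U x0 - c)\<^sup>2"
    proof (rule DERIV_nonneg_imp_nondecreasing[OF k(2)])
      fix r
      have "k * (U r - c)\<^sup>2 + 2 * ((U r - c) * U' r) \<ge> 0" using est[of r] unfolding k by linarith
      then show "\<exists>y. ((\<lambda>x. exp (k * x) * (U x - c)\<^sup>2) has_real_derivative y) (at r) \<and> 0 \<le> y"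
        by (intro exI[of _ "exp (k * r) * (k * (U r - c)\<^sup>2 + 2 * ((U r - c) * U' r))"] conjI der mult_nonneg_nonneg) simp_all
    qed
    then show ?thesis by (simp add: c)
  qed
  moreover have "x0 \<le> x \<or> x \<le> x0" by linarith
  ultimately have "\<exists>k. exp (k * x) * (U x - c)\<^sup>2 \<le> 0" by blast
  then show ?thesis by (auto simp: mult_le_0_iff)
qed

text \<open>By l'Hospital U x / x has the same limit as \<open>U'\<close>, while it tends to 0
  because \<open>U\<close> converges.\<close>

lemma limit_of_derivative_zero:
  fixes U U' :: "real \<Rightarrow> real"
  assumes "\<And>x. (U has_real_derivative U' x) (at x)" "(U \<longlongrightarrow> l) at_top" "(U' \<longlongrightarrow> k) at_top"
  shows "k = 0"
proof -
  have "((\<lambda>x. U x / x) \<longlongrightarrow> k) at_top"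
    by (rule lhospital_at_top_at_top[where f' = U' and g' = "\<lambda>_. 1"])
      (use assms in \<open>auto intro: filterlim_ident\<close>)
  moreover have "((\<lambda>x. U x / x) \<longlongrightarrow> 0) at_top"
    by (rule tendsto_divide_0[OF assms(2)]) (auto intro: filterlim_at_top_imp_at_infinity filterlim_ident)
  ultimately show ?thesis using tendsto_unique trivial_limit_at_top_linorder by blast
qed

section \<open>Sign and monotonicity of the profile\<close>

text \<open>The data are listed in a form that the reflection u to -u preserves, so that decreasing
  waves become instances of increasing ones.\<close>

locale profile_setting =
  fixes a a' a'' g g' g'' U U' :: "real \<Rightarrow> real" and um up :: real
  assumes a: "\<And>v. (a has_real_derivative a' v) (at v)" "\<And>v. (a' has_real_derivative a'' v) (at v)"
    and g: "\<And>v. (g has_real_derivative g' v) (at v)" "\<And>v. (g' has_real_derivative g'' v) (at v)"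
    and U: "\<And>x. (U has_real_derivative U' x) (at x)" "continuous_on UNIV U'"
    and ode: "\<And>x. a (U x) * U' x = g (U x)"
    and lim: "(U \<longlongrightarrow> um) at_bot" "(U \<longlongrightarrow> up) at_top"
    and nonchar: "\<And>x. a (U x) \<noteq> 0" "a um \<noteq> 0" "a up \<noteq> 0"
    and stable: "g' um < 0" "0 < g' up"
begin

lemma conts: "isCont a v" "isCont a' v" "isCont g v" "isCont g' v" "isCont U x"
  by (rule DERIV_isCont[OF a(1)] DERIV_isCont[OF a(2)] DERIV_isCont[OF g(1)] DERIV_isCont[OF g(2)] DERIV_isCont[OF U(1)])+

lemma U_cont: "continuous_on UNIV U"
  using conts(5) by (intro continuous_at_imp_continuous_on) auto

lemma U'_eq: "U' x = g (U x) / a (U x)"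
  using ode[of x] nonchar(1)[of x] by (simp add: field_simps)

lemma U'_lim: "(U' \<longlongrightarrow> g um / a um) at_bot" "(U' \<longlongrightarrow> g up / a up) at_top"
  unfolding U'_eq[abs_def]
  by (intro tendsto_divide isCont_tendsto_compose[OF conts(3)] isCont_tendsto_compose[OF conts(1)] lim nonchar)+

lemma U_bounded: "\<exists>M. \<forall>x. \<bar>U x\<bar> \<le> M" "\<exists>M. \<forall>x. \<bar>U' x\<bar> \<le> M"
  by (rule bounded_of_limits[OF U_cont lim], rule bounded_of_limits[OF U(2) U'_lim])

lemma g_zero: "g um = 0" "g up = 0"
proof -
  have "g up / a up = 0" by (rule limit_of_derivative_zero[OF U(1) lim(2) U'_lim(2)])
  then show "g up = 0" using nonchar by simp
  have "- (g um / a um) = 0"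
  proof (rule limit_of_derivative_zero[of "\<lambda>x. U (- x)" "\<lambda>x. - U' (- x)" um])
    show "((\<lambda>x. U (- x)) has_real_derivative - U' (- x)) (at x)" for x
      by (rule DERIV_cong[OF DERIV_chain2[OF U(1)]]) (auto intro!: derivative_eq_intros)
    show "((\<lambda>x. U (- x)) \<longlongrightarrow> um) at_top" by (rule filterlim_compose[OF lim(1) filterlim_uminus_at_bot_at_top])
    show "((\<lambda>x. - U' (- x)) \<longlongrightarrow> - (g um / a um)) at_top"
      by (intro tendsto_minus filterlim_compose[OF U'_lim(1) filterlim_uminus_at_bot_at_top])
  qed
  then show "g um = 0" using nonchar by simp
qed

lemma ends_ne: "um \<noteq> up"
  using stable by auto

text \<open>A zero of \<open>U'\<close> is a point where \<open>U\<close> takes a zero of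
  \<open>g\<close> as its value. Uniqueness for the profile equation would make \<open>U\<close>
  constant, against the endstates being distinct.\<close>

lemma U'_ne: "U' x \<noteq> 0"
proof
  assume "U' x = 0"
  then have gc: "g (U x) = 0" using ode[of x] by simp
  obtain M where M: "\<And>y. \<bar>U y\<bar> \<le> M" using U_bounded by blast
  have "continuous_on UNIV g'" using conts(4) by (intro continuous_at_imp_continuous_on) auto
  from Lipschitz_bound_exists[OF g(1) this, of "- M" M] obtain L where L: "0 \<le> L"
    "\<And>v w. v \<in> {-M..M} \<Longrightarrow> w \<in> {-M..M} \<Longrightarrow> \<bar>g v - g w\<bar> \<le> L * \<bar>v - w\<bar>" by blast
  have mem: "U y \<in> {-M..M}" for y using M[of y] by (auto simp: abs_le_iff)
  have "((\<lambda>y. 1 / a (U y)) \<longlongrightarrow> 1 / a um) at_bot" "((\<lambda>y. 1 / a (U y)) \<longlongrightarrow> 1 / a up) at_top"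
    by (intro tendsto_divide tendsto_const isCont_tendsto_compose[OF conts(1)] lim nonchar)+
  moreover have "continuous_on UNIV (\<lambda>y. 1 / a (U y))"
    by (intro continuous_at_imp_continuous_on ballI isCont_divide continuous_const isCont_o2[OF conts(5) conts(1)] nonchar)
  ultimately obtain A where A: "\<And>y. \<bar>1 / a (U y)\<bar> \<le> A" using bounded_of_limits by blast
  have "\<bar>U' y\<bar> \<le> (A * L) * \<bar>U y - U x\<bar>" for y
  proof -
    have "\<bar>U' y\<bar> = \<bar>1 / a (U y)\<bar> * \<bar>g (U y) - g (U x)\<bar>" unfolding U'_eq gc by (simp add: abs_divide)
    also have "\<dots> \<le> A * (L * \<bar>U y - U x\<bar>)"
      using order_trans[OF abs_ge_zero A[of y]] by (intro mult_mono L(2) mem A) auto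
    finally show ?thesis by simp
  qed
  then have const: "U y = U x" for y by (rule ode_constant[OF U(1) _ refl])
  have "(U \<longlongrightarrow> U x) G" for G
    by (rule Lim_transform_eventually[OF tendsto_const]) (rule always_eventually, rule allI, rule const[symmetric])
  then have "um = U x" "up = U x"
    by (rule tendsto_unique[OF trivial_limit_at_bot_linorder lim(1)], rule tendsto_unique[OF trivial_limit_at_top_linorder lim(2)])
  then show False using ends_ne by simp
qed

end

locale increasing_profile = profile_setting +
  assumes ends_less: "um < up"
begin

lemma U'_pos: "0 < U' x"
proof (rule ccontr)
  assume "\<not> 0 < U' x"
  then have neg: "U' x < 0" using U'_ne[of x] by linarith
  have all: "U' y < 0" for y
  proof (rule ccontr)
    assume "\<not> U' y < 0"
    then have y: "0 < U' y" using U'_ne[of y] by linarith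
    have "connected (range U')" by (rule connected_continuous_image[OF U(2) connected_UNIV])
    then have "0 \<in> range U'" using neg y connectedD_interval[of "range U'" "U' x" "U' y" 0] by auto
    then show False using U'_ne by auto
  qed
  have dec: "U y \<le> U x" if "x \<le> y" for x y
    by (rule DERIV_nonpos_imp_nonincreasing[OF that]) (use U(1) all less_imp_le in blast)
  have "\<forall>\<^sub>F y in at_top. U y \<le> U 0" using eventually_ge_at_top[of 0] by eventually_elim (rule dec)
  then have 1: "up \<le> U 0" by (rule tendsto_upperbound[OF lim(2)]) simp
  have "\<forall>\<^sub>F y in at_bot. U 0 \<le> U y" using eventually_le_at_bot[of 0] by eventually_elim (rule dec)
  then have "U 0 \<le> um" by (rule tendsto_lowerbound[OF lim(1)]) simp
  then show False using 1 ends_less by linarith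
qed

lemma U_less: "x < y \<Longrightarrow> U x < U y"
  by (rule less_of_positive_deriv[of x y U U']) (use U(1) U'_pos in auto)

lemma U_range: "um < U y" "U y < up"
proof -
  have "\<forall>\<^sub>F x in at_top. U (y + 1) \<le> U x"
    using eventually_ge_at_top[of "y + 1"] by eventually_elim (metis U_less less_eq_real_def)
  then have "U (y + 1) \<le> up" by (rule tendsto_lowerbound[OF lim(2)]) simp
  then show "U y < up" using U_less[of y "y + 1"] by simp
  have "\<forall>\<^sub>F x in at_bot. U x \<le> U (y - 1)"
    using eventually_le_at_bot[of "y - 1"] by eventually_elim (metis U_less less_eq_real_def)
  then have "um \<le> U (y - 1)" by (rule tendsto_upperbound[OF lim(1)]) simp
  then show "um < U y" using U_less[of "y - 1" y] by simp
qed

lemma U_onto: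
  assumes "um < w" "w < up"
  shows "\<exists>z. w = U z"
proof -
  have "\<forall>\<^sub>F x in at_bot. U x < w" using order_tendstoD(2)[OF lim(1) assms(1)] .
  then obtain x1 where x1: "U x1 < w" by (metis eventually_happens trivial_limit_at_bot_linorder)
  have "\<forall>\<^sub>F x in at_top. w < U x" using order_tendstoD(1)[OF lim(2) assms(2)] .
  then obtain x2 where x2: "w < U x2" by (metis eventually_happens trivial_limit_at_top_linorder)
  have "connected (range U)" by (rule connected_continuous_image[OF U_cont connected_UNIV])
  then have "w \<in> range U" using x1 x2 connectedD_interval[of "range U" "U x1" "U x2" w] by auto
  then show ?thesis by auto
qed

lemma a_ne: "um \<le> w \<Longrightarrow> w \<le> up \<Longrightarrow> a w \<noteq> 0"
  using U_onto[of w] nonchar by (cases "w = um"; cases "w = up"; auto)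

text \<open>\<open>a\<close> does not vanish on [um, up], hence has one sign there. A positive sign
  is impossible: g up = 0 and g' up > 0 make \<open>g\<close> negative just below \<open>up\<close>,
  whereas g (U x) = a (U x) U' x with \<open>U'\<close> positive.\<close>

lemma a_neg: "um \<le> w \<Longrightarrow> w \<le> up \<Longrightarrow> a w < 0"
proof (rule ccontr)
  assume w: "um \<le> w" "w \<le> up" "\<not> a w < 0"
  then have pos: "0 < a w" using a_ne[of w] by linarith
  have conn: "connected (a ` {um..up})"
    by (intro connected_continuous_image continuous_at_imp_continuous_on ballI conts connected_Icc)
  have all: "0 < a v" if v: "um \<le> v" "v \<le> up" for v
  proof (rule ccontr)
    assume "\<not> 0 < a v"
    then have "a v < 0" using a_ne[OF v] by linarith
    then have "0 \<in> a ` {um..up}"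
      using connectedD_interval[OF conn, of "a v" "a w" 0] v w pos by auto
    then show False using a_ne by auto
  qed
  obtain d where d: "d > 0" "\<And>e. 0 < e \<Longrightarrow> e < d \<Longrightarrow> g (up - e) < g up"
    using DERIV_pos_inc_left[OF g(1) stable(2)] by blast
  have "\<forall>\<^sub>F x in at_top. up - d < U x" by (rule order_tendstoD(1)[OF lim(2)]) (use d(1) in simp)
  then obtain z where z: "up - d < U z" by (metis eventually_happens trivial_limit_at_top_linorder)
  have "g (U z) < 0" using d(2)[of "up - U z"] U_range[of z] z g_zero by simp
  moreover have "0 < a (U z) * U' z" using all[of "U z"] U_range[of z] U'_pos[of z] by simp
  ultimately show False using ode[of z] by simp
qed

lemma g_neg: "um < w \<Longrightarrow> w < up \<Longrightarrow> g w < 0"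
proof -
  assume "um < w" "w < up"
  then obtain z where z: "w = U z" using U_onto by blast
  have "a (U z) * U' z < 0" using a_neg[of "U z"] U_range[of z] U'_pos[of z] by (simp add: mult_neg_pos)
  then show ?thesis using ode z by simp
qed

text \<open>The vector field is linearized at each endstate from both sides, so signs are needed
  slightly beyond [um, up]; those of \<open>g\<close> there follow from its derivatives at its zeros
  \<open>um\<close> and \<open>up\<close>.\<close>

lemma neighborhood: "\<exists>\<eta>>0. (\<forall>w. um - \<eta> < w \<and> w < up + \<eta> \<longrightarrow> a w < 0) \<and>
  (\<forall>w. um - \<eta> < w \<and> w < um \<longrightarrow> 0 < g w) \<and> (\<forall>w. up < w \<and> w < up + \<eta> \<longrightarrow> 0 < g w)"
proof -
  have near: "\<exists>d>0. \<forall>w. \<bar>w - c\<bar> < d \<longrightarrow> a w < 0" if "a c < 0" for c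
  proof -
    have "open {w. a w < 0}"
      by (intro open_Collect_less continuous_at_imp_continuous_on ballI conts continuous_on_const)
    then have "\<exists>d>0. ball c d \<subseteq> {w. a w < 0}" using that by (simp add: open_contains_ball)
    then show ?thesis by (auto simp: subset_iff dist_real_def abs_minus_commute)
  qed
  obtain d1 where d1: "d1 > 0" "\<And>w. \<bar>w - um\<bar> < d1 \<Longrightarrow> a w < 0" using near[OF a_neg[of um]] ends_less by auto
  obtain d2 where d2: "d2 > 0" "\<And>w. \<bar>w - up\<bar> < d2 \<Longrightarrow> a w < 0" using near[OF a_neg[of up]] ends_less by auto
  obtain d3 where d3: "d3 > 0" "\<And>e. 0 < e \<Longrightarrow> e < d3 \<Longrightarrow> g um < g (um - e)"
    using DERIV_neg_dec_left[OF g(1) stable(1)] by blast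
  obtain d4 where d4: "d4 > 0" "\<And>e. 0 < e \<Longrightarrow> e < d4 \<Longrightarrow> g up < g (up + e)"
    using DERIV_pos_inc_right[OF g(1) stable(2)] by blast
  define \<eta> where "\<eta> = Min {d1, d2, d3, d4}"
  have \<eta>: "0 < \<eta>" "\<eta> \<le> d1" "\<eta> \<le> d2" "\<eta> \<le> d3" "\<eta> \<le> d4" using d1(1) d2(1) d3(1) d4(1) by (auto simp: \<eta>_def)
  have "a w < 0" if "um - \<eta> < w" "w < up + \<eta>" for w
  proof -
    consider "w < um" | "up < w" | "um \<le> w" "w \<le> up" by linarith
    then show ?thesis
    proof cases
      case 1
      then show ?thesis using that \<eta> by (intro d1(2)) auto
    next
      case 2
      then show ?thesis using that \<eta> by (intro d2(2)) auto
    qed (rule a_neg)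
  qed
  moreover have "0 < g w" if "um - \<eta> < w" "w < um" for w
    using d3(2)[of "um - w"] that \<eta> g_zero by simp
  moreover have "0 < g w" if "up < w" "w < up + \<eta>" for w
    using d4(2)[of "w - up"] that \<eta> g_zero by simp
  ultimately show ?thesis using \<eta>(1) by blast
qed

end

section \<open>Stability in the frame of the wave, up to reflection\<close>

text \<open>Stated for C1 solutions in the frame of the wave and without entropies: in this form the
  reflection u to -u carries it over directly, and the weight does not move.\<close>

definition perturbations_decay ::
  "(real \<Rightarrow> real) \<Rightarrow> (real \<Rightarrow> real) \<Rightarrow> (real \<Rightarrow> real) \<Rightarrow> (real \<Rightarrow> real) \<Rightarrow> real \<Rightarrow> real \<Rightarrow> real \<Rightarrow> real \<Rightarrow> bool" where
  "perturbations_decay a g U U' \<kappa> \<omega> C \<delta> \<longleftrightarrow> (\<forall>u0 u0' E.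
     (\<forall>y. (u0 has_real_derivative u0' y) (at y)) \<and> continuous_on UNIV u0' \<and> 0 \<le> E \<and> E \<le> \<delta> \<and>
     (\<forall>y. \<bar>u0 y - U y\<bar> \<le> E * exp (- \<kappa> * max y 0)) \<and> (\<forall>y. \<bar>u0' y - U' y\<bar> \<le> E * exp (- \<kappa> * max y 0)) \<longrightarrow>
     (\<exists>w wt wx. continuous_on ({0..} \<times> UNIV) w \<and> C1_half_plane w wt wx \<and> (\<forall>y. w (0, y) = u0 y) \<and>
       (\<forall>z. 0 < fst z \<longrightarrow> wt z + a (w z) * wx z = g (w z)) \<and>
       (\<forall>z. 0 \<le> fst z \<longrightarrow> \<bar>w z - U (snd z)\<bar> \<le> C * E * exp (- \<kappa> * max (snd z) 0 - \<omega> * fst z)) \<and>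
       (\<forall>z. 0 \<le> fst z \<longrightarrow> \<bar>wx z - U' (snd z)\<bar> \<le> C * E * exp (- \<kappa> * max (snd z) 0 - \<omega> * fst z))))"

lemma perturbations_decayD:
  assumes "perturbations_decay a g U U' \<kappa> \<omega> C \<delta>"
    and "\<And>y. (u0 has_real_derivative u0' y) (at y)" "continuous_on UNIV u0'" "0 \<le> E" "E \<le> \<delta>"
    and "\<And>y. \<bar>u0 y - U y\<bar> \<le> E * exp (- \<kappa> * max y 0)" "\<And>y. \<bar>u0' y - U' y\<bar> \<le> E * exp (- \<kappa> * max y 0)"
  obtains w wt wx where "continuous_on ({0..} \<times> UNIV) w" "C1_half_plane w wt wx" "\<And>y. w (0, y) = u0 y"
    "\<And>z. 0 < fst z \<Longrightarrow> wt z + a (w z) * wx z = g (w z)"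
    "\<And>z. 0 \<le> fst z \<Longrightarrow> \<bar>w z - U (snd z)\<bar> \<le> C * E * exp (- \<kappa> * max (snd z) 0 - \<omega> * fst z)"
    "\<And>z. 0 \<le> fst z \<Longrightarrow> \<bar>wx z - U' (snd z)\<bar> \<le> C * E * exp (- \<kappa> * max (snd z) 0 - \<omega> * fst z)"
proof -
  note imp = assms(1)[unfolded perturbations_decay_def, THEN spec[of _ u0], THEN spec[of _ u0'], THEN spec[of _ E], THEN mp]
  have "(\<forall>y. (u0 has_real_derivative u0' y) (at y)) \<and> continuous_on UNIV u0' \<and> 0 \<le> E \<and> E \<le> \<delta> \<and>
     (\<forall>y. \<bar>u0 y - U y\<bar> \<le> E * exp (- \<kappa> * max y 0)) \<and> (\<forall>y. \<bar>u0' y - U' y\<bar> \<le> E * exp (- \<kappa> * max y 0))"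
    by (intro conjI allI assms(2-7))
  from imp[OF this] obtain w wt wx where x: "continuous_on ({0..} \<times> UNIV) w" "C1_half_plane w wt wx" "\<forall>y. w (0, y) = u0 y"
    "\<forall>z. 0 < fst z \<longrightarrow> wt z + a (w z) * wx z = g (w z)"
    "\<forall>z. 0 \<le> fst z \<longrightarrow> \<bar>w z - U (snd z)\<bar> \<le> C * E * exp (- \<kappa> * max (snd z) 0 - \<omega> * fst z)"
    "\<forall>z. 0 \<le> fst z \<longrightarrow> \<bar>wx z - U' (snd z)\<bar> \<le> C * E * exp (- \<kappa> * max (snd z) 0 - \<omega> * fst z)"
    by (elim exE conjE)
  show ?thesis
    by (rule that[OF x(1,2) x(3)[THEN spec] x(4)[THEN spec, THEN mp] x(5)[THEN spec, THEN mp] x(6)[THEN spec, THEN mp]])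
qed

context increasing_profile
begin

lemma stable_profile_increasing:
  assumes \<kappa>: "g' up / \<bar>a up\<bar> \<le> \<kappa>"
    and \<omega>: "0 \<le> \<omega>" "\<omega> \<le> \<bar>g' um\<bar>" "\<omega> \<le> (\<kappa> - g' up / \<bar>a up\<bar>) * \<bar>a up\<bar>"
  shows "\<exists>C>0. \<exists>\<delta>>0. perturbations_decay a g U U' \<kappa> \<omega> C \<delta>"
proof -
  obtain \<eta> where \<eta>: "0 < \<eta>" "\<And>w. um - \<eta> < w \<Longrightarrow> w < up + \<eta> \<Longrightarrow> a w < 0"
    "\<And>w. um - \<eta> < w \<Longrightarrow> w < um \<Longrightarrow> 0 < g w" "\<And>w. up < w \<Longrightarrow> w < up + \<eta> \<Longrightarrow> 0 < g w"
    using neighborhood by blast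
  define h where "h w = g w / a w" for w
  define h' where "h' w = (g' w * a w - g w * a' w) / (a w * a w)" for w
  define b where "b w = - 1 / a w" for w
  define \<mu> where "\<mu> = g' um / a um"
  define \<nu> where "\<nu> = g' up / \<bar>a up\<bar>"
  have am: "a um < 0" and ap: "a up < 0" using a_neg ends_less by auto
  have pos: "0 < \<mu>" "0 < \<nu>" using am ap stable by (simp_all add: \<mu>_def \<nu>_def divide_neg_neg divide_pos_neg)
  have mem: "um - \<eta> < um" "um < up + \<eta>" "um - \<eta> < up" "up < up + \<eta>" using \<eta>(1) ends_less by auto
  have h_deriv: "(h has_real_derivative h' w) (at w)" if "um - \<eta> < w" "w < up + \<eta>" for w
    unfolding h_def[abs_def] h'_def by (rule DERIV_divide[OF g(1) a(1)]) (use \<eta>(2)[OF that] in simp)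
  have h'_deriv: "\<exists>d. (h' has_real_derivative d) (at w)" if "um - \<eta> < w" "w < up + \<eta>" for w
    unfolding h'_def[abs_def]
    by (rule exI, rule DERIV_divide[OF DERIV_diff[OF DERIV_mult[OF g(2) a(1)] DERIV_mult[OF g(1) a(2)]] DERIV_mult[OF a(1) a(1)]])
      (use \<eta>(2)[OF that] in simp)
  have b_deriv: "(b has_real_derivative a' w / (a w * a w)) (at w)" if "um - \<eta> < w" "w < up + \<eta>" for w
    unfolding b_def[abs_def] by (rule DERIV_cong[OF DERIV_divide[OF DERIV_const a(1)]]) (use \<eta>(2)[OF that] in simp_all)
  have b_cont: "isCont b w" if "um - \<eta> < w" "w < up + \<eta>" for w by (rule DERIV_isCont[OF b_deriv[OF that]])
  have b_pos: "0 < b w" if "um - \<eta> < w" "w < up + \<eta>" for w using \<eta>(2)[OF that] by (simp add: b_def divide_neg_neg)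
  obtain d1 where d1: "(h' has_real_derivative d1) (at um)" using h'_deriv[OF mem(1,2)] by blast
  obtain d2 where d2: "(h' has_real_derivative d2) (at up)" using h'_deriv[OF mem(3,4)] by blast
  have h0: "h um = 0" "h up = 0" "h' um = \<mu>" "h' up = - \<nu>"
    using am ap by (simp_all add: h_def h'_def \<mu>_def \<nu>_def g_zero field_simps)
  have h_pos: "0 < h w" if "um < w" "w < up" for w
    using g_neg[OF that] a_neg[of w] that by (simp add: h_def divide_neg_neg)
  have h_neg1: "h w < 0" if "um - \<eta> < w" "w < um" for w
    using \<eta>(3)[OF that] \<eta>(2)[of w] that ends_less \<eta>(1) by (simp add: h_def divide_pos_neg)
  have h_neg2: "h w < 0" if "up < w" "w < up + \<eta>" for w
    using \<eta>(4)[OF that] \<eta>(2)[of w] that ends_less \<eta>(1) by (simp add: h_def divide_pos_neg)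
  have hU: "h (U y) = U' y" for y by (simp add: h_def U'_eq)
  have U_deriv: "(U has_real_derivative h (U y)) (at y)" for y using U(1)[of y] by (simp add: hU)
  note pc = profile_coordinates[OF ends_less \<eta>(1) pos h_deriv d1 d2 h0 h_pos h_neg1 h_neg2 b_cont
      b_deriv[OF mem(1,2)] b_deriv[OF mem(3,4)] U_deriv U_range U_onto]
  obtain H H' \<beta> \<beta>' C where
    H: "\<And>w. um - \<eta> < w \<Longrightarrow> w < up \<Longrightarrow> (H has_real_derivative H' w) (at w)"
    "\<And>w. um - \<eta> < w \<Longrightarrow> w < up \<Longrightarrow> isCont H' w"
    "\<And>w. um - \<eta> < w \<Longrightarrow> w < up \<Longrightarrow> H' w * h w = \<mu> * H w"
    "\<And>w. um - \<eta> < w \<Longrightarrow> w < up \<Longrightarrow> 0 < H' w"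
    "H um = 0" "\<And>y. H (U y) = exp (\<mu> * y)"
    and \<beta>: "\<And>w. um - \<eta> < w \<Longrightarrow> w < up \<Longrightarrow> (\<beta> has_real_derivative \<beta>' w) (at w)"
    "\<And>w. um - \<eta> < w \<Longrightarrow> w < up \<Longrightarrow> isCont \<beta>' w"
    "\<And>w. um - \<eta> < w \<Longrightarrow> w < up \<Longrightarrow> \<beta>' w * h w = b w - b um"
    and C: "1 \<le> C"
    "\<And>y w. comparable H \<mu> (um - \<eta> / 2) up y w \<Longrightarrow> H' w \<le> C * exp ((\<mu> + \<nu>) * max y 0)"
    "\<And>y w. comparable H \<mu> (um - \<eta> / 2) up y w \<Longrightarrow> exp ((\<mu> + \<nu>) * max y 0) \<le> C * H' w"
    "\<And>y w. comparable H \<mu> (um - \<eta> / 2) up y w \<Longrightarrow> \<bar>\<beta>' w\<bar> \<le> C * exp (\<nu> * max y 0)"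
    "\<And>y w. comparable H \<mu> (um - \<eta> / 2) up y w \<Longrightarrow> \<bar>\<beta> w - (b up - b um) * max y 0\<bar> \<le> C"
    by (rule pc; (assumption | (rule that; assumption)))
  have half: "um - \<eta> < w \<and> w < up + \<eta>" if "um - \<eta> / 2 \<le> w" "w \<le> up" for w using that \<eta>(1) by auto
  obtain B where B: "0 \<le> B" "\<And>w. um - \<eta> / 2 \<le> w \<Longrightarrow> w \<le> up \<Longrightarrow> b w \<le> B" "\<And>w. um - \<eta> / 2 \<le> w \<Longrightarrow> w \<le> up \<Longrightarrow> 1 \<le> B * b w"
    using positive_bounds_on_Icc[of "um - \<eta> / 2" up b] b_cont b_pos half by blast
  have Bpos: "0 < B" using B(1) B(3)[of up] \<eta>(1) ends_less by (cases "B = 0") auto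
  have h'_cont: "continuous_on {um - \<eta> / 2..up} h'"
  proof (intro continuous_at_imp_continuous_on ballI)
    fix w assume "w \<in> {um - \<eta> / 2..up}"
    then obtain d where "(h' has_real_derivative d) (at w)" using h'_deriv half by fastforce
    then show "isCont h' w" by (rule DERIV_isCont)
  qed
  have "\<exists>L\<ge>0. \<forall>x\<in>{um - \<eta> / 2..up}. \<forall>y\<in>{um - \<eta> / 2..up}. \<bar>h x - h y\<bar> \<le> L * \<bar>x - y\<bar>"
  proof (rule Lipschitz_on_interval[of "um - \<eta> / 2" up h h'])
    show "(h has_real_derivative h' w) (at w)" if "um - \<eta> / 2 \<le> w" "w \<le> up" for w
      using h_deriv half[OF that] by blast
    fix L assume "0 \<le> L" "\<And>x y. x \<in> {um - \<eta> / 2..up} \<Longrightarrow> y \<in> {um - \<eta> / 2..up} \<Longrightarrow> \<bar>h x - h y\<bar> \<le> L * \<bar>x - y\<bar>"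
    then show ?thesis by blast
  qed (rule h'_cont)
  then obtain L where L: "0 \<le> L" "\<forall>x\<in>{um - \<eta> / 2..up}. \<forall>y\<in>{um - \<eta> / 2..up}. \<bar>h x - h y\<bar> \<le> L * \<bar>x - y\<bar>"
    by blast
  define bmin where "bmin = 1 / B"
  define D where "D = (C + C * C * C) * (1 + L)"
  have D: "0 < D" using C(1) L(1) by (simp add: D_def add_pos_pos)
  \<comment> \<open>One entry for each smallness condition on \<open>E\<close>: comparability of the
    datum, room to the left of \<open>um\<close>, and noncrossing of characteristics.\<close>
  define \<delta> where "\<delta> = min (1 / (2 * C)) (min (\<eta> / 2) (bmin / 2 / D))"
  have bmin: "0 < bmin" using Bpos by (simp add: bmin_def)
  have \<delta>: "0 < \<delta>" using C(1) \<eta>(1) bmin D by (simp add: \<delta>_def)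
  define k where "k = L * (C * C) + B * (2 / bmin * (C * C * (1 + L)))"
  have k: "0 \<le> k" using L(1) C(1) B(1) bmin by (simp add: k_def)
  \<comment> \<open>Large enough for both \<open>w_bound\<close>, with C * C, and
    \<open>wx_bound\<close>, with \<open>k\<close>; the exponential comes from the bounded error in
    the travel time.\<close>
  define A where "A = (C * C + k) * exp (2 * C * \<omega>)"
  have A: "0 < A" using C(1) k by (simp add: A_def add_pos_nonneg)
  show ?thesis
    unfolding perturbations_decay_def
  proof (rule exI[of _ A], rule conjI, rule A, rule exI[of _ \<delta>], rule conjI, rule \<delta>, intro allI impI, elim conjE)
    fix u0 u0' :: "real \<Rightarrow> real" and E
    assume u0: "\<forall>y. (u0 has_real_derivative u0' y) (at y)" "continuous_on UNIV u0'"
      and E: "0 \<le> E" "E \<le> \<delta>"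
      and close: "\<forall>y. \<bar>u0 y - U y\<bar> \<le> E * exp (- \<kappa> * max y 0)" "\<forall>y. \<bar>u0' y - U' y\<bar> \<le> E * exp (- \<kappa> * max y 0)"
    interpret cc: characteristic_coordinates h b U H H' \<beta> \<beta>' u0 u0' um up \<eta> \<mu> \<nu> C L bmin \<kappa> \<omega> E
    proof
      show "um < up" "0 < \<eta>" "0 < \<mu>" "0 < \<nu>" "\<nu> \<le> \<kappa>" using ends_less \<eta>(1) pos \<kappa> by (auto simp: \<nu>_def)
      show "\<bar>h x - h y\<bar> \<le> L * \<bar>x - y\<bar>" if "um - \<eta> / 2 \<le> x" "x < up" "um - \<eta> / 2 \<le> y" "y < up" for x y
        using L(2) that by simp
      show "0 \<le> L" by (rule L)
      show "isCont h w" if "um - \<eta> < w" "w < up" for w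
        using DERIV_isCont[OF h_deriv[of w]] that \<eta>(1) by simp
      show "isCont b w" if "um - \<eta> < w" "w < up" for w using b_cont[of w] that \<eta>(1) by simp
      show "bmin \<le> b w" if "um - \<eta> / 2 \<le> w" "w < up" for w
        using B(3)[of w] that Bpos by (simp add: bmin_def field_simps)
      show "0 < bmin" by (rule bmin)
      show "0 \<le> b up" using b_pos[OF mem(3,4)] by simp
      show "0 \<le> \<omega>" by (rule \<omega>)
      have "\<omega> * b um \<le> \<bar>g' um\<bar> * b um" using \<omega>(2) b_pos[OF mem(1,2)] by (intro mult_right_mono) auto
      also have "\<dots> = \<mu>" using stable(1) am by (simp add: b_def \<mu>_def)
      finally show "\<omega> * b um \<le> \<mu>" .
      have "\<omega> * b up \<le> ((\<kappa> - g' up / \<bar>a up\<bar>) * \<bar>a up\<bar>) * b up" using \<omega>(3) b_pos[OF mem(3,4)] by (intro mult_right_mono) auto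
      also have "\<dots> = \<kappa> - \<nu>" using ap by (simp add: b_def \<nu>_def)
      finally show "\<omega> * b up \<le> \<kappa> - \<nu>" .
      show "\<bar>u0' y - h (U y)\<bar> \<le> E * exp (- \<kappa> * max y 0)" for y using close(2) by (simp add: hU)
      have "E \<le> 1 / (2 * C)" "E \<le> \<eta> / 2" "E \<le> bmin / 2 / D" using E(2) by (auto simp: \<delta>_def)
      then show "2 * C * E \<le> 1" "E \<le> \<eta> / 2" "(C + C * C * C) * (1 + L) * E \<le> bmin / 2"
        using C(1) D unfolding D_def[symmetric] by (simp_all add: field_simps)
    qed (use U_deriv U_range H \<beta> C u0 close E(1) in \<open>simp_all\<close>)
    have bound: "c * E * (exp (2 * C * \<omega>) * e) \<le> A * E * e" if "0 \<le> c" "c \<le> C * C + k" "0 \<le> e" for c e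
    proof -
      have "c * (E * exp (2 * C * \<omega>) * e) \<le> (C * C + k) * (E * exp (2 * C * \<omega>) * e)"
        using that E(1) by (intro mult_right_mono) auto
      then show ?thesis by (simp add: A_def algebra_simps)
    qed
    show "\<exists>w wt wx. continuous_on ({0..} \<times> UNIV) w \<and> C1_half_plane w wt wx \<and> (\<forall>y. w (0, y) = u0 y) \<and>
       (\<forall>z. 0 < fst z \<longrightarrow> wt z + a (w z) * wx z = g (w z)) \<and>
       (\<forall>z. 0 \<le> fst z \<longrightarrow> \<bar>w z - U (snd z)\<bar> \<le> A * E * exp (- \<kappa> * max (snd z) 0 - \<omega> * fst z)) \<and>
       (\<forall>z. 0 \<le> fst z \<longrightarrow> \<bar>wx z - U' (snd z)\<bar> \<le> A * E * exp (- \<kappa> * max (snd z) 0 - \<omega> * fst z))"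
    proof (rule exI[of _ cc.w], rule exI[of _ cc.wt], rule exI[of _ cc.wx], intro conjI allI impI)
      show "continuous_on ({0..} \<times> UNIV) cc.w" by (rule cc.w_continuous)
      show "C1_half_plane cc.w cc.wt cc.wx" by (rule cc.w_C1)
      show "cc.w (0, y) = u0 y" for y by (rule cc.w_initial)
      fix z :: "real \<times> real"
      show "cc.wt z + a (cc.w z) * cc.wx z = g (cc.w z)" if "0 < fst z"
      proof -
        have "a (cc.w z) < 0" using cc.w_dom[of z] that \<eta>(1) by (intro \<eta>(2)) auto
        then show ?thesis by (simp add: cc.wx_def h_def b_def field_simps)
      qed
      show "\<bar>cc.w z - U (snd z)\<bar> \<le> A * E * exp (- \<kappa> * max (snd z) 0 - \<omega> * fst z)" if "0 \<le> fst z"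
        by (rule order_trans[OF cc.w_bound[OF that] bound]) (use k C(1) in auto)
      show "\<bar>cc.wx z - U' (snd z)\<bar> \<le> A * E * exp (- \<kappa> * max (snd z) 0 - \<omega> * fst z)" if z: "0 \<le> fst z"
      proof -
        have "b (cc.w z) \<le> B" using cc.w_dom[OF z] by (intro B(2)) auto
        from cc.wx_bound[OF z this B(1)] have "\<bar>cc.wx z - U' (snd z)\<bar> \<le> k * E * (exp (2 * C * \<omega>) * exp (- \<kappa> * max (snd z) 0 - \<omega> * fst z))"
          unfolding hU k_def .
        then show ?thesis by (rule order_trans[OF _ bound]) (use k C(1) in auto)
      qed
    qed
  qed
qed

end

context profile_setting
begin

text \<open>If \<open>up\<close> lies below \<open>um\<close>, the reflected wave increases and
  solves the equation with a (- v) and - g (- v). The derivative of the latter is g' (- v), so the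
  signs at the endstates and the rates are unchanged.\<close>

lemma stable_profile:
  assumes \<kappa>: "g' up / \<bar>a up\<bar> \<le> \<kappa>"
    and \<omega>: "0 \<le> \<omega>" "\<omega> \<le> \<bar>g' um\<bar>" "\<omega> \<le> (\<kappa> - g' up / \<bar>a up\<bar>) * \<bar>a up\<bar>"
  shows "\<exists>C>0. \<exists>\<delta>>0. perturbations_decay a g U U' \<kappa> \<omega> C \<delta>"
proof (cases "um < up")
  case True
  then interpret increasing_profile by unfold_locales
  show ?thesis by (rule stable_profile_increasing[OF assms])
next
  case False
  then have less: "- um < - up" using ends_ne by linarith
  have neg: "((\<lambda>v. k (- v)) has_real_derivative - k' (- v)) (at v)" if "\<And>v. (k has_real_derivative k' v) (at v)" for k k' :: "real \<Rightarrow> real" and v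
    by (rule DERIV_cong[OF DERIV_chain2[OF that]]) (auto intro!: derivative_eq_intros)
  interpret r: increasing_profile "\<lambda>v. a (- v)" "\<lambda>v. - a' (- v)" "\<lambda>v. a'' (- v)" "\<lambda>v. - g (- v)" "\<lambda>v. g' (- v)"
    "\<lambda>v. - g'' (- v)" "\<lambda>x. - U x" "\<lambda>x. - U' x" "- um" "- up"
  proof
    show "((\<lambda>v. a (- v)) has_real_derivative - a' (- v)) (at v)" for v by (rule neg[OF a(1)])
    show "((\<lambda>v. - a' (- v)) has_real_derivative a'' (- v)) (at v)" for v
      using DERIV_minus[OF neg[OF a(2)], of v] by simp
    show "((\<lambda>v. - g (- v)) has_real_derivative g' (- v)) (at v)" for v
      using DERIV_minus[OF neg[OF g(1)], of v] by simp
    show "((\<lambda>v. g' (- v)) has_real_derivative - g'' (- v)) (at v)" for v by (rule neg[OF g(2)])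
    show "((\<lambda>x. - U x) has_real_derivative - U' x) (at x)" for x by (rule DERIV_minus[OF U(1)])
    show "continuous_on UNIV (\<lambda>x. - U' x)" by (rule continuous_on_minus[OF U(2)])
    show "((\<lambda>x. - U x) \<longlongrightarrow> - um) at_bot" "((\<lambda>x. - U x) \<longlongrightarrow> - up) at_top"
      by (rule tendsto_minus[OF lim(1)], rule tendsto_minus[OF lim(2)])
  qed (use ode nonchar stable less in auto)
  have "\<exists>C>0. \<exists>\<delta>>0. perturbations_decay (\<lambda>v. a (- v)) (\<lambda>v. - g (- v)) (\<lambda>x. - U x) (\<lambda>x. - U' x) \<kappa> \<omega> C \<delta>"
    by (rule r.stable_profile_increasing) (use assms in simp_all)
  then obtain C \<delta> where C: "0 < C" "0 < \<delta>"
    and main: "perturbations_decay (\<lambda>v. a (- v)) (\<lambda>v. - g (- v)) (\<lambda>x. - U x) (\<lambda>x. - U' x) \<kappa> \<omega> C \<delta>"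
    by (elim exE conjE)
  show ?thesis
    unfolding perturbations_decay_def
  proof (rule exI[of _ C], rule conjI, rule C(1), rule exI[of _ \<delta>], rule conjI, rule C(2), intro allI impI, elim conjE)
    fix u0 u0' :: "real \<Rightarrow> real" and E
    assume u0: "\<forall>y. (u0 has_real_derivative u0' y) (at y)" "continuous_on UNIV u0'"
      and E: "0 \<le> E" "E \<le> \<delta>"
      and close: "\<forall>y. \<bar>u0 y - U y\<bar> \<le> E * exp (- \<kappa> * max y 0)" "\<forall>y. \<bar>u0' y - U' y\<bar> \<le> E * exp (- \<kappa> * max y 0)"
    have sw: "\<bar>- x - - y\<bar> = \<bar>x - y\<bar>" "\<bar>- x - y\<bar> = \<bar>x - - y\<bar>" for x y :: real by linarith+
    obtain w wt wx where w: "continuous_on ({0..} \<times> UNIV) w" "C1_half_plane w wt wx" "\<And>y. w (0, y) = - u0 y"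
       "\<And>z. 0 < fst z \<Longrightarrow> wt z + a (- w z) * wx z = - g (- w z)"
       "\<And>z. 0 \<le> fst z \<Longrightarrow> \<bar>w z - - U (snd z)\<bar> \<le> C * E * exp (- \<kappa> * max (snd z) 0 - \<omega> * fst z)"
       "\<And>z. 0 \<le> fst z \<Longrightarrow> \<bar>wx z - - U' (snd z)\<bar> \<le> C * E * exp (- \<kappa> * max (snd z) 0 - \<omega> * fst z)"
    proof (rule perturbations_decayD[OF main, of "\<lambda>y. - u0 y" "\<lambda>y. - u0' y" E])
      show "((\<lambda>y. - u0 y) has_real_derivative - u0' y) (at y)" for y using u0(1) by (intro DERIV_minus) auto
      show "continuous_on UNIV (\<lambda>y. - u0' y)" by (rule continuous_on_minus[OF u0(2)])
      show "\<bar>- u0 y - - U y\<bar> \<le> E * exp (- \<kappa> * max y 0)" "\<bar>- u0' y - - U' y\<bar> \<le> E * exp (- \<kappa> * max y 0)" for y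
        unfolding sw(1) using close by blast+
    qed ((rule E)+, (rule that; assumption))
    show "\<exists>w wt wx. continuous_on ({0..} \<times> UNIV) w \<and> C1_half_plane w wt wx \<and> (\<forall>y. w (0, y) = u0 y) \<and>
       (\<forall>z. 0 < fst z \<longrightarrow> wt z + a (w z) * wx z = g (w z)) \<and>
       (\<forall>z. 0 \<le> fst z \<longrightarrow> \<bar>w z - U (snd z)\<bar> \<le> C * E * exp (- \<kappa> * max (snd z) 0 - \<omega> * fst z)) \<and>
       (\<forall>z. 0 \<le> fst z \<longrightarrow> \<bar>wx z - U' (snd z)\<bar> \<le> C * E * exp (- \<kappa> * max (snd z) 0 - \<omega> * fst z))"
    proof (rule exI[of _ "\<lambda>z. - w z"], rule exI[of _ "\<lambda>z. - wt z"], rule exI[of _ "\<lambda>z. - wx z"], intro conjI allI impI)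
      show "continuous_on ({0..} \<times> UNIV) (\<lambda>z. - w z)" by (rule continuous_on_minus[OF w(1)])
      show "C1_half_plane (\<lambda>z. - w z) (\<lambda>z. - wt z) (\<lambda>z. - wx z)"
        using C1_half_plane_compose[OF w(2) DERIV_minus[OF DERIV_ident] continuous_on_const] by simp
      show "- w (0, y) = u0 y" for y using w(3) by simp
      fix z :: "real \<times> real"
      show "- wt z + a (- w z) * - wx z = g (- w z)" if "0 < fst z"
      proof -
        have "wt z + a (- w z) * wx z = - g (- w z)" by (rule w(4)[OF that])
        then show ?thesis by simp
      qed
      show "\<bar>- w z - U (snd z)\<bar> \<le> C * E * exp (- \<kappa> * max (snd z) 0 - \<omega> * fst z)" if "0 \<le> fst z"
        unfolding sw(2) by (rule w(5)[OF that])
      show "\<bar>- wx z - U' (snd z)\<bar> \<le> C * E * exp (- \<kappa> * max (snd z) 0 - \<omega> * fst z)" if "0 \<le> fst z"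
        unfolding sw(2) by (rule w(6)[OF that])
    qed
  qed
qed

end

section \<open>Return to the original frame and to entropy solutions\<close>

theorem theorem1:
  fixes f g U :: "real \<Rightarrow> real" and \<sigma> um up \<kappa> :: real
  assumes "smooth f" and "smooth g" and "smooth U"
    and "traveling_wave f g U \<sigma> um up"
    and "non_characteristic f U \<sigma> um up"
    and "deriv g um < 0" and "0 < deriv g up"
    and "\<kappa> \<ge> kappa_plus f g \<sigma> up"
  shows "\<exists>C>0. \<exists>\<delta>\<^sub>0>0. \<forall>u\<^sub>0 :: real \<Rightarrow> real.
    BUC1 u\<^sub>0 \<and>
    BUC0 (\<lambda>x. (u\<^sub>0 x - U x) / Omega_plus \<kappa> x) \<and>
    BUC0 (\<lambda>x. deriv (\<lambda>y. u\<^sub>0 y - U y) x / Omega_plus \<kappa> x) \<and>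
    W1inf_norm \<kappa> (\<lambda>x. u\<^sub>0 x - U x) \<le> ennreal \<delta>\<^sub>0 \<longrightarrow>
    (\<exists>u. entropy_solution f g u\<^sub>0 u \<and>
      (\<forall>v. entropy_solution f g u\<^sub>0 v \<longrightarrow> (\<forall>t\<ge>0. AE x in lborel. v t x = u t x)) \<and>
      (\<forall>t\<ge>0. W1inf_norm \<kappa> (\<lambda>x. u t (x + \<sigma> * t) - U x)
         \<le> ennreal C * W1inf_norm \<kappa> (\<lambda>x. u\<^sub>0 x - U x)
             * ennreal (exp (- t * decay_rate f g \<sigma> um up \<kappa>))))"
proof -
  note sf = smooth_has_deriv[OF assms(1)] smooth_has_deriv[OF smooth_deriv[OF assms(1)]]
    smooth_has_deriv[OF smooth_deriv[OF smooth_deriv[OF assms(1)]]]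
  note sg = smooth_has_deriv[OF assms(2)] smooth_has_deriv[OF smooth_deriv[OF assms(2)]]
  note sU = smooth_has_deriv[OF assms(3)]
  have U'_cont: "continuous_on UNIV (deriv U)" by (rule smooth_continuous_on[OF smooth_deriv[OF assms(3)]])
  have lim: "(U \<longlongrightarrow> um) at_bot" "(U \<longlongrightarrow> up) at_top"
    and wave: "entropy_solution f g U (\<lambda>t x. U (x - \<sigma> * t))"
    using assms(4) by (auto simp: traveling_wave_def)
  obtain MU where MU: "\<And>x. \<bar>U x\<bar> \<le> MU" using bounded_of_limits[OF smooth_continuous_on[OF assms(3)] lim] by blast
  define a where "a v = deriv f v - \<sigma>" for v
  have ode: "a (U x) * deriv U x = g (U x)" for x
    unfolding a_def
    by (rule profile_equation[OF sf(1) smooth_continuous_on[OF smooth_deriv[OF assms(1)]]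
          smooth_continuous_on[OF assms(2)] sU U'_cont MU wave])
  interpret profile_setting a "deriv (deriv f)" "deriv (deriv (deriv f))" g "deriv g" "deriv (deriv g)" U "deriv U" um up
  proof
    show "(a has_real_derivative deriv (deriv f) v) (at v)" for v
      unfolding a_def[abs_def] using DERIV_diff[OF sf(2) DERIV_const] by simp
    show "a (U x) \<noteq> 0" "a um \<noteq> 0" "a up \<noteq> 0" for x
      using assms(5) by (auto simp: non_characteristic_def a_def)
  qed (rule sf sg sU U'_cont ode lim assms)+
  obtain MU' where MU': "\<And>x. \<bar>deriv U x\<bar> \<le> MU'" using U_bounded(2) by blast
  define \<omega> where "\<omega> = decay_rate f g \<sigma> um up \<kappa>"
  have \<kappa>: "deriv g up / \<bar>a up\<bar> \<le> \<kappa>" using assms(8) by (simp add: kappa_plus_def a_def)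
  have \<omega>: "0 \<le> \<omega>" "\<omega> \<le> \<bar>deriv g um\<bar>" "\<omega> \<le> (\<kappa> - deriv g up / \<bar>a up\<bar>) * \<bar>a up\<bar>"
    using \<kappa> by (auto simp: \<omega>_def decay_rate_def kappa_plus_def a_def)
  obtain C \<delta> where C: "0 < C" "0 < \<delta>" and decay: "perturbations_decay a g U (deriv U) \<kappa> \<omega> C \<delta>"
    using stable_profile[OF \<kappa> \<omega>] by blast
  obtain F where F: "\<And>r. (F has_real_derivative f r) (at r)"
    using continuous_on_antiderivative[OF smooth_continuous_on[OF assms(1)]] by blast
  show ?thesis
  \<comment> \<open>The factor 2 is the price of estimating pairs by their entries in
    \<open>W1inf_norm_le\<close>; the entry 1 covers t = 0.\<close>
  proof (rule exI[of _ "max 1 (2 * C)"], rule conjI, simp, rule exI[of _ \<delta>], rule conjI, rule C(2), intro allI impI, elim conjE)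
    fix u0 :: "real \<Rightarrow> real"
    assume BUC: "BUC1 u0" and small: "W1inf_norm \<kappa> (\<lambda>x. u0 x - U x) \<le> ennreal \<delta>"
    have u0: "(u0 has_real_derivative deriv u0 x) (at x)" for x
      using BUC by (simp add: BUC1_def DERIV_deriv_iff_real_differentiable)
    have u0'_cont: "continuous_on UNIV (deriv u0)"
      using BUC by (auto simp: BUC1_def BUC0_def intro: uniformly_continuous_imp_continuous)
    define E where "E = enn2real (W1inf_norm \<kappa> (\<lambda>x. u0 x - U x))"
    have "W1inf_norm \<kappa> (\<lambda>x. u0 x - U x) < top" using small ennreal_less_top le_less_trans by blast
    then have norm0: "W1inf_norm \<kappa> (\<lambda>x. u0 x - U x) = ennreal E" by (simp add: E_def)
    have E: "0 \<le> E" "E \<le> \<delta>" using small C(2) unfolding norm0 by (auto simp: E_def)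
    have v0: "((\<lambda>x. u0 x - U x) has_real_derivative deriv u0 x - deriv U x) (at x)" for x
      by (rule DERIV_diff[OF u0 sU])
    note close = W1inf_norm_bounds_le[OF v0 continuous_on_diff[OF u0'_cont U'_cont] norm0 E(1), unfolded Omega_plus_eq]
    obtain w wt wx where w: "continuous_on ({0..} \<times> UNIV) w" "C1_half_plane w wt wx" "\<And>y. w (0, y) = u0 y"
       "\<And>z. 0 < fst z \<Longrightarrow> wt z + a (w z) * wx z = g (w z)"
       "\<And>z. 0 \<le> fst z \<Longrightarrow> \<bar>w z - U (snd z)\<bar> \<le> C * E * exp (- \<kappa> * max (snd z) 0 - \<omega> * fst z)"
       "\<And>z. 0 \<le> fst z \<Longrightarrow> \<bar>wx z - deriv U (snd z)\<bar> \<le> C * E * exp (- \<kappa> * max (snd z) 0 - \<omega> * fst z)"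
      by (rule perturbations_decayD[OF decay u0 u0'_cont E close]) (rule that; assumption)
    \<comment> \<open>The change to the moving frame. Composition with it adds - \<sigma> times the
      space derivative to the time derivative, which turns a = f' - \<sigma> back into f'.\<close>
    define l where "l z = (fst z, snd z - \<sigma> * fst z)" for z :: "real \<times> real"
    define u where "u t x = w (l (t, x))" for t x
    have uw: "u (fst z) (snd z) = w (l z)" for z by (simp add: u_def)
    have l_cont: "continuous_on A l" for A unfolding l_def[abs_def] by (intro continuous_intros)
    have l_der: "(l has_derivative (\<lambda>v. (fst v, snd v - \<sigma> * fst v))) (at z)" for z
      unfolding l_def[abs_def] by (auto intro!: derivative_eq_intros)
    have w_grad: "has_gradient w (wt z) (wx z) z" if "0 < fst z" for z
      using w(2) that unfolding C1_half_plane_def by blast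
    have weight: "0 \<le> C * E" "exp (- \<kappa> * max y 0 - \<omega> * t) \<le> 1" if "0 \<le> t" for y t
    proof -
      have "0 \<le> \<kappa>" using \<kappa> stable by (meson abs_ge_zero divide_nonneg_nonneg less_imp_le order_trans)
      then have "0 \<le> \<kappa> * max y 0" "0 \<le> \<omega> * t" using \<omega>(1) that by auto
      then show "exp (- \<kappa> * max y 0 - \<omega> * t) \<le> 1" by simp
      show "0 \<le> C * E" using C E by simp
    qed
    interpret sol: classical_solution f "deriv f" "deriv (deriv f)" g "deriv g" F u
      "\<lambda>z. wt (l z) - \<sigma> * wx (l z)" "\<lambda>z. wx (l z)" "MU + C * E" "MU' + C * E"
    proof
      show "continuous_on UNIV (deriv (deriv f))" "continuous_on UNIV (deriv g)"
        by (rule smooth_continuous_on, intro smooth_deriv assms)+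
      show "continuous_on ({0..} \<times> UNIV) (\<lambda>z. u (fst z) (snd z))"
        unfolding uw by (rule continuous_on_compose2[OF w(1) l_cont]) (auto simp: l_def)
      show "C1_half_plane (\<lambda>z. u (fst z) (snd z)) (\<lambda>z. wt (l z) - \<sigma> * wx (l z)) (\<lambda>z. wx (l z))"
        unfolding C1_half_plane_def uw
      proof (intro conjI allI impI)
        fix z :: "real \<times> real" assume "0 < fst z"
        then have "has_gradient w (wt (l z)) (wx (l z)) (l z)" by (intro w_grad) (simp add: l_def)
        from has_derivative_compose[OF l_der this]
        show "has_gradient (\<lambda>z. w (l z)) (wt (l z) - \<sigma> * wx (l z)) (wx (l z)) z"
          by (rule has_derivative_eq_rhs) (auto simp: fun_eq_iff algebra_simps)
      next
        have c: "continuous_on ({0<..} \<times> UNIV) (\<lambda>z. k (l z))" if "continuous_on ({0<..} \<times> UNIV) k" for k :: "real \<times> real \<Rightarrow> real"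
          by (rule continuous_on_compose2[OF that l_cont]) (auto simp: l_def)
        show "continuous_on ({0<..} \<times> UNIV) (\<lambda>z. wx (l z))" by (rule c[OF C1_half_plane_continuous(3)[OF w(2)]])
        show "continuous_on ({0<..} \<times> UNIV) (\<lambda>z. wt (l z) - \<sigma> * wx (l z))"
          by (intro continuous_on_diff continuous_on_mult_left c C1_half_plane_continuous[OF w(2)])
      qed
      show "wt (l z) - \<sigma> * wx (l z) + deriv f (u (fst z) (snd z)) * wx (l z) = g (u (fst z) (snd z))" if "0 < fst z" for z
        using w(4)[of "l z"] that unfolding uw a_def by (simp add: l_def algebra_simps)
      show "\<bar>u t x\<bar> \<le> MU + C * E" if t: "0 \<le> t" for t x
      proof -
        have "\<bar>w (l (t, x)) - U (x - \<sigma> * t)\<bar> \<le> C * E * exp (- \<kappa> * max (x - \<sigma> * t) 0 - \<omega> * t)"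
          using w(5)[of "l (t, x)"] t by (simp add: l_def)
        also have "\<dots> \<le> C * E" by (rule mult_left_le[OF weight(2)[OF t] weight(1)[OF t]])
        finally show ?thesis using MU[of "x - \<sigma> * t"] unfolding u_def by linarith
      qed
      show "\<bar>wx (l z)\<bar> \<le> MU' + C * E" if z: "0 < fst z" for z
      proof -
        have t: "0 \<le> fst z" using z by simp
        have "\<bar>wx (l z) - deriv U (snd z - \<sigma> * fst z)\<bar> \<le> C * E * exp (- \<kappa> * max (snd z - \<sigma> * fst z) 0 - \<omega> * fst z)"
          using w(6)[of "l z"] t by (simp add: l_def)
        also have "\<dots> \<le> C * E" by (rule mult_left_le[OF weight(2)[OF t] weight(1)[OF t]])
        finally show ?thesis using MU'[of "snd z - \<sigma> * fst z"] by linarith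
      qed
    qed (rule F sf sg)+
    have u_0: "u 0 = u0" by (rule ext) (simp add: u_def l_def w(3))
    show "\<exists>u. entropy_solution f g u0 u \<and>
      (\<forall>v. entropy_solution f g u0 v \<longrightarrow> (\<forall>t\<ge>0. AE x in lborel. v t x = u t x)) \<and>
      (\<forall>t\<ge>0. W1inf_norm \<kappa> (\<lambda>x. u t (x + \<sigma> * t) - U x)
         \<le> ennreal (max 1 (2 * C)) * W1inf_norm \<kappa> (\<lambda>x. u0 x - U x)
             * ennreal (exp (- t * decay_rate f g \<sigma> um up \<kappa>)))"
    proof (rule exI[of _ u], intro conjI allI impI)
      show "entropy_solution f g u0 u" using sol.entropy_solution_self by (simp add: u_0)
      show "AE x in lborel. v t x = u t x" if "entropy_solution f g u0 v" "0 \<le> t" for v t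
        using sol.entropy_solution_unique[of v t] that by (simp add: u_0)
      fix t :: real assume t: "0 \<le> t"
      have rhs: "ennreal (max 1 (2 * C)) * W1inf_norm \<kappa> (\<lambda>x. u0 x - U x) * ennreal (exp (- t * decay_rate f g \<sigma> um up \<kappa>))
          = ennreal (max 1 (2 * C) * E * exp (- t * \<omega>))"
        unfolding norm0 \<omega>_def using E(1) by (simp add: ennreal_mult)
      have us: "u t (x + \<sigma> * t) = w (t, x)" for x by (simp add: u_def l_def)
      show "W1inf_norm \<kappa> (\<lambda>x. u t (x + \<sigma> * t) - U x)
         \<le> ennreal (max 1 (2 * C)) * W1inf_norm \<kappa> (\<lambda>x. u0 x - U x)
             * ennreal (exp (- t * decay_rate f g \<sigma> um up \<kappa>))"
      \<comment> \<open>The gradient of \<open>w\<close> is provided for t > 0; at t = 0 the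
        perturbation is the initial one and the exponential equals 1.\<close>
      proof (cases "t = 0")
        case True
        have "1 * E \<le> max 1 (2 * C) * E" using E(1) by (intro mult_right_mono) auto
        then show ?thesis unfolding rhs us using True w(3) norm0 by (simp add: ennreal_leI)
      next
        case False
        with t have tpos: "0 < t" by simp
        have "W1inf_norm \<kappa> (\<lambda>x. w (t, x) - U x) \<le> ennreal (2 * (C * E * exp (- t * \<omega>)))"
        proof (rule W1inf_norm_le)
          have "has_gradient w (wt (t, x)) (wx (t, x)) (t, x)" for x using tpos by (intro w_grad) simp
          then show "((\<lambda>x. w (t, x) - U x) has_real_derivative wx (t, x) - deriv U x) (at x)" for x
            by (intro DERIV_diff has_gradient_partials(2) sU)
          have "continuous_on UNIV (\<lambda>x. (t, x :: real))" by (intro continuous_on_Pair continuous_on_const continuous_on_id)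
          from continuous_on_compose2[OF C1_half_plane_continuous(3)[OF w(2)] this]
          have "continuous_on UNIV (\<lambda>x. wx (t, x))" using tpos by (simp add: image_subset_iff)
          then show "continuous_on UNIV (\<lambda>x. wx (t, x) - deriv U x)" by (rule continuous_on_diff[OF _ U'_cont])
          have e: "exp (- \<kappa> * max x 0 - \<omega> * t) = exp (- t * \<omega>) * Omega_plus \<kappa> x" for x
            unfolding Omega_plus_eq exp_add[symmetric] by (simp add: algebra_simps)
          show "\<bar>w (t, x) - U x\<bar> \<le> C * E * exp (- t * \<omega>) * Omega_plus \<kappa> x"
            "\<bar>wx (t, x) - deriv U x\<bar> \<le> C * E * exp (- t * \<omega>) * Omega_plus \<kappa> x" for x
            using w(5)[of "(t, x)"] w(6)[of "(t, x)"] t unfolding fst_conv snd_conv e by (simp_all add: mult.assoc)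
        qed
        also have "\<dots> \<le> ennreal (max 1 (2 * C) * E * exp (- t * \<omega>))"
        proof (rule ennreal_leI)
          have "2 * C * (E * exp (- t * \<omega>)) \<le> max 1 (2 * C) * (E * exp (- t * \<omega>))"
            using E(1) by (intro mult_right_mono) auto
          then show "2 * (C * E * exp (- t * \<omega>)) \<le> max 1 (2 * C) * E * exp (- t * \<omega>)" by (simp add: mult.assoc)
        qed
        finally show ?thesis unfolding rhs us .
      qed
    qed
  qed
qed

end
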